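(* Let $\mathcal H$ be a separable complex Hilbert space and assume that $A$ is a subsectorial operator on $\mathcal H$ such that $e^{-tA}$ is trace class for all $t>0$. Suppose that there exist $\alpha,\beta,C_\alpha,C_\beta,t_0>0$ such that for every $t\in(0,t_0)$, $$C_\alpha t^{-\alpha}\le\big|\mathrm{tr}(e^{-tA})\big|\qquad\text{and}\qquad\big\|e^{-tA}\big\|_{\mathrm{tr}}\le C_\beta t^{-\beta}.$$ Then there are $C,\lambda_0>0$ such that for every $\lambda\ge\lambda_0$, $$C\Big(\frac{\lambda}{\log(\lambda)}\Big)^{\alpha}\le\mathcal N_A(\lambda)\le e\,C_\beta\lambda^\beta .$$ If in addition $\beta=\alpha$, then the $\log$ factor can be removed.
   Context: Subsectorial operator: let $\mathcal B$ be a Banach space and $(A,D(A))$ an operator on $\mathcal B$, with resolvent set $\rho(A)$. $A$ is subsectorial of order $\delta>0$ if $-A$ is the infinitesimal generator of a bounded strongly continuous semigroup $(e^{-tA})_{t\ge0}$ and there are $y_0,C_0>0$ such that $\{iy: y\in\mathbb R,|y|\ge y_0\}\subset\rho(A)$ and $\|(A-z)^{-1}\|\le C_0\langle z\rangle^{-\delta}$ for all $z=iy$ with $y\in\mathbb R$, $|y|\ge y_0$, where $\langle z\rangle=(1+|z|^2)^{1/2}$. $A$ is subsectorial if it is subsectorial of order $\delta$ for some $\delta>0$. When $e^{-tA}$ is compact for all $t>0$, $A$ has discrete spectrum. For $z_j\in\mathrm{Sp}(A)$, the algebraic multiplicity $\mathrm{mult}(z_j)$ is the rank of the Riesz projector $\frac{i}{2\pi}\oint_{|z-z_j|=\varepsilon}(A-z)^{-1}dz$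 (small counterclockwise circle), and $\mathcal N_A(\lambda)=\sum_{z_j\in\mathrm{Sp}(A),\ \mathrm{Re}(z_j)\le\lambda}\mathrm{mult}(z_j)$. $\|\cdot\|_{\mathrm{tr}}$ is the trace class norm and $e$ is Euler's number. *)

theory Defs
  imports "HOL-Complex_Analysis.Complex_Analysis"
begin

section \<open>Complex Banach and Hilbert spaces\<close>

class complex_normed_vector = real_normed_vector +
  fixes scaleC :: "complex \<Rightarrow> 'a \<Rightarrow> 'a"  (infixr "*\<^sub>C" 75)
  assumes scaleC_add_right: "c *\<^sub>C (x + y) = c *\<^sub>C x + c *\<^sub>C y"
    and scaleC_add_left: "(c + d) *\<^sub>C x = c *\<^sub>C x + d *\<^sub>C x"
    and scaleC_scaleC: "c *\<^sub>C d *\<^sub>C x = (c * d) *\<^sub>C x"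
    and scaleR_scaleC: "scaleR r x = complex_of_real r *\<^sub>C x"
    and norm_scaleC: "norm (c *\<^sub>C x) = cmod c * norm x"

class complex_banach = complex_normed_vector + complete_space

subclass (in complex_banach) banach ..

text \<open>The inner product is linear in its first argument.\<close>

class complex_inner = complex_normed_vector +
  fixes cinner :: "'a \<Rightarrow> 'a \<Rightarrow> complex"
  assumes cinner_commute: "cinner x y = cnj (cinner y x)"
    and cinner_add_left: "cinner (x + y) z = cinner x z + cinner y z"
    and cinner_scaleC_left: "cinner (c *\<^sub>C x) y = c * cinner x y"
    and cinner_self: "cinner x x = complex_of_real ((norm x)\<^sup>2)"

class complex_hilbert = complex_inner + complex_banach

instantiation complex :: complex_hilbert
begin

definition scaleC_complex_def: "c *\<^sub>C (x::complex) = c * x"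
definition cinner_complex_def: "cinner x y = x * cnj y"

instance
proof
  fix x y z c d :: complex and r :: real
  show "c *\<^sub>C (x + y) = c *\<^sub>C x + c *\<^sub>C y"
    by (simp add: scaleC_complex_def algebra_simps)
  show "(c + d) *\<^sub>C x = c *\<^sub>C x + d *\<^sub>C x"
    by (simp add: scaleC_complex_def algebra_simps)
  show "c *\<^sub>C d *\<^sub>C x = (c * d) *\<^sub>C x"
    by (simp add: scaleC_complex_def)
  show "scaleR r x = complex_of_real r *\<^sub>C x"
    by (simp add: scaleC_complex_def scaleR_conv_of_real)
  show "norm (c *\<^sub>C x) = cmod c * norm x"
    by (simp add: scaleC_complex_def norm_mult)
  show "cinner x y = cnj (cinner y x)"
    by (simp add: cinner_complex_def)
  show "cinner (x + y) z = cinner x z + cinner y z"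
    by (simp add: cinner_complex_def algebra_simps)
  show "cinner (c *\<^sub>C x) y = c * cinner x y"
    by (simp add: cinner_complex_def scaleC_complex_def)
  show "cinner x x = complex_of_real ((norm x)\<^sup>2)"
    by (simp only: cinner_complex_def complex_norm_square)
qed

end

global_interpretation complex_vector:
  vector_space "scaleC :: complex \<Rightarrow> 'a \<Rightarrow> 'a::complex_normed_vector"
proof
  fix x :: 'a
  show "1 *\<^sub>C x = x"
    using scaleR_scaleC[of 1 x] by simp
qed (simp_all add: scaleC_add_right scaleC_add_left scaleC_scaleC)

definition bounded_clinear ::
    "('a::complex_normed_vector \<Rightarrow> 'b::complex_normed_vector) \<Rightarrow> bool" where
  "bounded_clinear T \<longleftrightarrow> bounded_linear T \<and> (\<forall>c x. T (c *\<^sub>C x) = c *\<^sub>C T x)"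

definition op_rank :: "('a::complex_normed_vector \<Rightarrow> 'a) \<Rightarrow> enat" where
  "op_rank T =
     (if \<exists>B. finite B \<and> range T \<subseteq> complex_vector.span B
      then enat (complex_vector.dim (range T)) else \<infinity>)"

section \<open>Trace class operators\<close>

definition cadjoint :: "('a::complex_hilbert \<Rightarrow> 'a) \<Rightarrow> 'a \<Rightarrow> 'a" where
  "cadjoint T = (THE S. \<forall>x y. cinner (T x) y = cinner x (S y))"

definition positive_op :: "('a::complex_hilbert \<Rightarrow> 'a) \<Rightarrow> bool" where
  "positive_op S \<longleftrightarrow>
     bounded_clinear S \<and> (\<forall>x. cinner (S x) x \<in> \<real> \<and> 0 \<le> Re (cinner (S x) x))"

text \<open>The positive square root of \<open>T\<^sup>* T\<close>.\<close>

definition abs_op :: "('a::complex_hilbert \<Rightarrow> 'a) \<Rightarrow> 'a \<Rightarrow> 'a" where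
  "abs_op T = (THE S. positive_op S \<and> S \<circ> S = cadjoint T \<circ> T)"

definition is_onb :: "'a::complex_hilbert set \<Rightarrow> bool" where
  "is_onb E \<longleftrightarrow>
     (\<forall>e\<in>E. norm e = 1) \<and> pairwise (\<lambda>e f. cinner e f = 0) E \<and>
     closure (complex_vector.span E) = UNIV"

text \<open>
  Traces are computed in one arbitrarily chosen orthonormal basis. The trace of a positive
  operator (a value in \<open>[0,\<infinity>]\<close>) and the trace of a trace class operator do not depend on it.
\<close>

definition some_onb :: "'a::complex_hilbert set" where
  "some_onb = (SOME E. is_onb E)"

definition trace_norm :: "('a::complex_hilbert \<Rightarrow> 'a) \<Rightarrow> ennreal" where
  "trace_norm T = (\<Sum>\<^sub>\<infinity>e\<in>some_onb. ennreal (Re (cinner (abs_op T e) e)))"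

definition trace_class :: "('a::complex_hilbert \<Rightarrow> 'a) \<Rightarrow> bool" where
  "trace_class T \<longleftrightarrow> bounded_clinear T \<and> trace_norm T < \<infinity>"

definition op_trace :: "('a::complex_hilbert \<Rightarrow> 'a) \<Rightarrow> complex" where
  "op_trace T = (\<Sum>\<^sub>\<infinity>e\<in>some_onb. cinner (T e) e)"

section \<open>Unbounded operators\<close>

text \<open>
  An unbounded operator is given by its domain \<open>D\<close> and a function \<open>A\<close>; the values of \<open>A\<close>
  outside \<open>D\<close> are irrelevant.
\<close>

definition linear_operator ::
    "'a::complex_normed_vector set \<Rightarrow> ('a \<Rightarrow> 'a) \<Rightarrow> bool" where
  "linear_operator D A \<longleftrightarrow>
     complex_vector.subspace D \<and>
     (\<forall>x\<in>D. \<forall>y\<in>D. A (x + y) = A x + A y) \<and> (\<forall>c. \<forall>x\<in>D. A (c *\<^sub>C x) = c *\<^sub>C A x)"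

definition resolvent ::
    "'a::complex_normed_vector set \<Rightarrow> ('a \<Rightarrow> 'a) \<Rightarrow> complex \<Rightarrow> 'a \<Rightarrow> 'a" where
  "resolvent D A z = inv_into D (\<lambda>x. A x - z *\<^sub>C x)"

definition resolvent_set ::
    "'a::complex_normed_vector set \<Rightarrow> ('a \<Rightarrow> 'a) \<Rightarrow> complex set" where
  "resolvent_set D A =
     {z. bij_betw (\<lambda>x. A x - z *\<^sub>C x) D UNIV \<and> bounded_clinear (resolvent D A z)}"

definition op_spectrum ::
    "'a::complex_normed_vector set \<Rightarrow> ('a \<Rightarrow> 'a) \<Rightarrow> complex set" where
  "op_spectrum D A = - resolvent_set D A"

text \<open>
  The integral \<open>\<i>/(2\<pi>) \<integral> (A - z)\<^sup>-\<^sup>1 dz\<close> over the counterclockwise circle of radius \<open>\<epsilon>\<close>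
  about \<open>z\<^sub>0\<close>, evaluated at a vector. The integrand follows the convention of
  \<open>has_contour_integral\<close>, which is restricted to complex-valued functions.
\<close>

definition riesz_integral ::
    "'a::complex_banach set \<Rightarrow> ('a \<Rightarrow> 'a) \<Rightarrow> complex \<Rightarrow> real \<Rightarrow> 'a \<Rightarrow> 'a" where
  "riesz_integral D A z\<^sub>0 \<epsilon> x =
     (\<i> / (2 * complex_of_real pi)) *\<^sub>C
       integral {0..1} (\<lambda>s. vector_derivative (circlepath z\<^sub>0 \<epsilon>) (at s within {0..1}) *\<^sub>C
                            resolvent D A (circlepath z\<^sub>0 \<epsilon> s) x)"

text \<open>
  At an isolated point of the spectrum the integral is the same for all sufficiently small
  radii, and that common value is the Riesz projector.
\<close>

definition riesz_projector ::
    "'a::complex_banach set \<Rightarrow> ('a \<Rightarrow> 'a) \<Rightarrow> complex \<Rightarrow> 'a \<Rightarrow> 'a" where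
  "riesz_projector D A z\<^sub>0 =
     (THE P. \<forall>\<^sub>F \<epsilon> in at_right 0. riesz_integral D A z\<^sub>0 \<epsilon> = P)"

definition alg_mult ::
    "'a::complex_banach set \<Rightarrow> ('a \<Rightarrow> 'a) \<Rightarrow> complex \<Rightarrow> enat" where
  "alg_mult D A z\<^sub>0 = op_rank (riesz_projector D A z\<^sub>0)"

definition counting_function ::
    "'a::complex_banach set \<Rightarrow> ('a \<Rightarrow> 'a) \<Rightarrow> real \<Rightarrow> ennreal" where
  "counting_function D A l =
     (\<Sum>\<^sub>\<infinity>z\<in>{z \<in> op_spectrum D A. Re z \<le> l}. ennreal_of_enat (alg_mult D A z))"

section \<open>Semigroups and subsectorial operators\<close>

definition c0_semigroup :: "(real \<Rightarrow> 'a::complex_banach \<Rightarrow> 'a) \<Rightarrow> bool" where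
  "c0_semigroup T \<longleftrightarrow>
     (\<forall>t\<ge>0. bounded_clinear (T t)) \<and> T 0 = id \<and>
     (\<forall>s\<ge>0. \<forall>t\<ge>0. T (s + t) = T s \<circ> T t) \<and>
     (\<forall>x. ((\<lambda>t. T t x) \<longlongrightarrow> x) (at_right 0))"

definition is_generator ::
    "'a::complex_banach set \<Rightarrow> ('a \<Rightarrow> 'a) \<Rightarrow> (real \<Rightarrow> 'a \<Rightarrow> 'a) \<Rightarrow> bool" where
  "is_generator D B T \<longleftrightarrow>
     (\<forall>x y. ((\<lambda>h. (T h x - x) /\<^sub>R h) \<longlongrightarrow> y) (at_right 0) \<longleftrightarrow> x \<in> D \<and> y = B x)"

text \<open>
  \<open>exp_semigroup D A T\<close> says that \<open>T t = e\<^sup>-\<^sup>t\<^sup>A\<close> for \<open>t \<ge> 0\<close>: a strongly continuous semigroup is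
  determined by its generator.
\<close>

definition exp_semigroup ::
    "'a::complex_banach set \<Rightarrow> ('a \<Rightarrow> 'a) \<Rightarrow> (real \<Rightarrow> 'a \<Rightarrow> 'a) \<Rightarrow> bool" where
  "exp_semigroup D A T \<longleftrightarrow> c0_semigroup T \<and> is_generator D (\<lambda>x. - A x) T"

definition bounded_semigroup :: "(real \<Rightarrow> 'a::complex_banach \<Rightarrow> 'a) \<Rightarrow> bool" where
  "bounded_semigroup T \<longleftrightarrow> (\<exists>M. \<forall>t\<ge>0. onorm (T t) \<le> M)"

definition japanese_bracket :: "complex \<Rightarrow> real" where
  "japanese_bracket z = sqrt (1 + (cmod z)\<^sup>2)"

definition subsectorial_of_order ::
    "real \<Rightarrow> 'a::complex_banach set \<Rightarrow> ('a \<Rightarrow> 'a) \<Rightarrow> bool" where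
  "subsectorial_of_order \<delta> D A \<longleftrightarrow>
     \<delta> > 0 \<and> linear_operator D A \<and>
     (\<exists>T. exp_semigroup D A T \<and> bounded_semigroup T) \<and>
     (\<exists>y\<^sub>0 > 0. \<exists>C\<^sub>0 > 0. \<forall>y::real. \<bar>y\<bar> \<ge> y\<^sub>0 \<longrightarrow>
        \<i> * complex_of_real y \<in> resolvent_set D A \<and>
        onorm (resolvent D A (\<i> * complex_of_real y))
          \<le> C\<^sub>0 * japanese_bracket (\<i> * complex_of_real y) powr (- \<delta>))"

definition subsectorial :: "'a::complex_banach set \<Rightarrow> ('a \<Rightarrow> 'a) \<Rightarrow> bool" where
  "subsectorial D A \<longleftrightarrow> (\<exists>\<delta> > 0. subsectorial_of_order \<delta> D A)"

end

theory Submission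
  imports Defs "HOL-Computational_Algebra.Fundamental_Theorem_Algebra" "HOL-Real_Asymp.Real_Asymp"
begin

text \<open>
  Consider orthonormal flags of subspaces invariant under the semigroup whose diagonal entries are
  \<open>exp (- s * \<zeta> k)\<close> with \<open>Re (\<zeta> k) \<le> \<Lambda>\<close>. Since \<open>\<Sum>k. \<bar>exp (- \<tau> * \<zeta> k)\<bar>\<close> is at most the trace norm of
  \<open>T \<tau>\<close>, such a flag has at most \<open>exp (\<tau> * \<Lambda>) * \<parallel>T \<tau>\<parallel>\<close> vectors. The length of a maximal flag is
  \<open>N\<^sub>A(\<Lambda>)\<close>, because its Riesz projectors are idempotents that are triangular with respect to the flag;
  the choice \<open>\<tau> = 1 / \<Lambda>\<close> gives the upper bound. By maximality the compression of \<open>T \<tau>\<close> to the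
  orthogonal complement has no eigenvalue of modulus at least \<open>exp (- \<tau> * \<Lambda>)\<close>, and hence
  \<open>\<bar>tr (T (2 * \<tau>))\<bar> \<le> K * N\<^sub>A(\<Lambda>) + exp (- \<tau> * \<Lambda>) * \<parallel>T \<tau>\<parallel>\<close> with a constant \<open>K\<close> for small \<open>\<tau>\<close>. The lower
  bounds follow with \<open>\<tau>\<close> a multiple of \<open>ln \<Lambda> / \<Lambda>\<close>, and of \<open>1 / \<Lambda>\<close> if \<open>\<beta> = \<alpha>\<close>.
\<close>

section \<open>Inner products and orthonormal families\<close>

text \<open>The obstacle is to relate traces to eigenvalues of a non-selfadjoint operator. Since
  \<open>T (2 * \<tau>)\<close> is the square of \<open>T \<tau>\<close>, only traces of squares
  occur: if the eigenvalues of a finite-rank operator have modulus at most r and its nuclear bound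
  is c, its squared eigenvalues sum to at most r * c in modulus. Truncation carries this to the
  limit, so only finite-rank operators need be triangularised completely. One flag is triangular for
  every \<open>T s\<close> at once, so it depends on \<Lambda> alone and \<tau> stays free. The
  spectrum of \<open>A\<close> enters through \<open>J z\<close>, the integral of exp (s * z) *
  \<open>T s\<close> over the unit interval: (A - z) * J z = I - exp z * T 1 for every complex z,
  which turns the resolvent into a Fredholm problem for \<open>T 1\<close>. Relative to the flag and
  its orthogonal complement the resolvent is block triangular. The complement block stays bounded
  near each z0 with Re z0 \<le> \<Lambda>, and the flag block has diagonal entries 1 / (\<zeta> k -
  z); hence the Riesz projectors see only the flag.\<close>

lemma bounded_bilinear_scaleC:
  "bounded_bilinear (scaleC :: complex \<Rightarrow> 'a \<Rightarrow> 'a::complex_normed_vector)"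
proof
  fix a b :: complex and x y :: 'a and r :: real
  show "(a + b) *\<^sub>C x = a *\<^sub>C x + b *\<^sub>C x" "a *\<^sub>C (x + y) = a *\<^sub>C x + a *\<^sub>C y"
    by (simp_all add: scaleC_add_left scaleC_add_right)
  show "(r *\<^sub>R a) *\<^sub>C x = r *\<^sub>R a *\<^sub>C x"
    by (simp only: scaleR_scaleC[of _ x] scaleR_scaleC[of _ "a *\<^sub>C x"] scaleC_scaleC scaleR_conv_of_real)
  show "a *\<^sub>C r *\<^sub>R x = r *\<^sub>R a *\<^sub>C x"
    by (simp only: scaleR_scaleC[of _ x] scaleR_scaleC[of _ "a *\<^sub>C x"] scaleC_scaleC mult.commute)
  show "\<exists>K. \<forall>(a::complex) (x::'a). norm (a *\<^sub>C x) \<le> norm a * norm x * K"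
    by (rule exI[of _ 1]) (simp add: norm_scaleC)
qed

lemmas bounded_linear_scaleC_right = bounded_bilinear.bounded_linear_right[OF bounded_bilinear_scaleC]
lemmas bounded_linear_scaleC_left = bounded_bilinear.bounded_linear_left[OF bounded_bilinear_scaleC]
lemmas tendsto_scaleC [tendsto_intros] = bounded_bilinear.tendsto[OF bounded_bilinear_scaleC]
lemmas continuous_on_scaleC [continuous_intros] =
  bounded_bilinear.continuous_on[OF bounded_bilinear_scaleC]

lemma cinner_add_right: "cinner x (y + z) = cinner x y + cinner x z"
  by (metis cinner_add_left cinner_commute complex_cnj_add)

lemma cinner_scaleC_right: "cinner x (c *\<^sub>C y) = cnj c * cinner x y"
  by (metis cinner_commute cinner_scaleC_left complex_cnj_mult)

lemma cinner_zero_left [simp]: "cinner 0 y = 0"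
  using cinner_scaleC_left[of 0 0 y] by simp

lemma cinner_zero_right [simp]: "cinner x 0 = 0"
  using cinner_scaleC_right[of x 0 0] by simp

lemma cinner_minus_left [simp]: "cinner (- x) y = - cinner x y"
  using cinner_scaleC_left[of "-1" x y] by simp

lemma cinner_minus_right [simp]: "cinner x (- y) = - cinner x y"
  using cinner_scaleC_right[of x "-1" y] by simp

lemma cinner_diff_left: "cinner (x - y) z = cinner x z - cinner y z"
  using cinner_add_left[of x "- y" z] by simp

lemma cinner_diff_right: "cinner x (y - z) = cinner x y - cinner x z"
  using cinner_add_right[of x y "- z"] by simp

lemma cinner_sum_left: "cinner (\<Sum>i\<in>I. f i) y = (\<Sum>i\<in>I. cinner (f i) y)"
  by (induction I rule: infinite_finite_induct) (simp_all add: cinner_add_left)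

lemma cinner_sum_right: "cinner x (\<Sum>i\<in>I. f i) = (\<Sum>i\<in>I. cinner x (f i))"
  by (induction I rule: infinite_finite_induct) (simp_all add: cinner_add_right)

lemma cinner_scaleR_left: "cinner (r *\<^sub>R x) y = of_real r * cinner x y"
  by (simp add: scaleR_scaleC cinner_scaleC_left)

lemma cinner_scaleR_right: "cinner x (r *\<^sub>R y) = of_real r * cinner x y"
  by (simp add: scaleR_scaleC cinner_scaleC_right)

lemma norm_diff_sq:
  fixes x y :: "'a::complex_inner"
  shows "(norm (x - y))\<^sup>2 = (norm x)\<^sup>2 - 2 * Re (cinner x y) + (norm y)\<^sup>2"
proof -
  have "Re (cinner (x - y) (x - y)) = Re (cinner x x) - Re (cinner x y) - Re (cinner y x) + Re (cinner y y)"
    by (simp add: cinner_diff_left cinner_diff_right)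
  moreover have "Re (cinner y x) = Re (cinner x y)"
    by (metis cinner_commute complex_cnj(1) complex.sel(1) complex_surj)
  ultimately show ?thesis
    by (simp add: cinner_self)
qed

lemma norm_add_sq:
  fixes x y :: "'a::complex_inner"
  shows "(norm (x + y))\<^sup>2 = (norm x)\<^sup>2 + 2 * Re (cinner x y) + (norm y)\<^sup>2"
  using norm_diff_sq[of x "- y"] by simp

lemma cinner_bound: "cmod (cinner x y) \<le> norm x * norm (y::'a::complex_inner)"
proof (cases "y = 0")
  case False
  \<comment> \<open>\<open>c *\<^sub>C y\<close> is the orthogonal projection of \<open>x\<close>
    onto the line of \<open>y\<close>; the claim is that its squared distance to \<open>x\<close> is
    nonnegative.\<close>
  define c where "c = cinner x y / of_real ((norm y)\<^sup>2)"
  have ny: "norm y > 0" using False by simp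
  have "0 \<le> (norm (x - c *\<^sub>C y))\<^sup>2" by simp
  also have "\<dots> = (norm x)\<^sup>2 - 2 * Re (cnj c * cinner x y) + (cmod c)\<^sup>2 * (norm y)\<^sup>2"
    by (simp add: norm_diff_sq cinner_scaleC_right norm_scaleC power_mult_distrib)
  also have "cnj c * cinner x y = of_real ((cmod (cinner x y))\<^sup>2 / (norm y)\<^sup>2)"
    by (simp only: c_def complex_cnj_divide complex_cnj_complex_of_real of_real_divide
        complex_norm_square times_divide_eq_left times_divide_eq_right mult.commute)
  also have "(cmod c)\<^sup>2 * (norm y)\<^sup>2 = (cmod (cinner x y))\<^sup>2 / (norm y)\<^sup>2"
  proof -
    have "cmod c = cmod (cinner x y) / (norm y)\<^sup>2"
      by (simp add: c_def norm_divide norm_power)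
    then show ?thesis using ny by (simp add: field_simps power2_eq_square)
  qed
  finally have "(cmod (cinner x y))\<^sup>2 / (norm y)\<^sup>2 \<le> (norm x)\<^sup>2" by simp
  then have "(cmod (cinner x y))\<^sup>2 \<le> (norm x * norm y)\<^sup>2"
    using ny by (simp add: field_simps power_mult_distrib)
  then show ?thesis by (rule power2_le_imp_le) simp
qed simp

lemma bounded_linear_cinner_left: "bounded_linear (\<lambda>x. cinner x (y::'a::complex_inner))"
  by (rule bounded_linear_intro[where K = "norm y"])
     (auto simp: cinner_add_left cinner_scaleR_left cinner_bound scaleR_conv_of_real)

lemma bounded_bilinear_cinner: "bounded_bilinear (cinner :: 'a \<Rightarrow> 'a::complex_inner \<Rightarrow> complex)"
  by (unfold_locales; (intro exI[of _ 1])?)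
     (auto simp: cinner_add_left cinner_add_right cinner_scaleR_left cinner_scaleR_right
       cinner_bound scaleR_conv_of_real)

lemmas tendsto_cinner [tendsto_intros] = bounded_bilinear.tendsto[OF bounded_bilinear_cinner]
lemmas continuous_on_cinner [continuous_intros] =
  bounded_bilinear.continuous_on[OF bounded_bilinear_cinner]

lemma cinner_eq_zero_iff: "cinner x x = 0 \<longleftrightarrow> x = (0::'a::complex_inner)"
  by (simp add: cinner_self)

lemma cinner_ext: "(\<And>y. cinner x y = cinner x' y) \<Longrightarrow> x = (x'::'a::complex_inner)"
  using cinner_eq_zero_iff[of "x - x'"] by (simp add: cinner_diff_left)

lemma cinner_ext_right: "(\<And>x. cinner x y = cinner x y') \<Longrightarrow> y = (y'::'a::complex_inner)"
  using cinner_eq_zero_iff[of "y - y'"] by (simp add: cinner_diff_right)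

lemma cinner_eq_0_commute: "cinner x y = 0 \<longleftrightarrow> cinner y x = 0"
  by (metis cinner_commute complex_cnj_zero_iff)

section \<open>Complex-linear maps and bounded operators\<close>

abbreviation clinear :: "('a::complex_normed_vector \<Rightarrow> 'b::complex_normed_vector) \<Rightarrow> bool" where
  "clinear \<equiv> Vector_Spaces.linear scaleC scaleC"

lemma clinearI:
  "(\<And>x y. S (x + y) = S x + S y) \<Longrightarrow> (\<And>c x. S (c *\<^sub>C x) = c *\<^sub>C S x) \<Longrightarrow> clinear S"
  by (simp add: Vector_Spaces.linear_def module_hom_def module_hom_axioms_def
      complex_vector.module_axioms complex_vector.vector_space_axioms)

lemma clinear_add: "clinear S \<Longrightarrow> S (x + y) = S x + S y"
  and clinear_scale: "clinear S \<Longrightarrow> S (c *\<^sub>C x) = c *\<^sub>C S x"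
  by (simp_all add: Vector_Spaces.linear_def module_hom_def module_hom_axioms_def)

lemma clinear_zero: "clinear S \<Longrightarrow> S 0 = 0"
  using clinear_scale[of S 0 0] by simp

lemma clinear_minus: "clinear S \<Longrightarrow> S (- x) = - S x"
  using clinear_scale[of S "-1" x] by simp

lemma clinear_diff: "clinear S \<Longrightarrow> S (x - y) = S x - S y"
  using clinear_add[of S x "- y"] by (simp add: clinear_minus)

lemma clinear_sum: "clinear S \<Longrightarrow> S (\<Sum>i\<in>I. f i) = (\<Sum>i\<in>I. S (f i))"
  by (induction I rule: infinite_finite_induct) (simp_all add: clinear_zero clinear_add)

lemma bounded_clinear_bounded_linear: "bounded_clinear T \<Longrightarrow> bounded_linear T"
  by (simp add: bounded_clinear_def)

lemma bounded_clinear_clinear: "bounded_clinear T \<Longrightarrow> clinear T"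
  by (rule clinearI) (auto simp: bounded_clinear_def linear_simps)

lemma bounded_clinearI:
  assumes "\<And>x y. S (x + y) = S x + S y" "\<And>c x. S (c *\<^sub>C x) = c *\<^sub>C S x"
    "\<And>x. norm (S x) \<le> K * norm x"
  shows "bounded_clinear S"
  unfolding bounded_clinear_def
  by (auto intro!: bounded_linear_intro[where K = K] simp: assms scaleR_scaleC mult.commute)

lemma bounded_clinearI':
  assumes "clinear S" "\<And>x. norm (S x) \<le> K * norm x"
  shows "bounded_clinear S"
  using assms by (intro bounded_clinearI) (auto simp: clinear_add clinear_scale)

lemma bounded_clinear_norm_le: "bounded_clinear T \<Longrightarrow> norm (T x) \<le> onorm T * norm x"
  by (simp add: bounded_clinear_bounded_linear onorm)

lemma onorm_nonneg: "bounded_clinear T \<Longrightarrow> 0 \<le> onorm T"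
  by (simp add: bounded_clinear_bounded_linear onorm_pos_le)

lemma bounded_clinear_compose:
  "bounded_clinear S \<Longrightarrow> bounded_clinear T \<Longrightarrow> bounded_clinear (\<lambda>x. S (T x))"
  by (auto simp: bounded_clinear_def intro: bounded_linear_compose)

lemma bounded_clinear_sub:
  "bounded_clinear S \<Longrightarrow> bounded_clinear T \<Longrightarrow> bounded_clinear (\<lambda>x. S x - T x)"
  by (auto simp: bounded_clinear_def complex_vector.scale_right_diff_distrib intro: bounded_linear_sub)

lemma bounded_clinear_ident: "bounded_clinear (\<lambda>x. x)"
  by (auto simp: bounded_clinear_def bounded_linear_ident)

lemma bounded_clinear_scaleC: "bounded_clinear T \<Longrightarrow> bounded_clinear (\<lambda>x. c *\<^sub>C T x)"
  by (auto simp: bounded_clinear_def scaleC_scaleC mult.commute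
      intro: bounded_linear_compose[OF bounded_linear_scaleC_right])

definition orthosystem :: "'i set \<Rightarrow> ('i \<Rightarrow> 'a::complex_inner) \<Rightarrow> bool" where
  "orthosystem I f \<longleftrightarrow>
     (\<forall>i\<in>I. \<forall>j\<in>I. i \<noteq> j \<longrightarrow> cinner (f i) (f j) = 0) \<and> (\<forall>i\<in>I. f i = 0 \<or> norm (f i) = 1)"

definition orthonormal :: "'i set \<Rightarrow> ('i \<Rightarrow> 'a::complex_inner) \<Rightarrow> bool" where
  "orthonormal I f \<longleftrightarrow> (\<forall>i\<in>I. \<forall>j\<in>I. cinner (f i) (f j) = (if i = j then 1 else 0))"

definition proj :: "('i \<Rightarrow> 'a::complex_inner) \<Rightarrow> 'i set \<Rightarrow> 'a \<Rightarrow> 'a" where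
  "proj f I x = (\<Sum>i\<in>I. cinner x (f i) *\<^sub>C f i)"

lemma norm_one_iff: "norm x = 1 \<longleftrightarrow> cinner x x = (1::complex)"
proof -
  have "cinner x x = 1 \<longleftrightarrow> (norm x)\<^sup>2 = 1"
    unfolding cinner_self by (metis of_real_1 of_real_eq_iff)
  also have "\<dots> \<longleftrightarrow> norm x = 1"
    by (smt (verit) norm_ge_zero power2_eq_1_iff)
  finally show ?thesis by simp
qed

lemma orthonormal_orthosystem: "orthonormal I f \<Longrightarrow> orthosystem I f"
  by (auto simp: orthonormal_def orthosystem_def norm_one_iff)

lemma orthonormal_norm: "orthonormal I f \<Longrightarrow> i \<in> I \<Longrightarrow> norm (f i) = 1"
  by (auto simp: orthonormal_def norm_one_iff)

lemma orthosystem_mono: "orthosystem I f \<Longrightarrow> J \<subseteq> I \<Longrightarrow> orthosystem J f"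
  by (auto simp: orthosystem_def)

lemma orthonormal_mono: "orthonormal I f \<Longrightarrow> J \<subseteq> I \<Longrightarrow> orthonormal J f"
  unfolding orthonormal_def by blast

lemma clinear_proj: "clinear (proj f I)"
  by (rule clinearI)
     (simp_all add: proj_def cinner_add_left cinner_scaleC_left scaleC_add_left sum.distrib
       complex_vector.scale_sum_right)

lemma cinner_proj_basis:
  assumes "orthosystem I f" "finite I" "j \<in> I"
  shows "cinner (proj f I x) (f j) = cinner x (f j)"
proof -
  have "cinner (proj f I x) (f j) = (\<Sum>i\<in>I. cinner x (f i) * cinner (f i) (f j))"
    by (simp add: proj_def cinner_sum_left cinner_scaleC_left)
  also have "\<dots> = (\<Sum>i\<in>I. if i = j then cinner x (f j) * cinner (f j) (f j) else 0)"
    using assms by (intro sum.cong) (auto simp: orthosystem_def)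
  also have "\<dots> = cinner x (f j) * cinner (f j) (f j)"
    using assms by simp
  also have "\<dots> = cinner x (f j)"
    using assms by (auto simp: orthosystem_def norm_one_iff)
  finally show ?thesis .
qed

lemma cinner_proj_left_right: "cinner (proj f I x) y = cinner x (proj f I y)"
proof -
  have "cinner x (proj f I y) = (\<Sum>i\<in>I. cnj (cinner y (f i)) * cinner x (f i))"
    by (simp add: proj_def cinner_sum_right cinner_scaleC_right)
  also have "\<dots> = (\<Sum>i\<in>I. cinner x (f i) * cinner (f i) y)"
    by (intro sum.cong refl) (metis cinner_commute mult.commute)
  finally show ?thesis
    by (simp add: proj_def cinner_sum_left cinner_scaleC_left)
qed

lemma cinner_proj_proj:
  assumes "orthosystem I f" "finite I"
  shows "cinner (proj f I x) (proj f I y) = cinner (proj f I x) y"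
    and "cinner (proj f I x) y = (\<Sum>i\<in>I. cinner x (f i) * cinner (f i) y)"
proof -
  show "cinner (proj f I x) y = (\<Sum>i\<in>I. cinner x (f i) * cinner (f i) y)"
    by (simp add: proj_def cinner_sum_left cinner_scaleC_left)
  have "cinner (proj f I x) (proj f I y) = (\<Sum>i\<in>I. cnj (cinner y (f i)) * cinner (proj f I x) (f i))"
    by (simp add: proj_def[of f I y] cinner_sum_right cinner_scaleC_right)
  also have "\<dots> = (\<Sum>i\<in>I. cinner (f i) y * cinner x (f i))"
    using assms by (intro sum.cong refl) (metis cinner_commute cinner_proj_basis)
  also have "\<dots> = cinner (proj f I x) y"
    by (simp add: proj_def cinner_sum_left cinner_scaleC_left mult.commute)
  finally show "cinner (proj f I x) (proj f I y) = cinner (proj f I x) y" .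
qed

lemma norm_proj_sq:
  assumes "orthosystem I f" "finite I"
  shows "(norm (proj f I x))\<^sup>2 = (\<Sum>i\<in>I. (cmod (cinner x (f i)))\<^sup>2)"
proof -
  have "complex_of_real ((norm (proj f I x))\<^sup>2) = cinner (proj f I x) x"
    using cinner_proj_proj(1)[OF assms, of x x] by (simp add: cinner_self)
  also have "\<dots> = (\<Sum>i\<in>I. cinner x (f i) * cnj (cinner x (f i)))"
    using cinner_proj_proj(2)[OF assms, of x x] by (metis (no_types, lifting) cinner_commute sum.cong)
  also have "\<dots> = complex_of_real (\<Sum>i\<in>I. (cmod (cinner x (f i)))\<^sup>2)"
    by (simp only: of_real_sum complex_norm_square)
  finally show ?thesis using of_real_eq_iff by blast
qed

lemma norm_diff_proj_sq:
  assumes "orthosystem I f" "finite I"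
  shows "(norm (x - proj f I x))\<^sup>2 = (norm x)\<^sup>2 - (\<Sum>i\<in>I. (cmod (cinner x (f i)))\<^sup>2)"
proof -
  have "cinner (proj f I x) x = complex_of_real ((norm (proj f I x))\<^sup>2)"
    using cinner_proj_proj(1)[OF assms, of x x] by (simp add: cinner_self)
  then have "Re (cinner x (proj f I x)) = (norm (proj f I x))\<^sup>2"
    by (metis Re_complex_of_real cinner_proj_left_right)
  then show ?thesis by (simp add: norm_diff_sq norm_proj_sq[OF assms])
qed

lemma bessel:
  assumes "orthosystem I f" "finite I"
  shows "(\<Sum>i\<in>I. (cmod (cinner x (f i)))\<^sup>2) \<le> (norm x)\<^sup>2"
  using norm_diff_proj_sq[OF assms, of x] zero_le_power2[of "norm (x - proj f I x)"] by linarith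

lemma norm_proj_le:
  assumes "orthosystem I f" "finite I"
  shows "norm (proj f I x) \<le> norm x"
  by (rule power2_le_imp_le) (simp_all add: norm_proj_sq[OF assms] bessel[OF assms])

lemma norm_diff_proj_le:
  assumes "orthosystem I f" "finite I"
  shows "norm (x - proj f I x) \<le> norm x"
  by (rule power2_le_imp_le) (simp_all add: norm_diff_proj_sq[OF assms] sum_nonneg)

lemma bounded_clinear_proj:
  "orthosystem I f \<Longrightarrow> finite I \<Longrightarrow> bounded_clinear (proj f I)"
  by (rule bounded_clinearI'[where K = 1]) (auto simp: clinear_proj norm_proj_le)

lemma bounded_clinear_diff_proj:
  "orthosystem I f \<Longrightarrow> finite I \<Longrightarrow> bounded_clinear (\<lambda>x. x - proj f I x)"
  by (intro bounded_clinear_sub bounded_clinear_ident bounded_clinear_proj)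

lemma proj_basis:
  assumes "orthosystem I f" "finite I" "j \<in> I"
  shows "proj f I (f j) = f j"
proof -
  have "proj f I (f j) = (\<Sum>i\<in>I. if i = j then cinner (f j) (f j) *\<^sub>C f j else 0)"
    unfolding proj_def using assms by (intro sum.cong) (auto simp: orthosystem_def)
  also have "\<dots> = f j"
    using assms by (auto simp: orthosystem_def norm_one_iff)
  finally show ?thesis .
qed

lemma proj_fix:
  assumes "orthosystem I f" "finite I" "x \<in> complex_vector.span (f ` I)"
  shows "proj f I x = x"
  using assms(3)
proof (induction rule: complex_vector.span_induct_alt)
  case base
  show ?case by (simp add: clinear_zero clinear_proj)
next
  case (step c u v)
  then show ?case
    using assms(1,2) by (auto simp: clinear_add clinear_scale clinear_proj proj_basis)
qed

lemma proj_in_span: "proj f I x \<in> complex_vector.span (f ` I)"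
  unfolding proj_def
  by (intro complex_vector.span_sum complex_vector.span_scale complex_vector.span_base) auto

lemma proj_proj:
  "orthosystem I f \<Longrightarrow> finite I \<Longrightarrow> proj f I (proj f I x) = proj f I x"
  by (simp add: proj_fix proj_in_span)

text \<open>The complementary projection is a contraction that annihilates \<open>u\<close>, so it
  takes \<open>x - u\<close> to \<open>x - proj f I x\<close>.\<close>

lemma norm_diff_proj_minimal:
  assumes "orthosystem I f" "finite I" "proj f I u = u"
  shows "norm (x - proj f I x) \<le> norm (x - u)"
proof -
  have "x - proj f I x = (x - u) - proj f I (x - u)"
    by (simp add: clinear_diff[OF clinear_proj] assms(3))
  then show ?thesis by (metis norm_diff_proj_le[OF assms(1,2)])
qed

text \<open>Pythagoras; only an inequality because members of the system may be
  \<open>0\<close>.\<close>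

lemma norm_sum_orthosystem:
  assumes "orthosystem I f" "finite I"
  shows "(norm (\<Sum>i\<in>I. c i *\<^sub>C f i))\<^sup>2 \<le> (\<Sum>i\<in>I. (cmod (c i))\<^sup>2)"
  using assms(2,1)
proof (induction I rule: finite_induct)
  case (insert i I)
  have "cinner (f i) (f j) = 0" if "j \<in> I" for j
    using insert that unfolding orthosystem_def by (metis insert_iff)
  then have "cinner (c i *\<^sub>C f i) (\<Sum>i\<in>I. c i *\<^sub>C f i) = 0"
    by (simp add: cinner_sum_right cinner_scaleC_left cinner_scaleC_right)
  moreover have "(norm (c i *\<^sub>C f i))\<^sup>2 \<le> (cmod (c i))\<^sup>2"
  proof -
    have "norm (f i) \<le> 1" using insert.prems by (auto simp: orthosystem_def)
    then show ?thesis
      by (intro power_mono) (auto simp: norm_scaleC mult_left_le)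
  qed
  moreover have "(norm (\<Sum>i\<in>I. c i *\<^sub>C f i))\<^sup>2 \<le> (\<Sum>i\<in>I. (cmod (c i))\<^sup>2)"
    using insert.IH orthosystem_mono[OF insert.prems] by blast
  moreover from calculation(1) have "(norm (\<Sum>i\<in>insert i I. c i *\<^sub>C f i))\<^sup>2
      = (norm (c i *\<^sub>C f i))\<^sup>2 + (norm (\<Sum>i\<in>I. c i *\<^sub>C f i))\<^sup>2"
    using insert.hyps by (simp add: norm_add_sq)
  moreover have "(\<Sum>i\<in>insert i I. (cmod (c i))\<^sup>2) = (cmod (c i))\<^sup>2 + (\<Sum>i\<in>I. (cmod (c i))\<^sup>2)"
    using insert.hyps by simp
  ultimately show ?case by linarith
qed simp

text \<open>One half of Riesz-Fischer: by Pythagoras the tails of the vector series are controlled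
  by the tails of the squared coefficients.\<close>

lemma summable_orthosystem:
  fixes f :: "nat \<Rightarrow> 'a::complex_hilbert"
  assumes f: "orthosystem UNIV f" and c: "summable (\<lambda>n. (cmod (c n))\<^sup>2)"
  shows "summable (\<lambda>n. c n *\<^sub>C f n)"
  unfolding summable_Cauchy
proof (intro allI impI)
  fix e :: real assume e: "e > 0"
  then obtain N where N: "\<And>m n. m \<ge> N \<Longrightarrow> norm (\<Sum>k=m..<n. (cmod (c k))\<^sup>2) < e\<^sup>2"
    using c[unfolded summable_Cauchy] by (meson zero_less_power)
  have "norm (\<Sum>k=m..<n. c k *\<^sub>C f k) < e" if "m \<ge> N" for m n
  proof -
    have "(norm (\<Sum>k=m..<n. c k *\<^sub>C f k))\<^sup>2 \<le> (\<Sum>k=m..<n. (cmod (c k))\<^sup>2)"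
      by (rule norm_sum_orthosystem) (auto intro: orthosystem_mono[OF f])
    also have "\<dots> < e\<^sup>2" using N[OF that, of n] by (simp add: abs_less_iff)
    finally show ?thesis using e by (simp add: power_less_imp_less_base)
  qed
  then show "\<exists>N. \<forall>m\<ge>N. \<forall>n. norm (\<Sum>k=m..<n. c k *\<^sub>C f k) < e" by blast
qed

text \<open>The termination argument for \<open>gram_schmidt\<close> must know that the recursive
  calls under the sum have index below \<open>n\<close>.\<close>

lemmas [fundef_cong] = sum.cong

text \<open>Vectors that depend on their predecessors yield \<open>0\<close>, since \<open>0 /\<^sub>R 0 = 0\<close>.\<close>

fun gram_schmidt :: "(nat \<Rightarrow> 'a::complex_inner) \<Rightarrow> nat \<Rightarrow> 'a" where
  "gram_schmidt y n =
     (let u = y n - (\<Sum>k\<in>{..<n}. cinner (y n) (gram_schmidt y k) *\<^sub>C gram_schmidt y k)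
      in u /\<^sub>R norm u)"

declare gram_schmidt.simps [simp del]

lemma gram_schmidt_proj:
  fixes y :: "nat \<Rightarrow> 'a::complex_inner"
  defines "u n \<equiv> y n - proj (gram_schmidt y) {..<n} (y n)"
  shows "gram_schmidt y n = u n /\<^sub>R norm (u n)"
  by (simp add: gram_schmidt.simps[of y n] Let_def u_def proj_def)

lemma orthosystem_gram_schmidt: "orthosystem UNIV (gram_schmidt y)"
proof -
  have *: "orthosystem {..<n} (gram_schmidt y)" for n
  proof (induction n)
    case (Suc n)
    define u where "u = y n - proj (gram_schmidt y) {..<n} (y n)"
    have g: "gram_schmidt y n = u /\<^sub>R norm u" unfolding u_def by (rule gram_schmidt_proj)
    have "cinner u (gram_schmidt y k) = 0" if "k < n" for k
      using that cinner_proj_basis[OF Suc, of k "y n"] by (simp add: u_def cinner_diff_left)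
    then have "cinner (gram_schmidt y n) (gram_schmidt y k) = 0" if "k < n" for k
      using that by (simp add: g cinner_scaleR_left)
    moreover from this have "cinner (gram_schmidt y k) (gram_schmidt y n) = 0" if "k < n" for k
      using that cinner_eq_0_commute by blast
    moreover have "gram_schmidt y n = 0 \<or> norm (gram_schmidt y n) = 1"
      by (cases "u = 0") (auto simp: g)
    ultimately show ?case
      using Suc by (auto simp: orthosystem_def less_Suc_eq)
  qed (simp add: orthosystem_def)
  show ?thesis
    unfolding orthosystem_def
  proof (intro conjI ballI impI)
    fix i j :: nat assume "i \<noteq> j"
    then show "cinner (gram_schmidt y i) (gram_schmidt y j) = 0"
      using *[of "Suc (max i j)"] by (auto simp: orthosystem_def)
  next
    fix i show "gram_schmidt y i = 0 \<or> norm (gram_schmidt y i) = 1"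
      using *[of "Suc i"] by (auto simp: orthosystem_def)
  qed
qed

lemma gram_schmidt_in_subspace:
  assumes V: "complex_vector.subspace V" and y: "\<And>n. y n \<in> V"
  shows "gram_schmidt y n \<in> V"
proof (induction n rule: less_induct)
  case (less n)
  have "proj (gram_schmidt y) {..<n} (y n) \<in> V"
    unfolding proj_def using less by (intro complex_vector.subspace_sum complex_vector.subspace_scale V) auto
  then show ?case
    by (subst gram_schmidt_proj, subst scaleR_scaleC)
      (intro complex_vector.subspace_scale complex_vector.subspace_diff V y)
qed

lemma proj_gram_schmidt:
  assumes "n < N"
  shows "proj (gram_schmidt y) {..<N} (y n) = y n"
proof (rule proj_fix)
  define u where "u = y n - proj (gram_schmidt y) {..<n} (y n)"
  have "y n = norm u *\<^sub>R gram_schmidt y n + proj (gram_schmidt y) {..<n} (y n)"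
  proof -
    have "gram_schmidt y n = u /\<^sub>R norm u" unfolding u_def by (rule gram_schmidt_proj)
    \<comment> \<open>If \<open>y n\<close> depends on its predecessors, both sides are
      \<open>0\<close>, so the decomposition covers this case as well.\<close>
    then have "norm u *\<^sub>R gram_schmidt y n = u" by (cases "u = 0") simp_all
    then show ?thesis by (simp add: u_def)
  qed
  also have "\<dots> \<in> complex_vector.span (gram_schmidt y ` {..<N})"
    unfolding proj_def scaleR_scaleC using assms
    by (intro complex_vector.span_add complex_vector.span_sum complex_vector.span_scale
        complex_vector.span_base) auto
  finally show "y n \<in> complex_vector.span (gram_schmidt y ` {..<N})" .
qed (auto intro: orthosystem_mono[OF orthosystem_gram_schmidt])

text \<open>From index \<open>Suc n\<close> on, \<open>y n\<close> lies in the space projected onto,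
  and the projection is the best approximation of \<open>x\<close> there.\<close>

lemma tendsto_proj_gram_schmidt:
  assumes "x \<in> closure (range y)"
  shows "(\<lambda>N. proj (gram_schmidt y) {..<N} x) \<longlonglongrightarrow> x"
proof (rule metric_LIMSEQ_I)
  fix e :: real assume "e > 0"
  then obtain n where n: "dist (y n) x < e"
    using assms by (auto simp: closure_approachable)
  have "dist (proj (gram_schmidt y) {..<N} x) x < e" if "N \<ge> Suc n" for N
  proof -
    have "norm (x - proj (gram_schmidt y) {..<N} x) \<le> norm (x - y n)"
      using that by (intro norm_diff_proj_minimal proj_gram_schmidt)
        (auto intro: orthosystem_mono[OF orthosystem_gram_schmidt])
    then show ?thesis using n by (simp add: dist_norm norm_minus_commute)
  qed
  then show "\<exists>N0. \<forall>N\<ge>N0. dist (proj (gram_schmidt y) {..<N} x) x < e" by blast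
qed

section \<open>Separability, orthonormal bases, Parseval's identity and adjoints\<close>

abbreviation separable_type :: "'a::metric_space itself \<Rightarrow> bool" where
  "separable_type _ \<equiv> separable_space (euclidean :: 'a topology)"

lemma separable_dense_sequence:
  assumes "separable_type TYPE('a::metric_space)"
  obtains y :: "nat \<Rightarrow> 'a::metric_space" where "closure (range y) = UNIV"
proof -
  obtain C :: "'a set" where C: "countable C" "closure C = UNIV"
    using assms by (auto simp: separable_space_def)
  then have "C \<noteq> {}" by auto
  then have "range (from_nat_into C) = C" using C(1) by (rule range_from_nat_into)
  then show ?thesis using C(2) that[of "from_nat_into C"] by simp
qed

lemma separable_orthosystem:
  assumes "separable_type TYPE('a::complex_hilbert)"
  obtains h :: "nat \<Rightarrow> 'a::complex_hilbert"
  where "orthosystem UNIV h" "\<And>x. (\<lambda>N. proj h {..<N} x) \<longlonglongrightarrow> x"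
proof -
  obtain y :: "nat \<Rightarrow> 'a" where "closure (range y) = UNIV"
    using separable_dense_sequence[OF assms] .
  then show ?thesis
    using that[OF orthosystem_gram_schmidt[of y]] tendsto_proj_gram_schmidt[of _ y] by simp
qed

text \<open>Makes the choice in \<open>some_onb\<close> meaningful: the nonzero Gram-Schmidt vectors
  of a dense sequence form an orthonormal basis.\<close>

lemma is_onb_some_onb:
  assumes "separable_type TYPE('a::complex_hilbert)"
  shows "is_onb (some_onb :: 'a::complex_hilbert set)"
proof -
  obtain h :: "nat \<Rightarrow> 'a"
    where h: "orthosystem UNIV h" "\<And>x. (\<lambda>N. proj h {..<N} x) \<longlonglongrightarrow> x"
    using separable_orthosystem[OF assms] by blast
  have "is_onb (range h - {0})"
    unfolding is_onb_def
  proof (intro conjI ballI)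
    show "norm e = 1" if "e \<in> range h - {0}" for e
      using h(1) that by (auto simp: orthosystem_def)
    show "pairwise (\<lambda>e f. cinner e f = 0) (range h - {0})"
      using h(1) unfolding orthosystem_def pairwise_def by (metis DiffE UNIV_I imageE)
    have "x \<in> closure (complex_vector.span (range h - {0}))" for x
    proof -
      have "proj h {..<N} x \<in> complex_vector.span (range h - {0})" for N
        unfolding proj_def
      proof (rule complex_vector.span_sum)
        fix i show "cinner x (h i) *\<^sub>C h i \<in> complex_vector.span (range h - {0})"
          by (cases "h i = 0")
             (auto intro!: complex_vector.span_scale[OF complex_vector.span_base] simp: complex_vector.span_zero)
      qed
      then show ?thesis
        unfolding closure_sequential using h(2) by (intro exI[of _ "\<lambda>N. proj h {..<N} x"]) simp
    qed
    then show "closure (complex_vector.span (range h - {0})) = UNIV" by auto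
  qed
  then show ?thesis unfolding some_onb_def by (rule someI)
qed

lemma is_onb_orthonormal: "is_onb E \<Longrightarrow> orthonormal E (\<lambda>e. e)"
  by (auto simp: is_onb_def orthonormal_def pairwise_def norm_one_iff)

text \<open>A finite combination of basis vectors close to \<open>x\<close> determines a finite set
  \<open>F\<close>; for every larger finite set the projection of \<open>x\<close> is at least as
  close, which is convergence along finite subsets.\<close>

lemma parseval:
  fixes x y :: "'a::complex_hilbert"
  assumes E: "is_onb E"
  shows "((\<lambda>e. cinner x e * cinner e y) has_sum cinner x y) E"
  unfolding has_sum_def tendsto_iff
proof (intro allI impI)
  fix e :: real assume e: "e > 0"
  have oE: "orthosystem F (\<lambda>e. e)" if "F \<subseteq> E" for F
    using is_onb_orthonormal[OF E] that by (intro orthonormal_orthosystem) (rule orthonormal_mono)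
  have "x \<in> closure (complex_vector.span E)" using E by (simp add: is_onb_def)
  moreover have "e / (norm y + 1) > 0" using e by (simp add: add_nonneg_pos)
  ultimately obtain u where u: "u \<in> complex_vector.span E" "dist u x < e / (norm y + 1)"
    by (meson closure_approachable)
  then obtain F r where F: "finite F" "F \<subseteq> E" "u = (\<Sum>a\<in>F. r a *\<^sub>C a)"
    by (auto simp: complex_vector.span_explicit)
  have "dist (\<Sum>e\<in>G. cinner x e * cinner e y) (cinner x y) < e"
    if G: "finite G" "F \<subseteq> G" "G \<subseteq> E" for G
  proof -
    have "u \<in> complex_vector.span ((\<lambda>e. e) ` G)"
      unfolding F(3) using G by (intro complex_vector.span_sum complex_vector.span_scale complex_vector.span_base) auto
    then have "proj (\<lambda>e. e) G u = u" using oE[OF G(3)] G(1) by (rule proj_fix[rotated 2])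
    then have "norm (x - proj (\<lambda>e. e) G x) \<le> norm (x - u)"
      by (intro norm_diff_proj_minimal oE G)
    then have *: "norm (proj (\<lambda>e. e) G x - x) < e / (norm y + 1)"
      using u(2) by (simp add: dist_norm norm_minus_commute)
    have "dist (\<Sum>e\<in>G. cinner x e * cinner e y) (cinner x y) = cmod (cinner (proj (\<lambda>e. e) G x - x) y)"
      by (simp add: dist_norm cinner_diff_left cinner_proj_proj(2)[OF oE[OF G(3)] G(1)])
    also have "\<dots> \<le> norm (proj (\<lambda>e. e) G x - x) * norm y" by (rule cinner_bound)
    also have "\<dots> \<le> norm (proj (\<lambda>e. e) G x - x) * (norm y + 1)" by (intro mult_left_mono) auto
    also have "\<dots> < e"
      using * norm_ge_zero[of y] by (subst (asm) pos_less_divide_eq) linarith+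
    finally show ?thesis .
  qed
  then show "\<forall>\<^sub>F G in finite_subsets_at_top E. dist (\<Sum>e\<in>G. cinner x e * cinner e y) (cinner x y) < e"
    unfolding eventually_finite_subsets_at_top using F by blast
qed

lemma parseval_norm:
  fixes x :: "'a::complex_hilbert"
  assumes "is_onb E"
  shows "((\<lambda>e. (cmod (cinner x e))\<^sup>2) has_sum (norm x)\<^sup>2) E"
proof -
  have eq: "cinner x e * cinner e x = of_real ((cmod (cinner x e))\<^sup>2)" for e
    by (metis cinner_commute complex_norm_square)
  have "((\<lambda>e. complex_of_real ((cmod (cinner x e))\<^sup>2)) has_sum of_real ((norm x)\<^sup>2)) E"
    using parseval[OF assms, of x x] unfolding eq cinner_self .
  then show ?thesis using has_sum_of_real_iff by blast
qed

lemma riesz_representation: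
  fixes \<phi> :: "'a::complex_hilbert \<Rightarrow> complex"
  assumes sep: "separable_type TYPE('a)" and \<phi>: "bounded_clinear \<phi>"
  obtains y where "\<And>x. \<phi> x = cinner x y"
proof -
  obtain h :: "nat \<Rightarrow> 'a"
    where h: "orthosystem UNIV h" "\<And>x. (\<lambda>N. proj h {..<N} x) \<longlonglongrightarrow> x"
    using separable_orthosystem[OF sep] by blast
  have lin: "clinear \<phi>" using \<phi> by (rule bounded_clinear_clinear)
  define c where "c n = cnj (\<phi> (h n))" for n
  \<comment> \<open>Test \<open>\<phi>\<close> on the partial sum \<open>v\<close> of the candidate
    vector: \<open>\<phi> v\<close> equals \<open>S\<close>, while the squared norm of
    \<open>v\<close> is at most \<open>S\<close>, so \<open>S\<close> cannot exceed the squared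
    operator norm.\<close>
  have bd: "(\<Sum>n<N. (cmod (c n))\<^sup>2) \<le> (onorm \<phi>)\<^sup>2" for N
  proof -
    define S where "S = (\<Sum>n<N. (cmod (c n))\<^sup>2)"
    define v where "v = (\<Sum>n<N. c n *\<^sub>C h n)"
    have S0: "S \<ge> 0" by (simp add: S_def sum_nonneg)
    have "\<phi> v = (\<Sum>n<N. cnj (\<phi> (h n)) * \<phi> (h n))"
      by (simp add: v_def clinear_sum[OF lin] clinear_scale[OF lin] c_def scaleC_complex_def)
    also have "\<dots> = of_real S"
      unfolding S_def c_def of_real_sum complex_mod_cnj complex_norm_square by (simp add: mult.commute)
    finally have "S = cmod (\<phi> v)" using S0 by simp
    also have "\<dots> \<le> onorm \<phi> * norm v" by (rule bounded_clinear_norm_le[OF \<phi>])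
    finally have "S\<^sup>2 \<le> (onorm \<phi>)\<^sup>2 * (norm v)\<^sup>2"
      using S0 by (metis power_mono power_mult_distrib)
    also have "(norm v)\<^sup>2 \<le> S"
      unfolding v_def S_def by (rule norm_sum_orthosystem) (auto intro: orthosystem_mono[OF h(1)])
    finally have "S * S \<le> (onorm \<phi>)\<^sup>2 * S"
      by (simp add: power2_eq_square mult_left_mono)
    then have "S \<le> (onorm \<phi>)\<^sup>2"
      using S0 by (cases "S = 0") (simp, metis mult_right_le_imp_le order_le_less)
    then show ?thesis by (simp add: S_def)
  qed
  have "summable (\<lambda>n. (cmod (c n))\<^sup>2)"
    by (rule summableI_nonneg_bounded[OF _ bd]) auto
  then have "summable (\<lambda>n. c n *\<^sub>C h n)" by (rule summable_orthosystem[OF h(1)])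
  then obtain y where y: "(\<lambda>n. c n *\<^sub>C h n) sums y" unfolding summable_def by blast
  have "\<phi> x = cinner x y" for x
  proof -
    have "(\<lambda>N. cinner x (\<Sum>n<N. c n *\<^sub>C h n)) \<longlonglongrightarrow> cinner x y"
      using y unfolding sums_def by (intro tendsto_intros)
    also have "(\<lambda>N. cinner x (\<Sum>n<N. c n *\<^sub>C h n)) = (\<lambda>N. \<phi> (proj h {..<N} x))"
      by (simp add: fun_eq_iff proj_def clinear_sum[OF lin] clinear_scale[OF lin] c_def
          scaleC_complex_def cinner_sum_right cinner_scaleC_right mult.commute)
    finally have "(\<lambda>N. \<phi> (proj h {..<N} x)) \<longlonglongrightarrow> cinner x y" .
    moreover have "(\<lambda>N. \<phi> (proj h {..<N} x)) \<longlonglongrightarrow> \<phi> x"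
      by (rule bounded_linear.tendsto[OF bounded_clinear_bounded_linear[OF \<phi>] h(2)])
    ultimately show ?thesis using LIMSEQ_unique by blast
  qed
  then show ?thesis using that by blast
qed

text \<open>Discharges the definite description in \<open>cadjoint\<close>: for each
  \<open>y\<close> the functional \<open>\<lambda>x. cinner (T x) y\<close> has exactly one Riesz
  vector.\<close>

lemma cadjoint:
  fixes T :: "'a::complex_hilbert \<Rightarrow> 'a"
  assumes sep: "separable_type TYPE('a)" and T: "bounded_clinear T"
  shows "cinner (T x) y = cinner x (cadjoint T y)"
proof -
  have "\<exists>z. \<forall>x. cinner (T x) y = cinner x z" for y
  proof -
    have "bounded_clinear (\<lambda>x. cinner (T x) y)"
    proof (rule bounded_clinearI)
      show "norm (cinner (T x) y) \<le> (onorm T * norm y) * norm x" for x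
        using cinner_bound[of "T x" y] mult_right_mono[OF bounded_clinear_norm_le[OF T, of x], of "norm y"]
        by (simp add: mult_ac)
    qed (use bounded_clinear_clinear[OF T] in
        \<open>auto simp: clinear_add clinear_scale cinner_add_left cinner_scaleC_left scaleC_complex_def\<close>)
    then show ?thesis using riesz_representation[OF sep] by metis
  qed
  then obtain S where S: "\<And>x y. cinner (T x) y = cinner x (S y)" by metis
  have "\<forall>x y. cinner (T x) y = cinner x (cadjoint T y)"
    unfolding cadjoint_def
  proof (rule theI[where a = S])
    show "\<forall>x y. cinner (T x) y = cinner x (S y)" by (simp only: S) simp
    show "S' = S" if "\<forall>x y. cinner (T x) y = cinner x (S' y)" for S'
      by (rule ext, rule cinner_ext_right) (metis that S)
  qed
  then show ?thesis by blast
qed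

lemma bounded_clinear_cadjoint:
  fixes T :: "'a::complex_hilbert \<Rightarrow> 'a"
  assumes sep: "separable_type TYPE('a)" and T: "bounded_clinear T"
  shows "bounded_clinear (cadjoint T)"
proof (rule bounded_clinearI)
  note adj = cadjoint[OF sep T, symmetric]
  show "cadjoint T (x + y) = cadjoint T x + cadjoint T y" for x y
    by (rule cinner_ext_right) (simp add: adj cinner_add_right)
  show "cadjoint T (c *\<^sub>C x) = c *\<^sub>C cadjoint T x" for c x
    by (rule cinner_ext_right) (simp add: adj cinner_scaleC_right)
  show "norm (cadjoint T x) \<le> onorm T * norm x" for x
  proof (cases "cadjoint T x = 0")
    case True
    then show ?thesis using onorm_nonneg[OF T] by simp
  next
    case False
    have "complex_of_real ((norm (cadjoint T x))\<^sup>2) = cinner (T (cadjoint T x)) x"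
      by (metis cinner_self adj)
    then have "(norm (cadjoint T x))\<^sup>2 = cmod (cinner (T (cadjoint T x)) x)"
      by (simp flip: \<open>complex_of_real _ = _\<close> add: norm_power)
    also have "\<dots> \<le> norm (T (cadjoint T x)) * norm x" by (rule cinner_bound)
    also have "\<dots> \<le> (onorm T * norm (cadjoint T x)) * norm x"
      by (intro mult_right_mono bounded_clinear_norm_le T) auto
    finally show ?thesis using False by (simp add: power2_eq_square mult_ac)
  qed
qed

section \<open>Square roots of positive operators\<close>

text \<open>Polarisation: the quadratic form is real, and it is expanded at \<open>x + y\<close> and
  at \<open>x + \<i> *\<^sub>C y\<close>.\<close>

lemma positive_op_selfadjoint:
  assumes S: "positive_op S"
  shows "cinner (S x) y = cinner x (S y)"
proof -
  have lin: "clinear S" using S by (auto simp: positive_op_def intro: bounded_clinear_clinear)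
  have real: "cinner (S z) z = cinner z (S z)" for z
    using S unfolding positive_op_def by (metis cinner_commute Reals_cnj_iff)
  have "cinner (S x) y + cinner (S y) x = cinner x (S y) + cinner y (S x)"
    using real[of "x + y"] real[of x] real[of y]
    by (simp add: clinear_add[OF lin] cinner_add_left cinner_add_right algebra_simps)
  moreover have "- (\<i> * cinner (S x) y) + \<i> * cinner (S y) x = - (\<i> * cinner x (S y)) + \<i> * cinner y (S x)"
    using real[of "x + \<i> *\<^sub>C y"] real[of x] real[of y]
    by (simp add: clinear_add[OF lin] clinear_scale[OF lin] cinner_add_left cinner_add_right
        cinner_scaleC_left cinner_scaleC_right algebra_simps)
  then have "\<i> * (- cinner (S x) y + cinner (S y) x) = \<i> * (- cinner x (S y) + cinner y (S x))"
    by (simp add: algebra_simps)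
  then have "- cinner (S x) y + cinner (S y) x = - cinner x (S y) + cinner y (S x)"
    by (metis complex_i_not_zero mult_cancel_left)
  ultimately have "2 * cinner (S x) y = 2 * cinner x (S y)" by algebra
  then show ?thesis by simp
qed

lemma positive_op_bounded: "positive_op S \<Longrightarrow> bounded_clinear S"
  and positive_op_Re_nonneg: "positive_op S \<Longrightarrow> 0 \<le> Re (cinner (S x) x)"
  by (simp_all add: positive_op_def)

text \<open>From \<open>0 \<le> \<langle>B u, u\<rangle>\<close> for \<open>u = x - B x / \<parallel>B\<parallel>\<close>.\<close>

lemma positive_op_norm_sq_le:
  assumes B: "positive_op B" and b: "onorm B \<le> b" "b > 0"
  shows "(norm (B x))\<^sup>2 \<le> b * Re (cinner (B x) x)"
proof -
  have bc: "bounded_clinear B" using B by (rule positive_op_bounded)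
  define y where "y = B x"
  define u where "u = x - (1/b) *\<^sub>R y"
  have lin: "clinear B" using bc by (rule bounded_clinear_clinear)
  have Bu: "B u = y - (1/b) *\<^sub>R B y"
    by (simp add: u_def y_def clinear_diff[OF lin] clinear_scale[OF lin] scaleR_scaleC)
  have yx: "cinner (B y) x = cinner y y"
    by (simp add: positive_op_selfadjoint[OF B] y_def)
  have yy: "Re (cinner y y) = (norm y)\<^sup>2" by (simp add: cinner_self)
  have "cinner (B u) u = cinner y x - (1/b) * cinner y y - (1/b) * cinner y y + (1/b)^2 * cinner (B y) y"
  proof -
    have "cinner (B u) u = cinner (y - (1/b) *\<^sub>R B y) (x - (1/b) *\<^sub>R y)"
      unfolding Bu by (simp add: u_def)
    then show ?thesis
      by (simp add: cinner_diff_left cinner_diff_right cinner_scaleR_left cinner_scaleR_right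
        yx power2_eq_square diff_divide_distrib)
  qed
  then have "Re (cinner (B u) u) = Re (cinner y x) - 2 * (norm y)\<^sup>2 / b + Re (cinner (B y) y) / b\<^sup>2"
    by (simp add: yy power2_eq_square Re_divide_of_real flip: of_real_mult)
  moreover have "Re (cinner (B y) y) \<le> b * (norm y)\<^sup>2"
  proof -
    have "Re (cinner (B y) y) \<le> norm (B y) * norm y"
      using complex_Re_le_cmod cinner_bound order_trans by blast
    also have "\<dots> \<le> (onorm B * norm y) * norm y"
      by (intro mult_right_mono bounded_clinear_norm_le bc) auto
    also have "\<dots> \<le> (b * norm y) * norm y"
      using b by (intro mult_right_mono) auto
    finally show ?thesis by (simp add: power2_eq_square mult_ac)
  qed
  then have "Re (cinner (B y) y) / b\<^sup>2 \<le> (norm y)\<^sup>2 / b"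
    using b by (simp add: field_simps power2_eq_square)
  ultimately have "0 \<le> Re (cinner y x) - (norm y)\<^sup>2 / b"
    using positive_op_Re_nonneg[OF B, of u] by simp
  then show ?thesis using b by (simp add: field_simps y_def)
qed

lemma positive_op_eq_0:
  assumes "positive_op B" "Re (cinner (B x) x) \<le> 0"
  shows "B x = 0"
proof -
  have pos: "onorm B + 1 > 0"
    using onorm_nonneg[OF positive_op_bounded[OF assms(1)]] by linarith
  have "(norm (B x))\<^sup>2 \<le> (onorm B + 1) * Re (cinner (B x) x)"
    using assms(1) pos by (intro positive_op_norm_sq_le) auto
  also have "\<dots> \<le> 0" using assms(2) pos by (simp add: mult_nonneg_nonpos)
  finally show ?thesis by simp
qed

text \<open>The coefficients of the power series of \<open>\<surd>(1 - t)\<close>.\<close>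

definition sqrt_coeff :: "nat \<Rightarrow> real" where
  "sqrt_coeff n = pochhammer (-1/2) n / fact n"

lemma sqrt_coeff_0 [simp]: "sqrt_coeff 0 = 1"
  by (simp add: sqrt_coeff_def)

lemma sqrt_coeff_nonpos: "n > 0 \<Longrightarrow> sqrt_coeff n \<le> 0"
  using pochhammer_nonneg[of "1/2::real"]
  by (cases n) (auto simp: sqrt_coeff_def pochhammer_rec mult_nonpos_nonneg divide_nonpos_pos)

text \<open>The partial sums are the coefficients of (1 - t)^(1/2) / (1 - t) = (1 - t)^(-1/2), which
  are positive.\<close>

lemma sqrt_coeff_partial_sum_nonneg: "(\<Sum>k<N. sqrt_coeff k) \<ge> 0"
proof (cases N)
  case (Suc m)
  have "(\<Sum>k<N. sqrt_coeff k) = (\<Sum>k\<le>m. (1/2 gchoose k) * (-1) ^ k)"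
    unfolding Suc lessThan_Suc_atMost
    by (intro sum.cong refl) (simp add: sqrt_coeff_def gbinomial_pochhammer flip: power_mult_distrib)
  also have "\<dots> = (-1) ^ m * (- 1/2 gchoose m)"
    by (simp add: gbinomial_sum_lower_neg)
  also have "\<dots> = pochhammer (1/2) m / fact m"
    by (simp add: gbinomial_pochhammer flip: power_mult_distrib)
  finally show ?thesis using pochhammer_nonneg[of "1/2::real" m] by simp
qed simp

text \<open>Only the coefficient of index 0 is positive, so for \<open>N > 0\<close> the absolute
  sum is 2 minus the plain sum.\<close>

lemma sqrt_coeff_abs_sum: "(\<Sum>k<N. \<bar>sqrt_coeff k\<bar>) \<le> 2"
proof -
  have "(\<Sum>k<N. \<bar>sqrt_coeff k\<bar>) \<le> 2 - (\<Sum>k<N. sqrt_coeff k)"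
  proof (induction N)
    case (Suc N)
    then show ?case using sqrt_coeff_nonpos[of N] by (cases "N = 0") auto
  qed simp
  then show ?thesis using sqrt_coeff_partial_sum_nonneg[of N] by linarith
qed

lemma sqrt_coeff_abs_summable: "(\<lambda>n. norm (sqrt_coeff n)) summable_on UNIV"
proof (rule norm_summable_imp_summable_on)
  show "summable (\<lambda>n. norm (norm (sqrt_coeff n)))"
    using summableI_nonneg_bounded[of "\<lambda>n. \<bar>sqrt_coeff n\<bar>" 2] sqrt_coeff_abs_sum by simp
qed

text \<open>These are the coefficients of the square of (1 - t)^(1/2), namely of 1 - t; the sum is
  Vandermonde's identity for rising factorials.\<close>

lemma sqrt_coeff_conv:
  "(\<Sum>i\<le>k. sqrt_coeff i * sqrt_coeff (k - i)) = (if k = 0 then 1 else if k = 1 then -1 else 0)"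
proof -
  have "(\<Sum>i\<le>k. sqrt_coeff i * sqrt_coeff (k - i)) =
      (\<Sum>i\<le>k. real (k choose i) * pochhammer (-1/2) i * pochhammer (-1/2) (k - i)) / fact k"
    unfolding sum_divide_distrib
    by (intro sum.cong refl) (simp add: sqrt_coeff_def binomial_fact)
  also have "\<dots> = pochhammer (-1) k / fact k"
    using pochhammer_binomial_sum[of "-1/2::real" "-1/2" k] by simp
  also have "\<dots> = (if k = 0 then 1 else if k = 1 then -1 else 0)"
  proof -
    have "pochhammer (-1 :: real) (Suc (Suc j)) = 0" for j
      by (simp add: pochhammer_rec)
    then show ?thesis by (cases k; cases "k - 1") auto
  qed
  finally show ?thesis .
qed

lemma sqrt_coeff_sum_nonneg: "(sqrt_coeff has_sum s) UNIV \<Longrightarrow> s \<ge> 0"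
  using LIMSEQ_le_const[of "\<lambda>N. \<Sum>k<N. sqrt_coeff k" s 0] sqrt_coeff_partial_sum_nonneg
  by (auto dest!: has_sum_imp_sums simp: sums_def)

text \<open>The setting for (I - C)^(1/2) as a binomial series. The coefficients are absolutely
  summable, so the series converges even when \<open>C\<close> has norm 1.\<close>

locale contraction_root =
  fixes C :: "'a::complex_hilbert \<Rightarrow> 'a"
  assumes C: "bounded_clinear C" and C_le: "\<And>x. norm (C x) \<le> norm x"
    and C_sym: "\<And>x y. cinner (C x) y = cinner x (C y)"
begin

lemma pow_bounded_clinear: "bounded_clinear (C ^^ n)"
  by (induction n) (auto simp: o_def bounded_clinear_ident id_def intro: bounded_clinear_compose C)

lemma pow_le: "norm ((C ^^ n) x) \<le> norm x"
  by (induction n) (auto intro: order_trans[OF C_le])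

lemma pow_sym: "cinner ((C ^^ n) x) y = cinner x ((C ^^ n) y)"
  by (induction n arbitrary: x y) (simp_all add: C_sym funpow_swap1)

definition root :: "'a \<Rightarrow> 'a" where
  "root x = (\<Sum>\<^sub>\<infinity>n. sqrt_coeff n *\<^sub>R (C ^^ n) x)"

lemma has_sum_root: "((\<lambda>n. sqrt_coeff n *\<^sub>R (C ^^ n) x) has_sum root x) UNIV"
proof -
  have "(\<lambda>n. norm (sqrt_coeff n *\<^sub>R (C ^^ n) x)) summable_on UNIV"
  proof (rule summable_on_comparison_test)
    show "(\<lambda>n. norm (sqrt_coeff n) * norm x) summable_on UNIV"
      using sqrt_coeff_abs_summable by (rule summable_on_cmult_left)
    show "norm (sqrt_coeff n *\<^sub>R (C ^^ n) x) \<le> norm (sqrt_coeff n) * norm x" for n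
      by (simp add: mult_left_mono pow_le)
  qed auto
  then show ?thesis unfolding root_def by (rule has_sum_infsum[OF abs_summable_summable])
qed

lemma root_add: "root (x + y) = root x + root y"
proof -
  have "((\<lambda>n. sqrt_coeff n *\<^sub>R (C ^^ n) x + sqrt_coeff n *\<^sub>R (C ^^ n) y) has_sum root x + root y) UNIV"
    by (intro has_sum_add has_sum_root)
  then have "((\<lambda>n. sqrt_coeff n *\<^sub>R (C ^^ n) (x + y)) has_sum root x + root y) UNIV"
    by (simp add: clinear_add[OF bounded_clinear_clinear[OF pow_bounded_clinear]] scaleR_add_right)
  then show ?thesis by (rule has_sum_unique[OF has_sum_root])
qed

text \<open>Commutation passes from \<open>C\<close> to its powers and termwise to the series; the
  uniqueness of square roots rests on it.\<close>

lemma root_commute: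
  assumes S: "bounded_clinear S" "\<And>x. S (C x) = C (S x)"
  shows "S (root x) = root (S x)"
proof -
  have pow: "S ((C ^^ n) x) = (C ^^ n) (S x)" for n
    by (induction n arbitrary: x) (simp_all add: S(2))
  have "((\<lambda>n. S (sqrt_coeff n *\<^sub>R (C ^^ n) x)) has_sum S (root x)) UNIV"
    by (rule has_sum_bounded_linear[OF bounded_clinear_bounded_linear[OF S(1)] has_sum_root])
  then have "((\<lambda>n. sqrt_coeff n *\<^sub>R (C ^^ n) (S x)) has_sum S (root x)) UNIV"
    by (simp add: scaleR_scaleC clinear_scale[OF bounded_clinear_clinear[OF S(1)]] pow)
  then show ?thesis by (rule has_sum_unique[OF _ has_sum_root])
qed

lemma root_scale: "root (c *\<^sub>C x) = c *\<^sub>C root x"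
  using root_commute[of "\<lambda>x. c *\<^sub>C x" x] clinear_scale[OF bounded_clinear_clinear[OF C]]
    bounded_clinear_scaleC[OF bounded_clinear_ident] by metis

lemma norm_root_le: "norm (root x) \<le> 2 * norm x"
proof -
  have "norm (\<Sum>k<N. sqrt_coeff k *\<^sub>R (C ^^ k) x) \<le> 2 * norm x" for N
  proof -
    have "norm (\<Sum>k<N. sqrt_coeff k *\<^sub>R (C ^^ k) x) \<le> (\<Sum>k<N. \<bar>sqrt_coeff k\<bar> * norm x)"
      by (rule sum_norm_le) (simp add: mult_left_mono pow_le)
    also have "\<dots> \<le> 2 * norm x"
      unfolding sum_distrib_right[symmetric] by (intro mult_right_mono sqrt_coeff_abs_sum) simp
    finally show ?thesis .
  qed
  moreover have "(\<lambda>N. \<Sum>k<N. sqrt_coeff k *\<^sub>R (C ^^ k) x) \<longlonglongrightarrow> root x"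
    using has_sum_root[of x] has_sum_imp_sums by (auto simp: sums_def)
  ultimately show ?thesis
    by (intro LIMSEQ_le_const2[OF tendsto_norm]) auto
qed

lemma bounded_clinear_root: "bounded_clinear root"
  by (rule bounded_clinearI[OF root_add root_scale norm_root_le])

lemma positive_root: "positive_op root"
  unfolding positive_op_def
proof (intro conjI allI bounded_clinear_root)
  fix x
  have hs: "((\<lambda>n. cinner (sqrt_coeff n *\<^sub>R (C ^^ n) x) x) has_sum cinner (root x) x) UNIV"
    by (rule has_sum_bounded_linear[OF bounded_linear_cinner_left has_sum_root])
  have real: "cnj (cinner ((C ^^ n) x) x) = cinner ((C ^^ n) x) x" for n
    by (metis cinner_commute pow_sym)
  have "((\<lambda>n. cnj (cinner (sqrt_coeff n *\<^sub>R (C ^^ n) x) x)) has_sum cnj (cinner (root x) x)) UNIV"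
    using hs by simp
  then have "cnj (cinner (root x) x) = cinner (root x) x"
    by (simp add: cinner_scaleR_left real) (rule has_sum_unique, assumption,
        use hs in \<open>simp add: cinner_scaleR_left\<close>)
  then show "cinner (root x) x \<in> \<real>" by (simp add: Reals_cnj_iff)
  obtain s where s: "(sqrt_coeff has_sum s) UNIV"
    using sqrt_coeff_abs_summable abs_summable_summable unfolding summable_on_def by blast
  \<comment> \<open>Termwise comparison with \<open>C\<close> replaced by the identity: the term of
    index 0 agrees, and all later coefficients are nonpositive while the inner products are at most
    the squared norm of \<open>x\<close>.\<close>
  have "s * (norm x)\<^sup>2 \<le> Re (cinner (root x) x)"
  proof (rule has_sum_mono)
    show "((\<lambda>n. sqrt_coeff n * (norm x)\<^sup>2) has_sum s * (norm x)\<^sup>2) UNIV"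
      by (rule has_sum_cmult_left[OF s])
    show "((\<lambda>n. Re (cinner (sqrt_coeff n *\<^sub>R (C ^^ n) x) x)) has_sum Re (cinner (root x) x)) UNIV"
      by (rule has_sum_Re[OF hs])
    fix n
    have "Re (cinner ((C ^^ n) x) x) \<le> norm ((C ^^ n) x) * norm x"
      using complex_Re_le_cmod cinner_bound order_trans by blast
    also have "\<dots> \<le> (norm x)\<^sup>2" by (simp add: power2_eq_square mult_right_mono pow_le)
    finally show "sqrt_coeff n * (norm x)\<^sup>2 \<le> Re (cinner (sqrt_coeff n *\<^sub>R (C ^^ n) x) x)"
      by (cases "n = 0") (simp_all add: cinner_self cinner_scaleR_left mult_left_mono_neg sqrt_coeff_nonpos)
  qed
  then show "0 \<le> Re (cinner (root x) x)"
    using sqrt_coeff_sum_nonneg[OF s] by (meson mult_nonneg_nonneg order_trans zero_le_power2)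
qed

text \<open>Cauchy product: the absolutely summable double series is regrouped along n + m = k, and
  the convolution of the coefficients leaves only k = 0 and k = 1.\<close>

lemma root_root: "root (root x) = x - C x"
proof -
  define F where "F n m = (sqrt_coeff n * sqrt_coeff m) *\<^sub>R (C ^^ (n + m)) x" for n m
  have inner: "(F n has_sum sqrt_coeff n *\<^sub>R (C ^^ n) (root x)) UNIV" for n
  proof -
    have "((\<lambda>m. sqrt_coeff n *\<^sub>R (C ^^ n) (sqrt_coeff m *\<^sub>R (C ^^ m) x)) has_sum
        sqrt_coeff n *\<^sub>R (C ^^ n) (root x)) UNIV"
      by (intro has_sum_scaleR has_sum_bounded_linear[OF _ has_sum_root]
          bounded_clinear_bounded_linear pow_bounded_clinear)
    then show ?thesis
      by (simp add: F_def[abs_def] scaleR_scaleC funpow_add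
          clinear_scale[OF bounded_clinear_clinear[OF pow_bounded_clinear]])
  qed
  have abs: "(\<lambda>m. norm (F n m)) summable_on UNIV" "infsum (\<lambda>m. norm (F n m)) UNIV \<le>
      norm (sqrt_coeff n) * (infsum (\<lambda>m. norm (sqrt_coeff m)) UNIV * norm x)" for n
  proof -
    have hs: "((\<lambda>m. norm (sqrt_coeff n) * (norm (sqrt_coeff m) * norm x)) has_sum
        norm (sqrt_coeff n) * (infsum (\<lambda>m. norm (sqrt_coeff m)) UNIV * norm x)) UNIV"
      by (intro has_sum_cmult_right has_sum_cmult_left has_sum_infsum sqrt_coeff_abs_summable)
    have le: "norm (F n m) \<le> norm (sqrt_coeff n) * (norm (sqrt_coeff m) * norm x)" for m
      by (simp add: F_def abs_mult mult_left_mono pow_le mult.assoc)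
    show "(\<lambda>m. norm (F n m)) summable_on UNIV"
      by (rule summable_on_comparison_test[OF has_sum_imp_summable[OF hs]]) (use le in simp_all)
    then show "infsum (\<lambda>m. norm (F n m)) UNIV \<le>
      norm (sqrt_coeff n) * (infsum (\<lambda>m. norm (sqrt_coeff m)) UNIV * norm x)"
      using has_sum_mono[OF has_sum_infsum hs] le by blast
  qed
  have "(\<lambda>n. infsum (\<lambda>m. norm (F n m)) UNIV) summable_on UNIV"
  proof (rule summable_on_comparison_test)
    show "(\<lambda>n. norm (sqrt_coeff n) * (infsum (\<lambda>m. norm (sqrt_coeff m)) UNIV * norm x)) summable_on UNIV"
      by (rule summable_on_cmult_left[OF sqrt_coeff_abs_summable])
  qed (use abs(2) in \<open>auto intro!: infsum_nonneg\<close>)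
  then have "(\<lambda>p. norm (case p of (n, m) \<Rightarrow> F n m)) summable_on UNIV \<times> UNIV"
    using abs(1) Infinite_Sum.abs_summable_on_Sigma_iff[where f = "\<lambda>(n, m). F n m" and A = UNIV and B = "\<lambda>_. UNIV"]
    by (simp add: infsum_nonneg)
  then have sum: "(\<lambda>(n, m). F n m) summable_on UNIV \<times> UNIV"
    by (rule abs_summable_summable)
  have "root (root x) = (\<Sum>\<^sub>\<infinity>n. \<Sum>\<^sub>\<infinity>m. F n m)"
    by (subst root_def) (simp add: infsumI[OF inner])
  also have "\<dots> = infsum (\<lambda>(n, m). F n m) (UNIV \<times> UNIV)"
    by (rule infsum_Sigma'_banach[OF sum])
  also have "bij_betw (\<lambda>(k, i). (i, k - i)) (SIGMA k:UNIV. {..k}) (UNIV \<times> (UNIV :: nat set))"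
    by (rule bij_betw_byWitness[where f' = "\<lambda>(n, m). (n + m, n)"]) auto
  then have "((\<lambda>p. case (case p of (k, i) \<Rightarrow> (i, k - i)) of (n, m) \<Rightarrow> F n m) has_sum
      infsum (\<lambda>(n, m). F n m) (UNIV \<times> UNIV)) (SIGMA k:UNIV. {..k})"
    by (subst has_sum_reindex_bij_betw) (assumption, rule has_sum_infsum[OF sum])
  then have hs: "((\<lambda>(k, i). F i (k - i)) has_sum infsum (\<lambda>(n, m). F n m) (UNIV \<times> UNIV)) (SIGMA k:UNIV. {..k})"
    by (simp only: case_prod_unfold fst_conv snd_conv)
  have "infsum (\<lambda>(n, m). F n m) (UNIV \<times> UNIV) = (\<Sum>\<^sub>\<infinity>k. \<Sum>\<^sub>\<infinity>i\<in>{..k}. F i (k - i))"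
    by (rule trans[OF infsumI[OF hs, symmetric] infsum_Sigma'_banach[OF has_sum_imp_summable[OF hs], symmetric]])
  also have "\<dots> = (\<Sum>\<^sub>\<infinity>k::nat. if k = 0 then x else if k = 1 then - C x else 0)"
  proof (rule infsum_cong)
    fix k :: nat
    have "(\<Sum>i\<le>k. F i (k - i)) = (\<Sum>i\<le>k. sqrt_coeff i * sqrt_coeff (k - i)) *\<^sub>R (C ^^ k) x"
      by (simp add: F_def scaleR_sum_left)
    then show "infsum (\<lambda>i. F i (k - i)) {..k} = (if k = 0 then x else if k = 1 then - C x else 0)"
      by (simp add: sqrt_coeff_conv)
  qed
  also have "\<dots> = (\<Sum>\<^sub>\<infinity>k\<in>{0, 1::nat}. if k = 0 then x else if k = 1 then - C x else 0)"
    by (rule infsum_cong_neutral) auto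
  also have "\<dots> = x - C x" by simp
  finally show ?thesis .
qed

end

text \<open>Apply the series to \<open>C\<close> = I - B / b with b slightly above the norm of
  \<open>B\<close>. That \<open>C\<close> is a contraction is the bound of
  \<open>positive_op_norm_sq_le\<close> in disguise.\<close>

theorem positive_op_sqrt:
  fixes B :: "'a::complex_hilbert \<Rightarrow> 'a"
  assumes B: "positive_op B"
  obtains R where "positive_op R" "\<And>x. R (R x) = B x"
    "\<And>S x. bounded_clinear S \<Longrightarrow> (\<And>y. S (B y) = B (S y)) \<Longrightarrow> S (R x) = R (S x)"
proof -
  define b where "b = onorm B + 1"
  have b: "b > 0" "onorm B \<le> b"
    using onorm_nonneg[OF positive_op_bounded[OF B]] by (auto simp: b_def)
  define C where "C x = x - (1 / b) *\<^sub>R B x" for x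
  have bC: "bounded_clinear C"
    unfolding C_def scaleR_scaleC
    by (intro bounded_clinear_sub bounded_clinear_ident bounded_clinear_scaleC positive_op_bounded B)
  interpret contraction_root C
  proof
    show "bounded_clinear C" by (rule bC)
    fix x y
    show "cinner (C x) y = cinner x (C y)"
      by (simp add: C_def cinner_diff_left cinner_diff_right cinner_scaleR_left cinner_scaleR_right
          positive_op_selfadjoint[OF B])
    have "Re (cinner x ((1 / b) *\<^sub>R B x)) = Re (cinner (B x) x) / b"
      by (simp add: cinner_scaleR_right positive_op_selfadjoint[OF B])
    then have "(norm (C x))\<^sup>2 = (norm x)\<^sup>2 - 2 * Re (cinner (B x) x) / b + (norm (B x))\<^sup>2 / b\<^sup>2"
      using b by (simp add: C_def norm_diff_sq power_divide)
    moreover have "(norm (B x))\<^sup>2 / b\<^sup>2 \<le> Re (cinner (B x) x) / b"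
      using positive_op_norm_sq_le[OF B b(2,1), of x] b by (simp add: field_simps power2_eq_square)
    moreover have "0 \<le> Re (cinner (B x) x) / b" using positive_op_Re_nonneg[OF B] b by simp
    ultimately have "(norm (C x))\<^sup>2 \<le> (norm x)\<^sup>2" by linarith
    then show "norm (C x) \<le> norm x" by (rule power2_le_imp_le) simp
  qed
  define R where "R x = sqrt b *\<^sub>R root x" for x
  have "positive_op R"
    using positive_root b(1) unfolding positive_op_def R_def
    by (auto simp: scaleR_scaleC cinner_scaleC_left intro: bounded_clinear_scaleC Reals_mult)
  moreover have "R (R x) = B x" for x
  proof -
    have "R (R x) = (sqrt b * sqrt b) *\<^sub>R root (root x)"
      by (simp only: R_def scaleR_scaleC root_scale scaleC_scaleC of_real_mult)
    also have "\<dots> = B x" using b(1) by (simp add: root_root C_def)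
    finally show ?thesis .
  qed
  moreover have "S (R x) = R (S x)" if S: "bounded_clinear S" "\<And>y. S (B y) = B (S y)" for S x
  proof -
    note lin = bounded_clinear_clinear[OF S(1)]
    have "S (C y) = C (S y)" for y
      by (simp add: C_def clinear_diff[OF lin] scaleR_scaleC clinear_scale[OF lin] S(2))
    then have "S (root x) = root (S x)" by (rule root_commute[OF S(1)])
    then show ?thesis by (simp add: R_def scaleR_scaleC clinear_scale[OF lin])
  qed
  ultimately show ?thesis using that by blast
qed

text \<open>\<open>S\<close> commutes with its square \<open>B\<close>, hence with \<open>R\<close>.
  Then (S + R) w = 0 for \<open>w = S x - R x\<close>, positivity forces \<open>S w = 0\<close> and
  \<open>R w = 0\<close>, and moving \<open>S\<close> and \<open>R\<close> across the inner product
  gives that \<open>w\<close> is orthogonal to itself.\<close>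

lemma positive_op_sqrt_unique:
  fixes B :: "'a::complex_hilbert \<Rightarrow> 'a"
  assumes S: "positive_op S" "\<And>x. S (S x) = B x"
    and R: "positive_op R" "\<And>x. R (R x) = B x"
      "\<And>S x. bounded_clinear S \<Longrightarrow> (\<And>y. S (B y) = B (S y)) \<Longrightarrow> S (R x) = R (S x)"
  shows "S x = R x"
proof -
  note bS = positive_op_bounded[OF S(1)] and bR = positive_op_bounded[OF R(1)]
  note linS = bounded_clinear_clinear[OF bS] and linR = bounded_clinear_clinear[OF bR]
  have comm: "S (R y) = R (S y)" for y
    by (rule R(3)[OF bS]) (metis S(2))
  define w where "w = S x - R x"
  have "S w + R w = 0"
    by (simp add: w_def clinear_diff[OF linS] clinear_diff[OF linR] S(2) R(2) comm)
  then have "cinner (S w) w + cinner (R w) w = 0"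
    by (metis cinner_add_left cinner_zero_left)
  then have "Re (cinner (S w) w) + Re (cinner (R w) w) = 0"
    by (metis plus_complex.sel(1) zero_complex.sel(1))
  then have "Re (cinner (S w) w) \<le> 0" "Re (cinner (R w) w) \<le> 0"
    using positive_op_Re_nonneg[OF S(1), of w] positive_op_Re_nonneg[OF R(1), of w] by linarith+
  then have "S w = 0" "R w = 0" using positive_op_eq_0 S(1) R(1) by blast+
  have "cinner w w = cinner x (S w) - cinner x (R w)"
    by (subst (1) w_def)
      (simp add: cinner_diff_left positive_op_selfadjoint[OF S(1)] positive_op_selfadjoint[OF R(1)])
  then have "w = 0" by (simp add: \<open>S w = 0\<close> \<open>R w = 0\<close> cinner_eq_zero_iff)
  then show ?thesis by (simp add: w_def)
qed

text \<open>Discharges the definite description in \<open>abs_op\<close>. Afterwards only positivity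
  and the equality of norms are needed.\<close>

lemma abs_op:
  fixes T :: "'a::complex_hilbert \<Rightarrow> 'a"
  assumes sep: "separable_type TYPE('a)" and T: "bounded_clinear T"
  shows "positive_op (abs_op T)" "norm (abs_op T x) = norm (T x)"
proof -
  define B where "B = cadjoint T \<circ> T"
  have BT: "cinner (B x) y = cinner (T x) (T y)" for x y
  proof -
    have "cinner (B x) y = cnj (cinner y (B x))" by (rule cinner_commute)
    also have "cinner y (B x) = cinner (T y) (T x)" unfolding B_def by (simp add: cadjoint[OF sep T])
    also have "cnj (cinner (T y) (T x)) = cinner (T x) (T y)" by (rule cinner_commute[symmetric])
    finally show ?thesis .
  qed
  have "positive_op B"
    unfolding positive_op_def
  proof (intro conjI allI)
    show "bounded_clinear B"
      unfolding B_def o_def by (rule bounded_clinear_compose[OF bounded_clinear_cadjoint[OF sep T] T])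
    show "cinner (B x) x \<in> \<real>" "0 \<le> Re (cinner (B x) x)" for x
      unfolding BT cinner_self by simp_all
  qed
  then obtain R where R: "positive_op R" "\<And>x. R (R x) = B x"
    "\<And>S x. bounded_clinear S \<Longrightarrow> (\<And>y. S (B y) = B (S y)) \<Longrightarrow> S (R x) = R (S x)"
    using positive_op_sqrt by blast
  have "positive_op (abs_op T) \<and> abs_op T \<circ> abs_op T = cadjoint T \<circ> T"
    unfolding abs_op_def
  proof (rule theI[where a = R])
    show "positive_op R \<and> R \<circ> R = cadjoint T \<circ> T"
      using R(1,2) by (auto simp: B_def)
    show "S = R" if "positive_op S \<and> S \<circ> S = cadjoint T \<circ> T" for S
    proof (rule ext, rule positive_op_sqrt_unique[OF _ _ R])
      show "positive_op S" using that by blast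
      show "S (S x) = B x" for x using that unfolding B_def by (metis comp_apply)
    qed
  qed
  then have pos: "positive_op (abs_op T)" and sq: "\<And>x. abs_op T (abs_op T x) = B x"
    by (auto simp: B_def fun_eq_iff)
  show "positive_op (abs_op T)" by (rule pos)
  have "cinner (abs_op T x) (abs_op T x) = cinner (T x) (T x)"
    using positive_op_selfadjoint[OF pos, of "abs_op T x" x] unfolding sq BT by simp
  then have "(norm (abs_op T x))\<^sup>2 = (norm (T x))\<^sup>2"
    unfolding cinner_self of_real_eq_iff .
  then show "norm (abs_op T x) = norm (T x)"
    by (rule power2_eq_imp_eq) simp_all
qed

section \<open>Nuclear representations of trace class operators\<close>

lemma cmod_cinner_commute: "cmod (cinner x y) = cmod (cinner y x)"
  by (metis cinner_commute complex_mod_cnj)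

text \<open>A series of rank-one operators with the bound \<open>c\<close> kept explicit. It is
  inherited by compressions with the same \<open>c\<close>, and it gives compactness, diagonal
  bounds and the trace without singular values.\<close>

definition nuclear_rep ::
    "('a::complex_hilbert \<Rightarrow> 'a) \<Rightarrow> (nat \<Rightarrow> 'a) \<Rightarrow> (nat \<Rightarrow> 'a) \<Rightarrow> real \<Rightarrow> bool" where
  "nuclear_rep S a b c \<longleftrightarrow>
     (\<forall>N. (\<Sum>i<N. norm (a i) * norm (b i)) \<le> c) \<and> (\<forall>x. (\<lambda>i. cinner x (a i) *\<^sub>C b i) sums S x)"

lemma nuclear_rep_bound: "nuclear_rep S a b c \<Longrightarrow> (\<Sum>i<N. norm (a i) * norm (b i)) \<le> c"
  and nuclear_rep_sums: "nuclear_rep S a b c \<Longrightarrow> (\<lambda>i. cinner x (a i) *\<^sub>C b i) sums S x"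
  by (simp_all add: nuclear_rep_def)

lemma trace_class_partial_sum:
  fixes K :: "'a::complex_hilbert \<Rightarrow> 'a"
  assumes sep: "separable_type TYPE('a)" and K: "trace_class K"
    and F: "finite F" "F \<subseteq> some_onb"
  shows "(\<Sum>e\<in>F. Re (cinner (abs_op K e) e)) \<le> enn2real (trace_norm K)"
proof -
  have pos: "positive_op (abs_op K)"
    using abs_op(1)[OF sep] K by (simp add: trace_class_def)
  have fin: "trace_norm K < \<infinity>" using K by (simp add: trace_class_def)
  have "ennreal (\<Sum>e\<in>F. Re (cinner (abs_op K e) e)) = (\<Sum>e\<in>F. ennreal (Re (cinner (abs_op K e) e)))"
    by (simp add: positive_op_Re_nonneg[OF pos])
  also have "\<dots> \<le> trace_norm K"
    unfolding trace_norm_def by (subst nonneg_infsum_complete) (auto intro!: SUP_upper F)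
  also have "\<dots> = ennreal (enn2real (trace_norm K))"
    using fin by simp
  finally show ?thesis
    by (simp add: ennreal_le_iff)
qed

text \<open>With \<open>P\<close> the absolute value of \<open>K\<close> and \<open>Q\<close> its
  square root, take an orthonormal system \<open>h n = Q (g n)\<close> and put
  \<open>a n = Q (h n)\<close>, \<open>b n = K (g n)\<close>. Both have the norm of
  \<open>P (g n)\<close>, so the nuclear sum is the sum of the squared norms of
  \<open>Q (h n)\<close>, at most the trace of \<open>P\<close>.\<close>

theorem trace_class_nuclear_rep:
  fixes K :: "'a::complex_hilbert \<Rightarrow> 'a"
  assumes sep: "separable_type TYPE('a)" and K: "trace_class K"
  obtains a b where "nuclear_rep K a b (enn2real (trace_norm K))"
proof -
  have bK: "bounded_clinear K" using K by (simp add: trace_class_def)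
  define P where "P = abs_op K"
  have P: "positive_op P" "\<And>x. norm (P x) = norm (K x)"
    using abs_op[OF sep bK] by (simp_all add: P_def)
  obtain Q where Q: "positive_op Q" "\<And>x. Q (Q x) = P x"
    by (rule positive_op_sqrt[OF P(1)], rule that)
  have bQ: "bounded_clinear Q" using Q(1) by (rule positive_op_bounded)
  note lQ = bounded_clinear_clinear[OF bQ] and lK = bounded_clinear_clinear[OF bK]
  note sQ = positive_op_selfadjoint[OF Q(1)]
  obtain y :: "nat \<Rightarrow> 'a" where y: "closure (range y) = UNIV"
    using separable_dense_sequence[OF sep] .
  \<comment> \<open>Orthonormalising inside the range of \<open>Q\<close> guarantees preimages
    \<open>g n\<close> under \<open>Q\<close>; this takes the place of the partial isometry in the
    polar decomposition.\<close>
  define h where "h = gram_schmidt (\<lambda>n. Q (y n))"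
  have oh: "orthosystem {..<N} h" for N
    unfolding h_def by (rule orthosystem_mono[OF orthosystem_gram_schmidt]) simp
  have "complex_vector.subspace (range Q)"
    unfolding complex_vector.subspace_def
    by (auto simp flip: clinear_add[OF lQ] clinear_scale[OF lQ]) (metis clinear_zero[OF lQ] rangeI)
  then have hQ: "h n \<in> range Q" for n
    unfolding h_def by (rule gram_schmidt_in_subspace) simp
  define g where "g n = inv Q (h n)" for n
  have g: "Q (g n) = h n" for n
    unfolding g_def by (rule f_inv_into_f[OF hQ])
  define a where "a n = Q (h n)" for n
  define b where "b n = K (g n)" for n
  have nb: "norm (b n) = norm (a n)" for n
    by (simp add: b_def a_def flip: P(2) Q(2)) (simp add: g)
  have tends: "(\<lambda>N. proj h {..<N} (Q x)) \<longlonglongrightarrow> Q x" for x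
    unfolding h_def
  proof (rule tendsto_proj_gram_schmidt)
    have "Q ` closure (range y) \<subseteq> closure (Q ` range y)"
      by (rule closure_bounded_linear_image_subset[OF bounded_clinear_bounded_linear[OF bQ]])
    then show "Q x \<in> closure (range (\<lambda>n. Q (y n)))"
      by (auto simp: y image_image)
  qed
  have "(\<lambda>i. cinner x (a i) *\<^sub>C b i) sums K x" for x
    unfolding sums_def
  proof (rule Lim_transform2)
    \<comment> \<open>The vectors \<open>v N\<close> need not converge. Only \<open>Q (v N)\<close>
      does, and \<open>norm (K u) = norm (Q (Q u))\<close> transfers this to
      \<open>K (v N)\<close>.\<close>
    define v where "v N = (\<Sum>i<N. cinner (Q x) (h i) *\<^sub>C g i)" for N
    have Kv: "K (v N) = (\<Sum>i<N. cinner x (a i) *\<^sub>C b i)" for N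
      by (simp add: v_def a_def b_def clinear_sum[OF lK] clinear_scale[OF lK] sQ)
    have Qv: "Q (v N) = proj h {..<N} (Q x)" for N
      by (simp add: v_def proj_def clinear_sum[OF lQ] clinear_scale[OF lQ] g)
    have "(\<lambda>N. Q (Q x - proj h {..<N} (Q x))) \<longlonglongrightarrow> Q (Q x - Q x)"
      by (rule bounded_linear.tendsto[OF bounded_clinear_bounded_linear[OF bQ]])
        (intro tendsto_diff tendsto_const tends)
    then have "(\<lambda>N. norm (Q (Q x - Q (v N)))) \<longlonglongrightarrow> 0"
      by (simp add: clinear_zero[OF lQ] Qv tendsto_norm_zero)
    moreover have "norm (Q (Q x - Q (v N))) = norm (K x - (\<Sum>i<N. cinner x (a i) *\<^sub>C b i))" for N
      by (metis clinear_diff[OF lQ] clinear_diff[OF lK] P(2) Q(2) Kv)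
    ultimately have "(\<lambda>N. norm (K x - (\<Sum>i<N. cinner x (a i) *\<^sub>C b i))) \<longlonglongrightarrow> 0"
      by simp
    then show "(\<lambda>N. K x - (\<Sum>i<N. cinner x (a i) *\<^sub>C b i)) \<longlonglongrightarrow> 0"
      by (rule tendsto_norm_zero_cancel)
  qed (rule tendsto_const)
  moreover have "(\<Sum>i<N. norm (a i) * norm (b i)) \<le> enn2real (trace_norm K)" for N
  proof -
    define E where "E = (some_onb :: 'a set)"
    have E: "is_onb E" unfolding E_def by (rule is_onb_some_onb[OF sep])
    \<comment> \<open>Parseval summed over \<open>i\<close>; for a fixed basis vector
      \<open>e\<close>, Bessel's inequality for \<open>h\<close> bounds the inner sum by the
      diagonal entry of \<open>P\<close> at \<open>e\<close>.\<close>
    have hs: "((\<lambda>e. \<Sum>i<M. (cmod (cinner (a i) e))\<^sup>2) has_sum (\<Sum>i<M. (norm (a i))\<^sup>2)) E" for M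
      by (induction M) (simp_all add: has_sum_add parseval_norm[OF E])
    have "(\<Sum>i<N. (norm (a i))\<^sup>2) \<le> enn2real (trace_norm K)"
    proof (rule has_sum_le_finite_sums[OF hs])
      fix F assume F: "finite F" "F \<subseteq> E"
      have "(\<Sum>e\<in>F. \<Sum>i<N. (cmod (cinner (a i) e))\<^sup>2) \<le> (\<Sum>e\<in>F. Re (cinner (P e) e))"
      proof (rule sum_mono)
        fix e
        have "(\<Sum>i<N. (cmod (cinner (a i) e))\<^sup>2) = (\<Sum>i<N. (cmod (cinner (Q e) (h i)))\<^sup>2)"
          by (simp only: a_def sQ[of "h _"] cmod_cinner_commute[of "Q e"])
        also have "\<dots> \<le> (norm (Q e))\<^sup>2" by (rule bessel[OF oh]) simp
        also have "\<dots> = Re (cinner (Q e) (Q e))" by (simp add: cinner_self)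
        also have "\<dots> = Re (cinner (P e) e)" by (simp only: Q(2)[symmetric] sQ)
        finally show "(\<Sum>i<N. (cmod (cinner (a i) e))\<^sup>2) \<le> Re (cinner (P e) e)" .
      qed
      also have "\<dots> \<le> enn2real (trace_norm K)"
        unfolding P_def using F by (intro trace_class_partial_sum sep K) (simp_all add: E_def)
      finally show "(\<Sum>e\<in>F. \<Sum>i<N. (cmod (cinner (a i) e))\<^sup>2) \<le> enn2real (trace_norm K)" .
    qed
    then show ?thesis by (simp add: nb power2_eq_square)
  qed
  ultimately show ?thesis using that unfolding nuclear_rep_def by blast
qed

lemma bessel_bilinear:
  assumes "orthosystem I e" "finite I"
  shows "(\<Sum>k\<in>I. cmod (cinner x (e k)) * cmod (cinner y (e k))) \<le> norm x * norm y"
proof -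
  have L2: "L2_set (\<lambda>k. cmod (cinner z (e k))) I \<le> norm z" for z
    unfolding L2_set_def using bessel[OF assms, of z] by (simp add: real_le_lsqrt)
  have "(\<Sum>k\<in>I. cmod (cinner x (e k)) * cmod (cinner y (e k)))
      \<le> L2_set (\<lambda>k. cmod (cinner x (e k))) I * L2_set (\<lambda>k. cmod (cinner y (e k))) I"
    using L2_set_mult_ineq[of "\<lambda>k. cmod (cinner x (e k))" "\<lambda>k. cmod (cinner y (e k))" I] by simp
  also have "\<dots> \<le> norm x * norm y"
    by (intro mult_mono L2) (simp_all add: L2_set_nonneg)
  finally show ?thesis .
qed

text \<open>Expand each diagonal entry in the representation, exchange the sums, and apply Bessel
  with Cauchy-Schwarz to each rank-one term. This is the only way in which a trace norm bounds
  eigenvalues here.\<close>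

lemma nuclear_rep_diagonal:
  assumes S: "nuclear_rep S a b c" and e: "orthosystem I e" "finite I"
  shows "(\<Sum>k\<in>I. cmod (cinner (S (e k)) (e k))) \<le> c"
proof (rule LIMSEQ_le_const2)
  show "(\<lambda>N. \<Sum>k\<in>I. cmod (cinner (\<Sum>i<N. cinner (e k) (a i) *\<^sub>C b i) (e k)))
      \<longlonglongrightarrow> (\<Sum>k\<in>I. cmod (cinner (S (e k)) (e k)))"
    using nuclear_rep_sums[OF S] unfolding sums_def by (intro tendsto_intros) auto
  have "(\<Sum>k\<in>I. cmod (cinner (\<Sum>i<N. cinner (e k) (a i) *\<^sub>C b i) (e k))) \<le> c" for N
  proof -
    have "(\<Sum>k\<in>I. cmod (cinner (\<Sum>i<N. cinner (e k) (a i) *\<^sub>C b i) (e k)))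
        \<le> (\<Sum>k\<in>I. \<Sum>i<N. cmod (cinner (a i) (e k)) * cmod (cinner (b i) (e k)))"
    proof (rule sum_mono)
      fix k
      have "cmod (cinner (\<Sum>i<N. cinner (e k) (a i) *\<^sub>C b i) (e k))
          \<le> (\<Sum>i<N. cmod (cinner (e k) (a i) * cinner (b i) (e k)))"
        unfolding cinner_sum_left cinner_scaleC_left by (rule norm_sum)
      then show "cmod (cinner (\<Sum>i<N. cinner (e k) (a i) *\<^sub>C b i) (e k))
          \<le> (\<Sum>i<N. cmod (cinner (a i) (e k)) * cmod (cinner (b i) (e k)))"
        by (simp only: norm_mult cmod_cinner_commute[of "e k" "a _"])
    qed
    also have "\<dots> = (\<Sum>i<N. \<Sum>k\<in>I. cmod (cinner (a i) (e k)) * cmod (cinner (b i) (e k)))"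
      by (rule sum.swap)
    also have "\<dots> \<le> (\<Sum>i<N. norm (a i) * norm (b i))"
      by (intro sum_mono bessel_bilinear e)
    also have "\<dots> \<le> c" by (rule nuclear_rep_bound[OF S])
    finally show ?thesis .
  qed
  then show "\<exists>M. \<forall>N\<ge>M. (\<Sum>k\<in>I. cmod (cinner (\<Sum>i<N. cinner (e k) (a i) *\<^sub>C b i) (e k))) \<le> c"
    by blast
qed

lemma nuclear_rep_compose:
  assumes S: "nuclear_rep S a b c" and B: "bounded_clinear B" and c': "\<And>x. norm (B x) \<le> norm x"
  shows "nuclear_rep (\<lambda>x. B (S x)) a (\<lambda>i. B (b i)) c"
  unfolding nuclear_rep_def
proof (intro conjI allI)
  fix N
  have "(\<Sum>i<N. norm (a i) * norm (B (b i))) \<le> (\<Sum>i<N. norm (a i) * norm (b i))"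
    by (intro sum_mono mult_left_mono c') auto
  also have "\<dots> \<le> c" by (rule nuclear_rep_bound[OF S])
  finally show "(\<Sum>i<N. norm (a i) * norm (B (b i))) \<le> c" .
next
  fix x
  have "(\<lambda>i. B (cinner x (a i) *\<^sub>C b i)) sums B (S x)"
    by (rule bounded_linear.sums[OF bounded_clinear_bounded_linear[OF B] nuclear_rep_sums[OF S]])
  then show "(\<lambda>i. cinner x (a i) *\<^sub>C B (b i)) sums B (S x)"
    by (simp add: clinear_scale[OF bounded_clinear_clinear[OF B]])
qed

lemma nuclear_rep_scale:
  assumes S: "nuclear_rep S a b c"
  shows "nuclear_rep (\<lambda>x. z *\<^sub>C S x) a (\<lambda>i. z *\<^sub>C b i) (cmod z * c)"
  unfolding nuclear_rep_def
proof (intro conjI allI)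
  fix N
  have "(\<Sum>i<N. norm (a i) * norm (z *\<^sub>C b i)) = cmod z * (\<Sum>i<N. norm (a i) * norm (b i))"
    by (simp add: norm_scaleC sum_distrib_left mult_ac)
  also have "\<dots> \<le> cmod z * c" by (intro mult_left_mono nuclear_rep_bound[OF S]) auto
  finally show "(\<Sum>i<N. norm (a i) * norm (z *\<^sub>C b i)) \<le> cmod z * c" .
next
  fix x
  have "(\<lambda>i. z *\<^sub>C (cinner x (a i) *\<^sub>C b i)) sums (z *\<^sub>C S x)"
    by (rule bounded_linear.sums[OF bounded_linear_scaleC_right nuclear_rep_sums[OF S]])
  then show "(\<lambda>i. cinner x (a i) *\<^sub>C z *\<^sub>C b i) sums (z *\<^sub>C S x)"
    by (simp add: mult.commute)
qed

text \<open>Fubini over pairs of a rank-one term and a basis vector, with Parseval for the sum over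
  the basis. The extra factor \<open>B\<close> allows the trace of the square of an operator to be
  read off a single representation of it.\<close>

lemma nuclear_rep_trace:
  fixes S :: "'a::complex_hilbert \<Rightarrow> 'a"
  assumes sep: "separable_type TYPE('a)" and S: "nuclear_rep S a b c" and B: "bounded_clinear B"
  shows "(\<lambda>i. cinner (B (b i)) (a i)) sums op_trace (\<lambda>x. B (S x))"
proof -
  define E where "E = (some_onb :: 'a set)"
  have E: "is_onb E" unfolding E_def by (rule is_onb_some_onb[OF sep])
  define F where "F i e = cinner (B (b i)) e * cinner e (a i)" for i e
  have oE: "orthosystem G (\<lambda>e. e)" if "G \<subseteq> E" for G
    using is_onb_orthonormal[OF E] that by (intro orthonormal_orthosystem) (rule orthonormal_mono)
  have finF: "(\<Sum>e\<in>G. norm (F i e)) \<le> norm (B (b i)) * norm (a i)" if "finite G" "G \<subseteq> E" for G i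
    using bessel_bilinear[OF oE[OF that(2)] that(1), of "B (b i)" "a i"]
    by (simp add: F_def norm_mult cmod_cinner_commute[of _ "a i"])
  have sumF: "(\<lambda>e. norm (F i e)) summable_on E" for i
    by (rule nonneg_bdd_above_summable_on) (auto intro!: bdd_aboveI finF)
  have leF: "infsum (\<lambda>e. norm (F i e)) E \<le> norm (B (b i)) * norm (a i)" for i
    by (rule infsum_le_finite_sums[OF sumF]) (rule finF)
  have bBab: "norm (B (b i)) * norm (a i) \<le> onorm B * (norm (a i) * norm (b i))" for i
    using mult_right_mono[OF bounded_clinear_norm_le[OF B, of "b i"], of "norm (a i)"]
    by (simp add: mult_ac)
  have sab: "summable (\<lambda>i. norm (a i) * norm (b i))"
    by (rule summableI_nonneg_bounded[where x = c]) (auto intro: nuclear_rep_bound[OF S])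
  then have "summable (\<lambda>i. onorm B * (norm (a i) * norm (b i)))" by (rule summable_mult)
  then have "summable (\<lambda>i. norm (infsum (\<lambda>e. norm (F i e)) E))"
    by (rule summable_comparison_test'[where N = 0])
      (use leF bBab in \<open>simp add: infsum_nonneg\<close>, meson order_trans)
  then have "(\<lambda>i. infsum (\<lambda>e. norm (F i e)) E) summable_on UNIV"
    by (rule norm_summable_imp_summable_on)
  then have "(\<lambda>p. norm (case p of (i, e) \<Rightarrow> F i e)) summable_on UNIV \<times> E"
    using sumF Infinite_Sum.abs_summable_on_Sigma_iff[where f = "\<lambda>(i, e). F i e" and A = UNIV and B = "\<lambda>_. E"]
    by (simp add: infsum_nonneg)
  then have sum: "(\<lambda>(i, e). F i e) summable_on UNIV \<times> E"
    by (rule abs_summable_summable)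
  have inner: "infsum (F i) E = cinner (B (b i)) (a i)" for i
    unfolding F_def by (rule infsumI[OF parseval[OF E]])
  have "infsum (\<lambda>i. F i e) UNIV = cinner (B (S e)) e" for e
  proof (rule infsumI, rule norm_summable_imp_has_sum)
    have "(\<lambda>i. cinner (B (cinner e (a i) *\<^sub>C b i)) e) sums cinner (B (S e)) e"
      by (intro bounded_linear.sums[OF bounded_linear_cinner_left]
          bounded_linear.sums[OF bounded_clinear_bounded_linear[OF B]] nuclear_rep_sums[OF S])
    then show "(\<lambda>i. F i e) sums cinner (B (S e)) e"
      by (simp add: F_def clinear_scale[OF bounded_clinear_clinear[OF B]] cinner_scaleC_left mult.commute)
    show "summable (\<lambda>i. norm (F i e))"
    proof (rule summable_comparison_test'[OF summable_mult[OF sab], where N = 0])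
      fix i
      have "cmod (F i e) \<le> (norm (B (b i)) * norm e) * (norm e * norm (a i))"
        unfolding F_def norm_mult by (intro mult_mono cinner_bound) auto
      also have "\<dots> = (norm e * norm e) * (norm (B (b i)) * norm (a i))" by simp
      also have "\<dots> \<le> (norm e * norm e) * (onorm B * (norm (a i) * norm (b i)))"
        by (intro mult_left_mono bBab) auto
      finally show "norm (norm (F i e)) \<le> (norm e * norm e * onorm B) * (norm (a i) * norm (b i))"
        by (simp add: mult_ac)
    qed
  qed
  then have "op_trace (\<lambda>x. B (S x)) = (\<Sum>\<^sub>\<infinity>e\<in>E. \<Sum>\<^sub>\<infinity>i. F i e)"
    by (simp add: op_trace_def E_def)
  also have "\<dots> = (\<Sum>\<^sub>\<infinity>i. \<Sum>\<^sub>\<infinity>e\<in>E. F i e)"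
    by (rule infsum_swap_banach[OF sum, symmetric])
  also have "\<dots> = (\<Sum>\<^sub>\<infinity>i. cinner (B (b i)) (a i))" by (simp add: inner)
  finally have "op_trace (\<lambda>x. B (S x)) = (\<Sum>\<^sub>\<infinity>i. cinner (B (b i)) (a i))" .
  moreover have "(\<lambda>i. cinner (B (b i)) (a i)) summable_on UNIV"
    using summable_on_Sigma_banach[OF sum] by (simp add: inner)
  ultimately show ?thesis
    by (metis has_sum_infsum has_sum_imp_sums)
qed

section \<open>Finite-dimensional subspaces and triangular forms\<close>

text \<open>A vector of \<open>E0\<close> outside \<open>E1\<close> would extend a basis of
  \<open>E1\<close> beyond the dimension of \<open>E0\<close>.\<close>

lemma subspace_eqI_dim:
  fixes B :: "'a::complex_normed_vector set"
  assumes sub: "complex_vector.subspace E1" "E1 \<subseteq> E0" "E0 \<subseteq> complex_vector.span B" "finite B"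
    and dim: "complex_vector.dim E0 \<le> complex_vector.dim E1"
  shows "E1 = E0"
proof -
  obtain B1 where B1: "B1 \<subseteq> E1" "complex_vector.independent B1" "E1 \<subseteq> complex_vector.span B1"
    "card B1 = complex_vector.dim E1"
    using complex_vector.basis_exists .
  obtain B0 where B0: "B0 \<subseteq> E0" "complex_vector.independent B0" "E0 \<subseteq> complex_vector.span B0"
    "card B0 = complex_vector.dim E0"
    using complex_vector.basis_exists .
  have finB0: "finite B0"
    using complex_vector.independent_span_bound[OF sub(4) B0(2)] B0(1) sub(3) by blast
  have finB1: "finite B1"
    using complex_vector.independent_span_bound[OF sub(4) B1(2)] B1(1) sub(2,3) by blast
  have spanB1: "complex_vector.span B1 = E1"
    using complex_vector.span_subspace[OF B1(1,3) sub(1)] .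
  have "x \<in> E1" if x: "x \<in> E0" for x
  proof (rule ccontr)
    assume "x \<notin> E1"
    then have ind: "complex_vector.independent (insert x B1)" and "x \<notin> B1"
      using B1(1,2) spanB1 complex_vector.independent_insertI[of x B1] by auto
    have "insert x B1 \<subseteq> complex_vector.span B0" using x B1(1) sub(2) B0(3) by blast
    then have "card (insert x B1) \<le> card B0"
      using complex_vector.independent_span_bound[OF finB0 ind] by blast
    then show False using \<open>x \<notin> B1\<close> finB1 B0(4) B1(4) dim by simp
  qed
  then show ?thesis using sub(2) by blast
qed

lemma injective_imp_surjective_on:
  fixes L :: "'a::complex_normed_vector \<Rightarrow> 'a"
  assumes L: "clinear L" and E: "complex_vector.subspace E" "E \<subseteq> complex_vector.span B" "finite B"
    and LE: "L ` E \<subseteq> E" and inj: "\<And>x. x \<in> E \<Longrightarrow> L x = 0 \<Longrightarrow> x = 0"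
  shows "L ` E = E"
proof (rule subspace_eqI_dim[OF _ LE E(2,3)])
  interpret vector_space_pair "scaleC :: complex \<Rightarrow> 'a \<Rightarrow> 'a" "scaleC :: complex \<Rightarrow> 'a \<Rightarrow> 'a" ..
  obtain B1 where B1: "B1 \<subseteq> E" "complex_vector.independent B1" "E \<subseteq> complex_vector.span B1"
    "card B1 = complex_vector.dim E"
    using complex_vector.basis_exists .
  have spanB1: "complex_vector.span B1 = E"
    using complex_vector.span_subspace[OF B1(1,3) E(1)] .
  have injE: "inj_on L E"
  proof (rule inj_onI)
    fix x y assume "x \<in> E" "y \<in> E" "L x = L y"
    then show "x = y"
      using inj[of "x - y"] by (simp add: clinear_diff[OF L] complex_vector.subspace_diff[OF E(1)])
  qed
  have span: "complex_vector.span (L ` B1) = L ` E"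
    using linear_span_image[OF L, of B1] spanB1 by simp
  show "complex_vector.subspace (L ` E)" unfolding span[symmetric] by (rule complex_vector.subspace_span)
  have "complex_vector.independent (L ` B1)"
    using linear_independent_injective_image[OF L B1(2)] injE spanB1 by simp
  then have "complex_vector.dim (L ` E) = card (L ` B1)"
    unfolding span[symmetric] by (rule complex_vector.dim_span_eq_card_independent)
  also have "card (L ` B1) = card B1"
    using injE B1(1) by (intro card_image) (rule inj_on_subset)
  finally show "complex_vector.dim E \<le> complex_vector.dim (L ` E)" using B1(4) by simp
qed

section \<open>Eigenvectors on finite-dimensional invariant subspaces\<close>

definition poly_apply :: "('a \<Rightarrow> 'a) \<Rightarrow> complex poly \<Rightarrow> 'a \<Rightarrow> 'a::complex_normed_vector" where
  "poly_apply S p x = (\<Sum>i\<le>degree p. coeff p i *\<^sub>C (S ^^ i) x)"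

lemma poly_apply_eq:
  assumes "degree p \<le> n"
  shows "poly_apply S p x = (\<Sum>i\<le>n. coeff p i *\<^sub>C (S ^^ i) x)"
  unfolding poly_apply_def using assms
  by (intro sum.mono_neutral_left) (auto simp: coeff_eq_0)

lemma clinear_funpow:
  fixes S :: "'a::complex_normed_vector \<Rightarrow> 'a"
  shows "clinear S \<Longrightarrow> clinear (S ^^ n)"
  by (induction n) (auto intro!: clinearI simp: clinear_add clinear_scale)

lemma poly_apply_linear_factor:
  assumes S: "clinear S"
  shows "poly_apply S ([:-z, 1:] * q) x = poly_apply S q (S x - z *\<^sub>C x)"
proof -
  have coeff: "coeff ([:-z, 1:] * q) i = coeff (pCons 0 q) i - z * coeff q i" for i
    by simp
  have "poly_apply S ([:-z, 1:] * q) x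
      = (\<Sum>i\<le>Suc (degree q). coeff ([:-z, 1:] * q) i *\<^sub>C (S ^^ i) x)"
    by (rule poly_apply_eq) (rule order_trans[OF degree_mult_le], simp)
  also have "\<dots> = (\<Sum>i\<le>Suc (degree q). coeff (pCons 0 q) i *\<^sub>C (S ^^ i) x)
      - z *\<^sub>C (\<Sum>i\<le>Suc (degree q). coeff q i *\<^sub>C (S ^^ i) x)"
    unfolding coeff
    by (simp only: complex_vector.scale_left_diff_distrib sum_subtractf complex_vector.scale_sum_right scaleC_scaleC)
  also have "(\<Sum>i\<le>Suc (degree q). coeff (pCons 0 q) i *\<^sub>C (S ^^ i) x) = (\<Sum>i\<le>degree q. coeff q i *\<^sub>C (S ^^ i) (S x))"
    by (subst sum.atMost_Suc_shift) (simp add: funpow_swap1)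
  also have "(\<Sum>i\<le>Suc (degree q). coeff q i *\<^sub>C (S ^^ i) x) = (\<Sum>i\<le>degree q. coeff q i *\<^sub>C (S ^^ i) x)"
    by (simp add: coeff_eq_0)
  also have "(\<Sum>i\<le>degree q. coeff q i *\<^sub>C (S ^^ i) (S x)) - z *\<^sub>C (\<Sum>i\<le>degree q. coeff q i *\<^sub>C (S ^^ i) x)
     = poly_apply S q (S x - z *\<^sub>C x)"
    by (simp add: poly_apply_def clinear_diff[OF clinear_funpow[OF S]] clinear_scale[OF clinear_funpow[OF S]]
        complex_vector.scale_right_diff_distrib sum_subtractf complex_vector.scale_sum_right mult.commute)
  finally show ?thesis .
qed

text \<open>Split off a linear factor and apply it to \<open>x\<close>: either the result vanishes,
  and \<open>x\<close> is an eigenvector, or the remaining factor of lower degree annihilates a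
  nonzero vector.\<close>

lemma eigenvector_of_poly:
  assumes S: "clinear S" and E: "complex_vector.subspace E" "S ` E \<subseteq> E"
    and "p \<noteq> 0" "x \<in> E" "x \<noteq> 0" "poly_apply S p x = 0"
  shows "\<exists>z v. v \<in> E \<and> v \<noteq> 0 \<and> S v = z *\<^sub>C v"
  using assms(4-7)
proof (induction "degree p" arbitrary: p x rule: less_induct)
  case less
  show ?case
  proof (cases "degree p = 0")
    case True
    then obtain c where c: "p = [:c:]" by (rule degree_eq_zeroE)
    then have "c *\<^sub>C x = 0" "c \<noteq> 0" using less.prems by (auto simp: poly_apply_def)
    then show ?thesis using less.prems(3) by simp
  next
    case False
    then obtain z where "poly p z = 0"
      using fundamental_theorem_of_algebra_alt[of p] by (metis degree_pCons_0)
    then obtain q where q: "p = [:-z, 1:] * q" by (metis poly_eq_0_iff_dvd dvdE)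
    then have "q \<noteq> 0" using less.prems(1) by auto
    then have deg: "degree q < degree p" unfolding q by (subst degree_mult_eq) auto
    define w where "w = S x - z *\<^sub>C x"
    have "w \<in> E" unfolding w_def using E less.prems(2)
      by (intro complex_vector.subspace_diff complex_vector.subspace_scale) auto
    moreover have "poly_apply S q w = 0"
      using less.prems(4) unfolding q w_def poly_apply_linear_factor[OF S] .
    ultimately show ?thesis
      using less.hyps[OF deg \<open>q \<noteq> 0\<close>, of w] less.prems(2,3) by (cases "w = 0") (auto simp: w_def)
  qed
qed

lemma eigenvector_exists:
  fixes S :: "'a::complex_normed_vector \<Rightarrow> 'a"
  assumes S: "clinear S" and E: "complex_vector.subspace E" "S ` E \<subseteq> E"
    and fin: "E \<subseteq> complex_vector.span B" "finite B" and x: "x \<in> E" "x \<noteq> 0"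
  shows "\<exists>z v. v \<in> E \<and> v \<noteq> 0 \<and> S v = z *\<^sub>C v"
proof -
  define N where "N = card B"
  have SE: "(S ^^ i) x \<in> E" for i
    using E(2) x(1) by (induction i) auto
  obtain c where c: "\<exists>i\<le>N. c i \<noteq> 0" "(\<Sum>i\<le>N. c i *\<^sub>C (S ^^ i) x) = 0"
  \<comment> \<open>Linear dependence is a property of the set of iterates, so a repeated iterate is
    treated apart; it gives the relation with coefficients 1 and -1.\<close>
  proof (cases "inj_on (\<lambda>i. (S ^^ i) x) {..N}")
    case True
    have "complex_vector.dependent ((\<lambda>i. (S ^^ i) x) ` {..N})"
    proof (rule ccontr)
      assume "complex_vector.independent ((\<lambda>i. (S ^^ i) x) ` {..N})"
      then have "card ((\<lambda>i. (S ^^ i) x) ` {..N}) \<le> card B"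
        using complex_vector.independent_span_bound[OF fin(2)] SE fin(1) by blast
      then show False unfolding card_image[OF True] N_def[symmetric] by simp
    qed
    then obtain u where u: "\<exists>v\<in>(\<lambda>i. (S ^^ i) x) ` {..N}. u v \<noteq> 0"
      "(\<Sum>v\<in>(\<lambda>i. (S ^^ i) x) ` {..N}. u v *\<^sub>C v) = 0"
      by (auto simp: complex_vector.dependent_finite)
    show ?thesis
      by (rule that[of "\<lambda>i. u ((S ^^ i) x)"])
        (use u in \<open>auto simp: sum.reindex[OF True]\<close>)
  next
    case False
    then obtain i j where ij: "i \<le> N" "j \<le> N" "i \<noteq> j" "(S ^^ i) x = (S ^^ j) x"
      by (auto simp: inj_on_def)
    define c :: "nat \<Rightarrow> complex" where "c k = (if k = i then 1 else if k = j then -1 else 0)" for k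
    have "(\<Sum>k\<le>N. c k *\<^sub>C (S ^^ k) x) = (\<Sum>k\<in>{i, j}. c k *\<^sub>C (S ^^ k) x)"
      using ij by (intro sum.mono_neutral_right) (auto simp: c_def)
    also have "\<dots> = 0" using ij by (simp add: c_def)
    finally have "(\<Sum>k\<le>N. c k *\<^sub>C (S ^^ k) x) = 0" .
    moreover have "c i \<noteq> 0" by (simp add: c_def)
    ultimately show ?thesis using that ij(1) by blast
  qed
  define p where "p = (\<Sum>i\<le>N. monom (c i) i)"
  have coeff: "coeff p i = (if i \<le> N then c i else 0)" for i
    by (simp add: p_def coeff_sum)
  have "p \<noteq> 0" using c(1) coeff by (metis coeff_0)
  moreover have "degree p \<le> N" by (rule degree_le) (simp add: coeff)
  then have "poly_apply S p x = 0" using c(2) by (simp add: poly_apply_eq coeff)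
  ultimately show ?thesis by (intro eigenvector_of_poly[OF S E _ x])
qed

text \<open>Take a nonzero invariant subspace \<open>F\<close> of least dimension. An eigenspace of
  \<open>S\<close> in \<open>F\<close> is invariant under everything that commutes with
  \<open>S\<close>, so it is all of \<open>F\<close>; thus every operator of the family is a scalar
  on \<open>F\<close>.\<close>

lemma common_eigenvector_exists:
  fixes E :: "'a::complex_normed_vector set"
  assumes lin: "\<And>S. S \<in> \<T> \<Longrightarrow> clinear S"
    and comm: "\<And>S S' x. S \<in> \<T> \<Longrightarrow> S' \<in> \<T> \<Longrightarrow> x \<in> E \<Longrightarrow> S (S' x) = S' (S x)"
    and E: "complex_vector.subspace E" "\<And>S. S \<in> \<T> \<Longrightarrow> S ` E \<subseteq> E"
    and fin: "E \<subseteq> complex_vector.span B" "finite B" and ne: "E \<noteq> {0}"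
  shows "\<exists>v\<in>E. v \<noteq> 0 \<and> (\<forall>S\<in>\<T>. \<exists>c. S v = c *\<^sub>C v)"
proof -
  define \<E> where "\<E> F \<longleftrightarrow> complex_vector.subspace F \<and> F \<subseteq> E \<and> F \<noteq> {0} \<and> (\<forall>S\<in>\<T>. S ` F \<subseteq> F)" for F
  have "\<E> E" using E ne by (auto simp: \<E>_def)
  then obtain F where F: "\<E> F" "\<And>G. \<E> G \<Longrightarrow> complex_vector.dim F \<le> complex_vector.dim G"
    using arg_min_nat_lemma[of \<E> E complex_vector.dim] by blast
  have Fsub: "complex_vector.subspace F" "F \<subseteq> E" "F \<noteq> {0}" "\<And>S. S \<in> \<T> \<Longrightarrow> S ` F \<subseteq> F"
    using F(1) by (auto simp: \<E>_def)
  have finF: "F \<subseteq> complex_vector.span B" using Fsub(2) fin(1) by blast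
  obtain x where x: "x \<in> F" "x \<noteq> 0"
    using Fsub(1,3) complex_vector.subspace_0 by blast
  have "\<exists>c. S x = c *\<^sub>C x" if S: "S \<in> \<T>" for S
  proof -
    obtain z v where v: "v \<in> F" "v \<noteq> 0" "S v = z *\<^sub>C v"
      using eigenvector_exists[OF lin[OF S] Fsub(1) Fsub(4)[OF S] finF fin(2) x] by blast
    define G where "G = {y \<in> F. S y = z *\<^sub>C y}"
    have "complex_vector.subspace G"
      unfolding complex_vector.subspace_def G_def using Fsub(1) lin[OF S]
      by (auto simp: complex_vector.subspace_def clinear_zero clinear_add clinear_scale scaleC_add_right mult.commute)
    moreover have "S' ` G \<subseteq> G" if S': "S' \<in> \<T>" for S'
    proof
      fix w assume "w \<in> S' ` G"
      then obtain y where y: "y \<in> F" "S y = z *\<^sub>C y" "w = S' y" by (auto simp: G_def)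
      have "S w = S' (S y)" using comm[OF S S', of y] y Fsub(2) by auto
      also have "\<dots> = z *\<^sub>C w" by (simp add: y clinear_scale[OF lin[OF S']])
      finally show "w \<in> G" using y Fsub(4)[OF S'] by (auto simp: G_def)
    qed
    moreover have "v \<in> G" using v by (auto simp: G_def)
    ultimately have "\<E> G" using Fsub(2) v(2) by (auto simp: \<E>_def G_def)
    then have "G = F"
      using \<open>complex_vector.subspace G\<close> F(2) finF fin(2) by (intro subspace_eqI_dim) (auto simp: G_def)
    then show ?thesis using x(1) by (auto simp: G_def)
  qed
  then show ?thesis using x Fsub(2) by blast
qed

section \<open>Orthonormal flags and triangular matrices\<close>

lemma orthonormal_independent:
  assumes f: "orthonormal I f" and I: "finite I"
  shows "inj_on f I" "complex_vector.independent (f ` I)"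
proof -
  show inj: "inj_on f I"
    using f unfolding orthonormal_def inj_on_def by (metis zero_neq_one)
  show "complex_vector.independent (f ` I)"
  proof (rule complex_vector.independent_if_scalars_zero)
    fix c x assume c: "(\<Sum>x\<in>f ` I. c x *\<^sub>C x) = 0" and "x \<in> f ` I"
    then obtain j where j: "j \<in> I" "x = f j" by blast
    have "0 = cinner (\<Sum>i\<in>I. c (f i) *\<^sub>C f i) (f j)"
      using c by (simp add: sum.reindex[OF inj])
    also have "\<dots> = (\<Sum>i\<in>I. if i = j then c (f i) else 0)"
      unfolding cinner_sum_left cinner_scaleC_left
      using f j by (intro sum.cong) (auto simp: orthonormal_def)
    also have "\<dots> = c x" using I j by simp
    finally show "c x = 0" by simp
  qed (use I in simp)
qed

lemma orthonormal_card_le: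
  assumes f: "orthonormal {..<n} f" and B: "f ` {..<n} \<subseteq> complex_vector.span B" "finite B"
  shows "n \<le> card B"
  using complex_vector.independent_span_bound[OF B(2) orthonormal_independent(2)[OF f] B(1)]
    card_image[OF orthonormal_independent(1)[OF f]] by simp

text \<open>Every \<open>S\<close> of the family is upper triangular in the basis \<open>f\<close>.
  Membership in a span is written as a fixed-point equation of a projection, so that coordinates can
  be read off directly.\<close>

definition flag :: "('a::complex_inner \<Rightarrow> 'a) set \<Rightarrow> (nat \<Rightarrow> 'a) \<Rightarrow> nat \<Rightarrow> bool" where
  "flag \<T> f n \<longleftrightarrow> orthonormal {..<n} f \<and> (\<forall>S\<in>\<T>. \<forall>j<n. proj f {..j} (S (f j)) = S (f j))"

lemma flag_orthonormal: "flag \<T> f n \<Longrightarrow> orthonormal {..<n} f"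
  by (simp add: flag_def)

lemma flag_orthosystem: "flag \<T> f n \<Longrightarrow> m \<le> n \<Longrightarrow> orthosystem {..<m} f"
  by (auto simp: flag_def intro!: orthonormal_orthosystem intro: orthonormal_mono)

lemma flag_invariant_span:
  assumes fl: "flag \<T> f n" and S: "S \<in> \<T>" "clinear S" and m: "m \<le> n"
    and x: "x \<in> complex_vector.span (f ` {..<m})"
  shows "S x \<in> complex_vector.span (f ` {..<m})"
  using x
proof (induction rule: complex_vector.span_induct_alt)
  case base
  show ?case by (simp add: clinear_zero[OF S(2)] complex_vector.span_zero)
next
  case (step c u v)
  then obtain j where j: "j < m" "u = f j" by auto
  have "proj f {..j} (S (f j)) = S (f j)" using fl S(1) j m by (auto simp: flag_def)
  then have "S u \<in> complex_vector.span (f ` {..j})" by (metis proj_in_span j(2))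
  also have "\<dots> \<subseteq> complex_vector.span (f ` {..<m})"
    using j by (intro complex_vector.span_mono) auto
  finally show ?case using step
    by (auto simp: clinear_add[OF S(2)] clinear_scale[OF S(2)] intro: complex_vector.span_add complex_vector.span_scale)
qed

lemma flag_invariant:
  assumes fl: "flag \<T> f n" and S: "S \<in> \<T>" "clinear S" and m: "m \<le> n"
  shows "proj f {..<m} (S (proj f {..<m} x)) = S (proj f {..<m} x)"
  by (rule proj_fix[OF flag_orthosystem[OF fl m] _ flag_invariant_span[OF fl S m proj_in_span]]) simp

text \<open>The span is invariant, so the part of \<open>x\<close> in it is lost after compression.
  Consequently compressions to the orthogonal complement multiply like the operators
  themselves.\<close>

lemma flag_compress:
  assumes fl: "flag \<T> f n" and S: "S \<in> \<T>" "clinear S"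
  shows "S x - proj f {..<n} (S x)
    = S (x - proj f {..<n} x) - proj f {..<n} (S (x - proj f {..<n} x))"
  using flag_invariant[OF fl S order_refl, of x]
  by (simp add: clinear_diff[OF S(2)] clinear_diff[OF clinear_proj])

text \<open>For \<open>i < k\<close> the vector \<open>S1 (f i)\<close> has no component along
  \<open>f k\<close>, so only the index \<open>k\<close> survives.\<close>

lemma flag_diag_mult:
  assumes fl: "flag \<T> f n" and S: "S1 \<in> \<T>" "clinear S1" "S2 \<in> \<T>" and k: "k < n"
  shows "cinner (S1 (S2 (f k))) (f k) = cinner (S1 (f k)) (f k) * cinner (S2 (f k)) (f k)"
proof -
  have "proj f {..k} (S2 (f k)) = S2 (f k)" using fl S(3) k by (auto simp: flag_def)
  then have "cinner (S1 (S2 (f k))) (f k) = cinner (S1 (\<Sum>i\<in>{..k}. cinner (S2 (f k)) (f i) *\<^sub>C f i)) (f k)"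
    by (simp add: proj_def)
  also have "\<dots> = (\<Sum>i\<in>{..k}. cinner (S2 (f k)) (f i) * cinner (S1 (f i)) (f k))"
    by (simp add: clinear_sum[OF S(2)] clinear_scale[OF S(2)] cinner_sum_left cinner_scaleC_left)
  also have "\<dots> = (\<Sum>i\<in>{..k}. if i = k then cinner (S2 (f k)) (f k) * cinner (S1 (f k)) (f k) else 0)"
  proof (intro sum.cong refl)
    fix i assume i: "i \<in> {..k}"
    show "cinner (S2 (f k)) (f i) * cinner (S1 (f i)) (f k)
        = (if i = k then cinner (S2 (f k)) (f k) * cinner (S1 (f k)) (f k) else 0)"
    proof (cases "i = k")
      case False
      then have "proj f {..i} (S1 (f i)) = S1 (f i)" using fl S(1) k i by (auto simp: flag_def)
      then have "cinner (S1 (f i)) (f k) = cinner (proj f {..i} (S1 (f i))) (f k)" by simp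
      also have "\<dots> = (\<Sum>j\<in>{..i}. cinner (S1 (f i)) (f j) * cinner (f j) (f k))"
        by (simp add: proj_def cinner_sum_left cinner_scaleC_left)
      also have "\<dots> = 0"
        using flag_orthonormal[OF fl] i k False by (intro sum.neutral) (auto simp: orthonormal_def)
      finally show ?thesis using False by simp
    qed simp
  qed
  also have "\<dots> = cinner (S1 (f k)) (f k) * cinner (S2 (f k)) (f k)" by simp
  finally show ?thesis .
qed

lemma proj_upd: "n \<notin> I \<Longrightarrow> proj (f(n := v)) I = proj f I"
  unfolding proj_def by (intro ext sum.cong) auto

lemma flag_extend:
  assumes fl: "flag \<T> f n" and v: "norm v = 1" "\<And>i. i < n \<Longrightarrow> cinner v (f i) = 0"
    and eig: "\<And>S. S \<in> \<T> \<Longrightarrow> \<exists>c. S v - proj f {..<n} (S v) = c *\<^sub>C v"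
  shows "flag \<T> (f(n := v)) (Suc n)"
  unfolding flag_def
proof (intro conjI ballI allI impI)
  have "cinner (f i) v = 0" if "i < n" for i using v(2)[OF that] cinner_eq_0_commute by blast
  then show on: "orthonormal {..<Suc n} (f(n := v))"
    using flag_orthonormal[OF fl] v by (auto simp: orthonormal_def norm_one_iff)
  fix S j assume S: "S \<in> \<T>" and j: "j < Suc n"
  show "proj (f(n := v)) {..j} (S ((f(n := v)) j)) = S ((f(n := v)) j)"
  proof (cases "j = n")
    case False
    then show ?thesis using fl S j by (auto simp: flag_def proj_upd)
  next
    case True
    obtain c where "S v - proj f {..<n} (S v) = c *\<^sub>C v" using eig[OF S] by blast
    then have "S v = c *\<^sub>C v + proj (f(n := v)) {..<n} (S v)" by (simp add: proj_upd algebra_simps)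
    also have "\<dots> \<in> complex_vector.span ((f(n := v)) ` {..n})"
    proof (intro complex_vector.span_add complex_vector.span_scale)
      show "v \<in> complex_vector.span ((f(n := v)) ` {..n})"
        by (rule complex_vector.span_base) auto
      show "proj (f(n := v)) {..<n} (S v) \<in> complex_vector.span ((f(n := v)) ` {..n})"
        by (rule subsetD[OF complex_vector.span_mono proj_in_span]) auto
    qed
    finally show ?thesis
      using True orthonormal_orthosystem[OF on] by (simp add: proj_fix lessThan_Suc_atMost)
  qed
qed

text \<open>On the orthogonal complement the compressions commute because they compose like the
  operators; a normalised common eigenvector of theirs is the next flag vector.\<close>

lemma flag_extend_finite:
  fixes f :: "nat \<Rightarrow> 'a::complex_inner"
  assumes fl: "flag \<T> f n" and lin: "\<And>S. S \<in> \<T> \<Longrightarrow> clinear S"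
    and comm: "\<And>S S' x. S \<in> \<T> \<Longrightarrow> S' \<in> \<T> \<Longrightarrow> S (S' x) = S' (S x)"
    and E: "complex_vector.subspace E" "\<And>x i. x \<in> E \<Longrightarrow> i < n \<Longrightarrow> cinner x (f i) = 0"
      "\<And>S x. S \<in> \<T> \<Longrightarrow> x \<in> E \<Longrightarrow> S x - proj f {..<n} (S x) \<in> E"
    and fin: "E \<subseteq> complex_vector.span B" "finite B" and ne: "E \<noteq> {0}"
  obtains v where "v \<in> E" "norm v = 1" "flag \<T> (f(n := v)) (Suc n)"
    "\<And>S. S \<in> \<T> \<Longrightarrow> \<exists>c. S v - proj f {..<n} (S v) = c *\<^sub>C v"
proof -
  define C where "C S x = S x - proj f {..<n} (S x)" for S and x :: 'a
  have linC: "clinear (C S)" if "S \<in> \<T>" for S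
    using lin[OF that] clinear_proj[of f "{..<n}"] unfolding C_def
    by (intro clinearI) (simp_all add: clinear_add clinear_scale complex_vector.scale_right_diff_distrib)
  have CC: "C S (C S' x) = C (S \<circ> S') x" if "S \<in> \<T>" "S' \<in> \<T>" for S S' x
    unfolding C_def comp_def using flag_compress[OF fl that(1) lin[OF that(1)], of "S' x"] by simp
  have "\<exists>v\<in>E. v \<noteq> 0 \<and> (\<forall>S\<in>C ` \<T>. \<exists>c. S v = c *\<^sub>C v)"
  proof (rule common_eigenvector_exists[OF _ _ E(1) _ fin ne])
    fix S S' x assume "S \<in> C ` \<T>" "S' \<in> C ` \<T>"
    then obtain U U' where U: "U \<in> \<T>" "U' \<in> \<T>" "S = C U" "S' = C U'" by blast
    have "U \<circ> U' = U' \<circ> U" using comm U by auto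
    then show "S (S' x) = S' (S x)" using U by (simp add: CC)
  next
    show "S ` E \<subseteq> E" if "S \<in> C ` \<T>" for S using E(3) that by (auto simp: C_def)
  qed (use linC in auto)
  then obtain w where w: "w \<in> E" "w \<noteq> 0" "\<And>S. S \<in> \<T> \<Longrightarrow> \<exists>c. C S w = c *\<^sub>C w" by auto
  define v where "v = complex_of_real (1 / norm w) *\<^sub>C w"
  have v: "v \<in> E" "norm v = 1"
    using w E(1) by (auto simp: v_def norm_scaleC norm_divide intro: complex_vector.subspace_scale)
  have eig: "\<exists>c. C S v = c *\<^sub>C v" if "S \<in> \<T>" for S
    using w(3)[OF that] by (auto simp: v_def clinear_scale[OF linC[OF that]] mult.commute)
  then have "flag \<T> (f(n := v)) (Suc n)"
    using v E(2) by (intro flag_extend[OF fl]) (auto simp: C_def)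
  then show ?thesis using that v eig by (auto simp: C_def)
qed

text \<open>Schur triangularisation inside an invariant subspace. A longest flag in \<open>R\<close>
  must exhaust \<open>R\<close>, since otherwise the compressed part of \<open>R\<close> is nonzero
  and supplies another vector.\<close>

lemma schur_flag:
  fixes S :: "'a::complex_inner \<Rightarrow> 'a"
  assumes S: "clinear S" and R: "complex_vector.subspace R" "S ` R \<subseteq> R"
    and fin: "R \<subseteq> complex_vector.span B" "finite B"
  obtains f n where "flag {S} f n" "f ` {..<n} \<subseteq> R" "\<And>x. x \<in> R \<Longrightarrow> proj f {..<n} x = x"
proof -
  define good where "good n \<longleftrightarrow> (\<exists>f. flag {S} f n \<and> f ` {..<n} \<subseteq> R)" for n
  have "good 0" by (simp add: good_def flag_def orthonormal_def)
  moreover have "n \<le> card B" if "good n" for n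
    using that fin unfolding good_def by (meson flag_orthonormal order_trans orthonormal_card_le)
  ultimately have good: "good (Greatest good)" and great: "\<And>n. good n \<Longrightarrow> n \<le> Greatest good"
    by (metis GreatestI_nat, metis Greatest_le_nat)
  define n where "n = Greatest good"
  obtain f where f: "flag {S} f n" "f ` {..<n} \<subseteq> R" using good unfolding good_def n_def by blast
  define Q where "Q x = x - proj f {..<n} x" for x
  have os: "orthosystem {..<n} f" by (rule flag_orthosystem[OF f(1) order_refl])
  have projR: "proj f {..<n} x \<in> R" for x
    unfolding proj_def using f(2) by (intro complex_vector.subspace_sum complex_vector.subspace_scale R(1)) auto
  have QR: "Q x \<in> R" if "x \<in> R" for x
    unfolding Q_def by (intro complex_vector.subspace_diff R(1) that projR)
  have linQ: "clinear Q"
    unfolding Q_def using clinear_proj[of f "{..<n}"]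
    by (intro clinearI) (simp_all add: clinear_add clinear_scale complex_vector.scale_right_diff_distrib)
  have "Q ` R = {0}"
  proof (rule ccontr)
    assume ne: "Q ` R \<noteq> {0}"
    obtain v where v: "v \<in> Q ` R" "flag {S} (f(n := v)) (Suc n)"
    proof (rule flag_extend_finite[OF f(1) _ _ _ _ _ _ fin(2) ne])
      show "complex_vector.subspace (Q ` R)"
        unfolding complex_vector.subspace_def using R(1)
        by (auto simp: complex_vector.subspace_def image_iff simp flip: clinear_add[OF linQ] clinear_scale[OF linQ])
          (metis clinear_zero[OF linQ])
      show "Q ` R \<subseteq> complex_vector.span B" using QR fin(1) by blast
      show "cinner x (f i) = 0" if "x \<in> Q ` R" "i < n" for x i
        using that cinner_proj_basis[OF os] by (auto simp: Q_def cinner_diff_left)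
      show "S' x - proj f {..<n} (S' x) \<in> Q ` R" if "S' \<in> {S}" "x \<in> Q ` R" for S' x
      proof -
        have "x \<in> R" using that(2) QR by auto
        then show ?thesis using R(2) that(1) by (auto simp: Q_def)
      qed
    qed (use S in auto)
    have "good (Suc n)"
      unfolding good_def using v QR f(2) by (intro exI[of _ "f(n := v)"]) (auto simp: less_Suc_eq)
    then show False using great[of "Suc n"] by (simp add: n_def)
  qed
  then have "proj f {..<n} x = x" if "x \<in> R" for x
  proof -
    have "Q x \<in> Q ` R" using that by (rule imageI)
    then have "Q x = 0" using \<open>Q ` R = {0}\<close> by simp
    then show ?thesis by (simp add: Q_def)
  qed
  then show ?thesis using that[OF f] by blast
qed

text \<open>The vectors \<open>P (f k)\<close> with diagonal entry 1 form a basis of the range. Such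
  a vector is independent of the earlier ones because of its component along \<open>f k\<close>; a
  diagonal entry 0 adds nothing, by idempotence.\<close>

lemma op_rank_idempotent:
  fixes P :: "'a::complex_inner \<Rightarrow> 'a"
  assumes P: "clinear P" "\<And>x. P (P x) = P x" and rng: "range P \<subseteq> complex_vector.span (f ` {..<n})"
    and fl: "flag {P} f n" and diag: "\<And>k. k < n \<Longrightarrow> cinner (P (f k)) (f k) = (if k \<in> J then 1 else 0)"
  shows "op_rank P = enat (card {k \<in> J. k < n})"
proof -
  define I where "I m = {k \<in> J. k < m}" for m
  have os: "orthosystem {..<m} f" if "m \<le> n" for m by (rule flag_orthosystem[OF fl that])
  have finI: "finite (I m)" for m by (simp add: I_def)
  have *: "complex_vector.independent ((\<lambda>k. P (f k)) ` I m) \<and> card ((\<lambda>k. P (f k)) ` I m) = card (I m) \<and>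
      (\<forall>j<m. P (f j) \<in> complex_vector.span ((\<lambda>k. P (f k)) ` I m))" if "m \<le> n" for m
    using that
  proof (induction m)
    case 0
    show ?case by (simp add: I_def complex_vector.independent_empty)
  next
    case (Suc m)
    define W where "W = complex_vector.span ((\<lambda>k. P (f k)) ` I m)"
    have IH: "complex_vector.independent ((\<lambda>k. P (f k)) ` I m)" "card ((\<lambda>k. P (f k)) ` I m) = card (I m)"
      "\<And>j. j < m \<Longrightarrow> P (f j) \<in> W"
      using Suc by (auto simp: W_def)
    have m: "m < n" "m \<le> n" using Suc.prems by auto
    have Wsub: "W \<subseteq> complex_vector.span (f ` {..<m})"
      unfolding W_def
    proof (rule complex_vector.span_minimal)
      show "(\<lambda>k. P (f k)) ` I m \<subseteq> complex_vector.span (f ` {..<m})"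
      proof clarify
        fix k assume "k \<in> I m"
        then show "P (f k) \<in> complex_vector.span (f ` {..<m})"
          using m by (intro flag_invariant_span[OF fl _ P(1)]) (auto simp: I_def intro: complex_vector.span_base)
      qed
    qed simp
    have fm: "cinner u (f m) = 0" if u: "u \<in> complex_vector.span (f ` {..<m})" for u
    proof -
      have "u = proj f {..<m} u" using proj_fix[OF os[OF m(2)] _ u] by simp
      then have "cinner u (f m) = cinner (proj f {..<m} u) (f m)" by simp
      also have "\<dots> = (\<Sum>j\<in>{..<m}. cinner u (f j) * cinner (f j) (f m))"
        by (simp add: proj_def cinner_sum_left cinner_scaleC_left)
      also have "\<dots> = 0"
        using flag_orthonormal[OF fl] m(1) by (intro sum.neutral) (auto simp: orthonormal_def)
      finally show ?thesis .
    qed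
    show ?case
    proof (cases "m \<in> J")
      case True
      then have I: "I (Suc m) = insert m (I m)" by (auto simp: I_def)
      have "P (f m) \<notin> W" using fm Wsub diag[OF m(1)] True by auto
      then show ?thesis
        using IH finI[of m]
        by (auto simp: I W_def less_Suc_eq card_insert_if complex_vector.independent_insertI
            intro: complex_vector.span_base subsetD[OF complex_vector.span_mono])
    next
      case False
      then have I: "I (Suc m) = I m" by (auto simp: I_def less_Suc_eq)
      have "proj f {..m} (P (f m)) = P (f m)" using fl m by (auto simp: flag_def)
      then have "P (f m) = cinner (P (f m)) (f m) *\<^sub>C f m + proj f {..<m} (P (f m))"
        by (simp add: proj_def lessThan_Suc_atMost[symmetric] add.commute)
      also have "\<dots> = proj f {..<m} (P (f m))" using diag[OF m(1)] False by simp
      \<comment> \<open>With diagonal entry 0, \<open>P (f m)\<close> lies in the span of the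
        earlier flag vectors; applying \<open>P\<close> once more writes it through their
        images.\<close>
      finally have "P (f m) = P (\<Sum>j<m. cinner (P (f m)) (f j) *\<^sub>C f j)"
        by (metis P(2) proj_def)
      also have "\<dots> = (\<Sum>j<m. cinner (P (f m)) (f j) *\<^sub>C P (f j))"
        by (simp add: clinear_sum[OF P(1)] clinear_scale[OF P(1)])
      also have "\<dots> \<in> W" unfolding W_def
        by (intro complex_vector.span_sum complex_vector.span_scale) (use IH(3) in \<open>simp add: W_def\<close>)
      finally show ?thesis using IH by (auto simp: I W_def less_Suc_eq)
    qed
  qed
  define B where "B = (\<lambda>k. P (f k)) ` I n"
  have B: "complex_vector.independent B" "card B = card (I n)" "\<And>j. j < n \<Longrightarrow> P (f j) \<in> complex_vector.span B"
    using *[OF order_refl] by (auto simp: B_def)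
  have "range P \<subseteq> complex_vector.span B"
  proof clarify
    fix x
    have "P x = proj f {..<n} (P x)" 
      by (rule proj_fix[OF os[OF order_refl] finite_lessThan subsetD[OF rng rangeI], symmetric])
    then have "P x = P (\<Sum>j<n. cinner (P x) (f j) *\<^sub>C f j)" by (metis P(2) proj_def)
    also have "\<dots> = (\<Sum>j<n. cinner (P x) (f j) *\<^sub>C P (f j))"
      by (simp add: clinear_sum[OF P(1)] clinear_scale[OF P(1)])
    also have "\<dots> \<in> complex_vector.span B"
      using B(3) by (intro complex_vector.span_sum complex_vector.span_scale) auto
    finally show "P x \<in> complex_vector.span B" .
  qed
  moreover have "B \<subseteq> range P" by (auto simp: B_def)
  moreover have "finite B" using finI by (simp add: B_def)
  ultimately have "\<exists>B. finite B \<and> range P \<subseteq> complex_vector.span B" "complex_vector.dim (range P) = card (I n)"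
    using complex_vector.dim_unique[OF _ _ B(1,2)] by blast+
  then show ?thesis by (simp add: op_rank_def I_def)
qed

section \<open>Spectral properties of operators with a nuclear representation\<close>

lemma nuclear_rep_clinear:
  assumes S: "nuclear_rep S a b c"
  shows "clinear S"
proof (rule clinearI)
  fix x y
  have "(\<lambda>i. cinner x (a i) *\<^sub>C b i + cinner y (a i) *\<^sub>C b i) sums (S x + S y)"
    by (intro sums_add nuclear_rep_sums[OF S])
  then have "(\<lambda>i. cinner (x + y) (a i) *\<^sub>C b i) sums (S x + S y)"
    by (simp add: cinner_add_left scaleC_add_left)
  then show "S (x + y) = S x + S y" by (rule sums_unique2[OF nuclear_rep_sums[OF S]])
next
  fix z x
  have "(\<lambda>i. z *\<^sub>C (cinner x (a i) *\<^sub>C b i)) sums (z *\<^sub>C S x)"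
    by (rule bounded_linear.sums[OF bounded_linear_scaleC_right nuclear_rep_sums[OF S]])
  then have "(\<lambda>i. cinner (z *\<^sub>C x) (a i) *\<^sub>C b i) sums (z *\<^sub>C S x)"
    by (simp add: cinner_scaleC_left)
  then show "S (z *\<^sub>C x) = z *\<^sub>C S x" by (rule sums_unique2[OF nuclear_rep_sums[OF S]])
qed

section \<open>Finite-rank truncations, compactness and the Fredholm alternative\<close>

definition trunc :: "(nat \<Rightarrow> 'a) \<Rightarrow> (nat \<Rightarrow> 'a) \<Rightarrow> nat \<Rightarrow> 'a \<Rightarrow> 'a::complex_inner" where
  "trunc a b m x = (\<Sum>i<m. cinner x (a i) *\<^sub>C b i)"

lemma clinear_trunc: "clinear (trunc a b m)"
  by (rule clinearI)
    (simp_all add: trunc_def cinner_add_left cinner_scaleC_left scaleC_add_left sum.distrib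
      complex_vector.scale_sum_right)

lemma trunc_in_span: "trunc a b m x \<in> complex_vector.span (b ` {..<m})"
  unfolding trunc_def
  by (intro complex_vector.span_sum complex_vector.span_scale complex_vector.span_base) auto

lemma trunc_nuclear_rep:
  assumes S: "nuclear_rep S a b c"
  shows "nuclear_rep (trunc a b m) a (\<lambda>i. if i < m then b i else 0) c"
  unfolding nuclear_rep_def
proof (intro conjI allI)
  fix N
  have "(\<Sum>i<N. norm (a i) * norm (if i < m then b i else 0)) \<le> (\<Sum>i<N. norm (a i) * norm (b i))"
    by (rule sum_mono) auto
  also have "\<dots> \<le> c" by (rule nuclear_rep_bound[OF S])
  finally show "(\<Sum>i<N. norm (a i) * norm (if i < m then b i else 0)) \<le> c" .
next
  fix x
  have "(\<lambda>i. cinner x (a i) *\<^sub>C (if i < m then b i else 0)) sums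
      (\<Sum>i<m. cinner x (a i) *\<^sub>C (if i < m then b i else 0))"
    by (rule sums_finite) auto
  then show "(\<lambda>i. cinner x (a i) *\<^sub>C (if i < m then b i else 0)) sums trunc a b m x"
    by (simp add: trunc_def)
qed

text \<open>The error is a tail of the nuclear series, hence tends to 0 uniformly on the unit
  ball.\<close>

lemma nuclear_rep_trunc_error:
  assumes S: "nuclear_rep S a b c"
  obtains \<delta> where "\<delta> \<longlonglongrightarrow> 0" "\<And>m. 0 \<le> \<delta> m" "\<And>m x. norm (S x - trunc a b m x) \<le> \<delta> m * norm x"
proof -
  define g where "g i = norm (a i) * norm (b i)" for i
  have g: "summable g" unfolding g_def
    by (rule summableI_nonneg_bounded[where x = c]) (auto intro: nuclear_rep_bound[OF S])
  define \<delta> where "\<delta> m = suminf g - (\<Sum>i<m. g i)" for m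
  have tail: "(\<Sum>i. g (i + m)) = \<delta> m" for m
    using suminf_minus_initial_segment[OF g, of m] by (simp add: \<delta>_def)
  have "\<delta> \<longlonglongrightarrow> suminf g - suminf g"
    unfolding \<delta>_def by (intro tendsto_diff tendsto_const summable_LIMSEQ g)
  then have "\<delta> \<longlonglongrightarrow> 0" by simp
  moreover have "0 \<le> \<delta> m" for m
    unfolding tail[symmetric]
    by (intro suminf_nonneg summable_ignore_initial_segment[OF g]) (simp add: g_def)
  moreover have "norm (S x - trunc a b m x) \<le> \<delta> m * norm x" for m x
  proof -
    have "(\<lambda>i. cinner x (a (i + m)) *\<^sub>C b (i + m)) sums (S x - trunc a b m x)"
      unfolding trunc_def by (rule sums_split_initial_segment[OF nuclear_rep_sums[OF S]])
    then have "S x - trunc a b m x = (\<Sum>i. cinner x (a (i + m)) *\<^sub>C b (i + m))"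
      by (rule sums_unique)
    also have "norm \<dots> \<le> (\<Sum>i. g (i + m) * norm x)"
    proof (rule norm_suminf_le)
      show "summable (\<lambda>i. g (i + m) * norm x)"
        by (intro summable_mult2 summable_ignore_initial_segment g)
      fix i
      have "norm (cinner x (a (i + m)) *\<^sub>C b (i + m)) \<le> (norm x * norm (a (i + m))) * norm (b (i + m))"
        unfolding norm_scaleC by (intro mult_right_mono cinner_bound) auto
      then show "norm (cinner x (a (i + m)) *\<^sub>C b (i + m)) \<le> g (i + m) * norm x"
        by (simp add: g_def mult_ac)
    qed
    also have "\<dots> = \<delta> m * norm x"
      by (subst suminf_mult2[symmetric]) (simp_all add: tail summable_ignore_initial_segment g)
    finally show ?thesis .
  qed
  ultimately show ?thesis using that by blast
qed

lemma nuclear_rep_bounded_clinear: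
  assumes S: "nuclear_rep S a b c"
  shows "bounded_clinear S"
proof -
  obtain \<delta> where "\<And>m x. norm (S x - trunc a b m x) \<le> \<delta> m * norm x"
    using nuclear_rep_trunc_error[OF S] by metis
  from this[of _ 0] show ?thesis
    by (intro bounded_clinearI'[OF nuclear_rep_clinear[OF S], where K = "\<delta> 0"]) (simp add: trunc_def)
qed

lemma trunc_compact:
  fixes a b :: "nat \<Rightarrow> 'a::complex_hilbert"
  shows "\<exists>C. compact C \<and> (\<forall>x. norm x \<le> 1 \<longrightarrow> trunc a b m x \<in> C)"
proof (induction m)
  case 0
  show ?case by (rule exI[of _ "{0}"]) (simp add: trunc_def)
next
  case (Suc m)
  then obtain C where C: "compact C" "\<And>x. norm x \<le> 1 \<Longrightarrow> trunc a b m x \<in> C" by blast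
  define C' where "C' = (\<lambda>z. z *\<^sub>C b m) ` cball 0 (norm (a m))"
  have "compact C'" unfolding C'_def
    by (intro compact_continuous_image linear_continuous_on bounded_linear_scaleC_left compact_cball)
  then have "compact {x + y |x y. x \<in> C \<and> y \<in> C'}" by (rule compact_sums[OF C(1)])
  moreover have "trunc a b (Suc m) x \<in> {x + y |x y. x \<in> C \<and> y \<in> C'}" if x: "norm x \<le> 1" for x
  proof -
    have "cmod (cinner x (a m)) \<le> norm x * norm (a m)" by (rule cinner_bound)
    also have "\<dots> \<le> 1 * norm (a m)" using x by (intro mult_right_mono) auto
    finally have "cinner x (a m) *\<^sub>C b m \<in> C'" by (auto simp: C'_def)
    then show ?thesis using C(2)[OF x] by (auto simp: trunc_def)
  qed
  ultimately show ?case by blast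
qed

lemma nuclear_rep_compact:
  fixes S :: "'a::complex_hilbert \<Rightarrow> 'a"
  assumes S: "nuclear_rep S a b c"
  shows "compact (closure (S ` cball 0 1))"
  unfolding compact_eq_totally_bounded
proof (intro conjI allI impI)
  show "complete (closure (S ` cball 0 1))" by (simp add: complete_eq_closed)
  fix e :: real assume e: "e > 0"
  obtain \<delta> where \<delta>: "\<delta> \<longlonglongrightarrow> 0" "\<And>m. 0 \<le> \<delta> m" "\<And>m x. norm (S x - trunc a b m x) \<le> \<delta> m * norm x"
    using nuclear_rep_trunc_error[OF S] by blast
  have "\<forall>\<^sub>F m in sequentially. \<delta> m < e / 4"
    using \<delta>(1) e by (intro order_tendstoD(2)) auto
  then obtain m where m: "\<delta> m < e / 4" by (auto simp: eventually_sequentially)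
  obtain C where C: "compact C" "\<And>x. norm x \<le> 1 \<Longrightarrow> trunc a b m x \<in> C"
    using trunc_compact[of a b m] by blast
  have "e / 4 > 0" using e by simp
  then obtain k where k: "finite k" "C \<subseteq> (\<Union>p\<in>k. ball p (e / 4))"
    using C(1) unfolding compact_eq_totally_bounded by meson
  have "S ` cball 0 1 \<subseteq> (\<Union>p\<in>k. cball p (e / 2))"
  proof clarify
    fix x :: 'a assume "x \<in> cball 0 1"
    then have x: "norm x \<le> 1" by simp
    then obtain p where p: "p \<in> k" "dist p (trunc a b m x) < e / 4"
      using C(2) k(2) by fastforce
    have "norm (S x - trunc a b m x) \<le> \<delta> m * 1"
      using \<delta>(3)[of x m] mult_left_mono[OF x \<delta>(2)[of m]] by linarith
    then have "dist (trunc a b m x) (S x) < e / 4" using m by (simp add: dist_norm norm_minus_commute)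
    then have "dist p (S x) \<le> e / 2" using p(2) dist_triangle[of p "S x" "trunc a b m x"] by linarith
    then show "S x \<in> (\<Union>p\<in>k. cball p (e / 2))" using p(1) by auto
  qed
  \<comment> \<open>The covering is first made by closed balls of half the radius, because only a
    closed cover passes to the closure.\<close>
  then have "closure (S ` cball 0 1) \<subseteq> (\<Union>p\<in>k. cball p (e / 2))"
    using k(1) by (intro closure_minimal closed_UN) auto
  also have "\<dots> \<subseteq> (\<Union>p\<in>k. ball p e)" using e by (intro UN_mono) auto
  finally show "\<exists>k. finite k \<and> closure (S ` cball 0 1) \<subseteq> (\<Union>x\<in>k. ball x e)" using k(1) by blast
qed

lemma nuclear_rep_convergent_subsequence:
  fixes S :: "'a::complex_hilbert \<Rightarrow> 'a"
  assumes S: "nuclear_rep S a b c" and x: "\<And>k::nat. norm (x k) \<le> 1"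
  obtains l r where "strict_mono (r :: nat \<Rightarrow> nat)" "(\<lambda>k. S (x (r k))) \<longlonglongrightarrow> l"
proof -
  have "seq_compact (closure (S ` cball 0 1))"
    using nuclear_rep_compact[OF S] by (simp add: compact_eq_seq_compact_metric)
  moreover have "\<forall>k. S (x k) \<in> closure (S ` cball 0 1)"
    using x closure_subset[of "S ` cball 0 1"] by auto
  ultimately obtain l r where "strict_mono r" "((\<lambda>k. S (x k)) \<circ> r) \<longlonglongrightarrow> l"
    unfolding seq_compact_def by metis
  then show ?thesis using that by (simp add: o_def)
qed

text \<open>Approximate eigenpairs have a convergent subsequence: \<open>S (x k)\<close> by
  compactness, \<open>z k\<close> by boundedness, and then \<open>x k\<close> itself since the limit
  of \<open>z k\<close> is nonzero. The limit would be a unit eigenvector. The bound is uniform over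
  \<open>Z\<close>, which may be unbounded.\<close>

lemma nuclear_rep_bounded_below:
  fixes S :: "'a::complex_hilbert \<Rightarrow> 'a"
  assumes S: "nuclear_rep S a b c" and Z: "closed Z" "0 \<notin> Z"
    and no_eig: "\<And>z x. z \<in> Z \<Longrightarrow> S x = z *\<^sub>C x \<Longrightarrow> x = 0"
  shows "\<exists>d>0. \<forall>z\<in>Z. \<forall>x. d * norm x \<le> norm (S x - z *\<^sub>C x)"
proof (rule ccontr)
  assume neg: "\<not> ?thesis"
  note bS = nuclear_rep_bounded_clinear[OF S]
  note lS = bounded_clinear_clinear[OF bS]
  have "\<exists>z x. z \<in> Z \<and> norm x = 1 \<and> norm (S x - z *\<^sub>C x) < inverse (real (Suc k))" for k
  proof -
    have "inverse (real (Suc k)) > 0" by simp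
    then obtain z y where zy: "z \<in> Z" "norm (S y - z *\<^sub>C y) < inverse (real (Suc k)) * norm y"
      using neg by (meson not_le)
    have "norm y > 0" using zy(2) by (cases "y = 0") (auto simp: clinear_zero[OF lS])
    define x where "x = complex_of_real (1 / norm y) *\<^sub>C y"
    have "norm x = 1" using \<open>norm y > 0\<close> by (simp add: x_def norm_scaleC norm_divide)
    moreover have "S x - z *\<^sub>C x = complex_of_real (1 / norm y) *\<^sub>C (S y - z *\<^sub>C y)"
      by (simp add: x_def clinear_scale[OF lS] complex_vector.scale_right_diff_distrib mult.commute)
    then have "norm (S x - z *\<^sub>C x) = norm (S y - z *\<^sub>C y) / norm y"
      by (simp add: norm_scaleC norm_divide)
    then have "norm (S x - z *\<^sub>C x) < inverse (real (Suc k))"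
      using zy(2) \<open>norm y > 0\<close> by (simp add: pos_divide_less_eq)
    ultimately show ?thesis using zy(1) by blast
  qed
  then obtain z x where zx: "\<And>k. z k \<in> Z" "\<And>k. norm (x k) = 1"
    "\<And>k. norm (S (x k) - z k *\<^sub>C x k) < inverse (real (Suc k))"
    by metis
  obtain l r where r: "strict_mono (r :: nat \<Rightarrow> nat)" "(\<lambda>k. S (x (r k))) \<longlonglongrightarrow> l"
    using nuclear_rep_convergent_subsequence[OF S, of x] zx(2) by (metis order_refl)
  \<comment> \<open>A unit vector that is nearly an eigenvector forces \<open>z k\<close> to be at
    most slightly larger than the norm of \<open>S\<close>, so only a compact part of
    \<open>Z\<close> matters.\<close>
  have zb: "cmod (z k) \<le> onorm S + 1" for k
  proof -
    have "cmod (z k) = norm (z k *\<^sub>C x k)" by (simp add: norm_scaleC zx(2))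
    also have "\<dots> \<le> norm (S (x k)) + norm (S (x k) - z k *\<^sub>C x k)"
      by (metis norm_triangle_sub norm_minus_commute)
    also have "norm (S (x k)) \<le> onorm S" using bounded_clinear_norm_le[OF bS, of "x k"] zx(2) by simp
    also have "norm (S (x k) - z k *\<^sub>C x k) \<le> 1"
      using zx(3)[of k] by (rule order_trans[OF less_imp_le]) (simp add: field_simps)
    finally show ?thesis by simp
  qed
  have "seq_compact (cball (0::complex) (onorm S + 1))"
    using compact_cball by (simp add: compact_eq_seq_compact_metric)
  moreover have "\<forall>k. z (r k) \<in> cball 0 (onorm S + 1)" using zb by simp
  ultimately obtain \<mu> q where q: "strict_mono q" "((\<lambda>k. z (r k)) \<circ> q) \<longlonglongrightarrow> \<mu>"
    unfolding seq_compact_def by metis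
  have z_lim: "(\<lambda>k. z (r (q k))) \<longlonglongrightarrow> \<mu>" using q(2) by (simp add: o_def)
  have mu: "\<mu> \<in> Z" by (rule closed_sequentially[OF Z(1) _ z_lim]) (simp add: zx(1))
  then have mu0: "\<mu> \<noteq> 0" using Z(2) by blast
  have S_lim: "(\<lambda>k. S (x (r (q k)))) \<longlonglongrightarrow> l"
    using LIMSEQ_subseq_LIMSEQ[OF r(2) q(1)] by (simp add: o_def)
  have rq: "strict_mono (\<lambda>k. r (q k))" using r(1) q(1) by (simp add: strict_mono_def)
  have "(\<lambda>k. inverse (real (Suc (r (q k))))) \<longlonglongrightarrow> 0"
    using LIMSEQ_subseq_LIMSEQ[OF LIMSEQ_inverse_real_of_nat rq] by (simp add: o_def)
  then have "(\<lambda>k. S (x (r (q k))) - z (r (q k)) *\<^sub>C x (r (q k))) \<longlonglongrightarrow> 0"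
    by (rule Lim_null_comparison[rotated]) (intro always_eventually allI less_imp_le zx(3))
  then have "(\<lambda>k. S (x (r (q k))) - (S (x (r (q k))) - z (r (q k)) *\<^sub>C x (r (q k)))) \<longlonglongrightarrow> l - 0"
    by (intro tendsto_diff S_lim)
  then have "(\<lambda>k. z (r (q k)) *\<^sub>C x (r (q k))) \<longlonglongrightarrow> l" by simp
  then have "(\<lambda>k. inverse (z (r (q k))) *\<^sub>C (z (r (q k)) *\<^sub>C x (r (q k)))) \<longlonglongrightarrow> inverse \<mu> *\<^sub>C l"
    by (intro tendsto_scaleC tendsto_inverse z_lim mu0)
  moreover have "inverse (z k) *\<^sub>C (z k *\<^sub>C x k) = x k" for k
  proof -
    have "z k \<noteq> 0" using zx(1)[of k] Z(2) by auto
    then show ?thesis by simp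
  qed
  ultimately have x_lim: "(\<lambda>k. x (r (q k))) \<longlonglongrightarrow> inverse \<mu> *\<^sub>C l" by simp
  have "(\<lambda>k. S (x (r (q k)))) \<longlonglongrightarrow> S (inverse \<mu> *\<^sub>C l)"
    by (rule bounded_linear.tendsto[OF bounded_clinear_bounded_linear[OF bS] x_lim])
  then have "S (inverse \<mu> *\<^sub>C l) = l" using S_lim LIMSEQ_unique by blast
  then have "S (inverse \<mu> *\<^sub>C l) = \<mu> *\<^sub>C (inverse \<mu> *\<^sub>C l)" using mu0 by simp
  then have "inverse \<mu> *\<^sub>C l = 0" by (rule no_eig[OF mu])
  then have "(\<lambda>k. norm (x (r (q k)))) \<longlonglongrightarrow> 0"
    using tendsto_norm[OF x_lim] by (simp only: norm_zero)
  then show False by (simp add: zx(2) LIMSEQ_const_iff)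
qed

text \<open>Injectivity gives a lower bound for I - S, which late truncations inherit with half the
  constant. For them surjectivity is finite-dimensional linear algebra, and the solutions of the
  truncated equations converge.\<close>

lemma fredholm_alternative:
  fixes S :: "'a::complex_hilbert \<Rightarrow> 'a"
  assumes S: "nuclear_rep S a b c" and inj: "\<And>x. S x = x \<Longrightarrow> x = 0"
  obtains R where "bounded_clinear R" "\<And>x. R (x - S x) = x" "\<And>x. R x - S (R x) = x"
proof -
  note bS = nuclear_rep_bounded_clinear[OF S]
  note lS = bounded_clinear_clinear[OF bS]
  obtain d where d: "d > 0" "\<And>x. d * norm x \<le> norm (S x - x)"
  proof -
    have "\<exists>d>0. \<forall>z\<in>{1}. \<forall>x. d * norm x \<le> norm (S x - z *\<^sub>C x)"
      using inj by (intro nuclear_rep_bounded_below[OF S]) auto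
    then show ?thesis using that by auto
  qed
  have below: "d * norm x \<le> norm (x - S x)" for x
    using d(2)[of x] by (simp add: norm_minus_commute)
  obtain \<delta> where \<delta>: "\<delta> \<longlonglongrightarrow> 0" "\<And>m. 0 \<le> \<delta> m" "\<And>m x. norm (S x - trunc a b m x) \<le> \<delta> m * norm x"
    using nuclear_rep_trunc_error[OF S] by blast
  have "\<forall>\<^sub>F m in sequentially. \<delta> m < d / 2" using \<delta>(1) d(1) by (intro order_tendstoD(2)) auto
  then obtain M where M: "\<And>m. m \<ge> M \<Longrightarrow> \<delta> m < d / 2" by (auto simp: eventually_sequentially)
  have below_trunc: "d / 2 * norm x \<le> norm (x - trunc a b m x)" if "m \<ge> M" for m x
  proof -
    have "d * norm x \<le> norm (x - trunc a b m x) + norm (trunc a b m x - S x)"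
      using below[of x] norm_triangle_ineq[of "x - trunc a b m x" "trunc a b m x - S x"] by simp
    also have "norm (trunc a b m x - S x) \<le> \<delta> m * norm x" using \<delta>(3) by (simp add: norm_minus_commute)
    also have "\<dots> \<le> d / 2 * norm x" using M[OF that] by (intro mult_right_mono) auto
    finally show ?thesis by simp
  qed
  have surj: "\<exists>x. x - S x = y" for y
  proof -
    have "\<exists>x. x - trunc a b m x = y" if m: "m \<ge> M" for m
    proof -
      \<comment> \<open>\<open>E\<close> contains the range of the truncation. Solving on
        \<open>E\<close> with right-hand side \<open>trunc a b m y\<close> suffices: adding
        \<open>y\<close> to that solution solves the equation for \<open>y\<close> itself.\<close>
      define E where "E = complex_vector.span (b ` {..<m})"
      define L where "L x = x - trunc a b m x" for x
      have lL: "clinear L" unfolding L_def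
        by (rule clinearI) (simp_all add: clinear_add[OF clinear_trunc] clinear_scale[OF clinear_trunc]
            complex_vector.scale_right_diff_distrib)
      have "L ` E = E"
      proof (rule injective_imp_surjective_on[OF lL])
        show "complex_vector.subspace E" "E \<subseteq> complex_vector.span (b ` {..<m})" "finite (b ` {..<m})"
          by (auto simp: E_def)
        show "L ` E \<subseteq> E" unfolding L_def E_def
          by (auto intro: complex_vector.span_diff trunc_in_span)
        show "x = 0" if "L x = 0" for x
          using below_trunc[OF m, of x] that d(1) by (simp add: L_def mult_le_0_iff)
      qed
      moreover have "trunc a b m y \<in> E" unfolding E_def by (rule trunc_in_span)
      ultimately obtain u where "L u = trunc a b m y" by (metis imageE)
      then have "(y + u) - trunc a b m (y + u) = y"
        by (simp add: L_def clinear_add[OF clinear_trunc] diff_eq_eq)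
      then show ?thesis by blast
    qed
    then obtain x where x: "\<And>m. m \<ge> M \<Longrightarrow> x m - trunc a b m (x m) = y" by metis
    have xb: "norm (x m) \<le> 2 / d * norm y" if "m \<ge> M" for m
      using below_trunc[OF that, of "x m"] x[OF that] d(1) by (simp add: field_simps)
    have zlim: "(\<lambda>m. (x m - S (x m)) - y) \<longlonglongrightarrow> 0"
    proof (rule Lim_null_comparison)
      show "(\<lambda>m. \<delta> m * (2 / d * norm y)) \<longlonglongrightarrow> 0"
        using tendsto_mult_right[OF \<delta>(1), of "2 / d * norm y"] by simp
      have "norm ((x m - S (x m)) - y) \<le> \<delta> m * (2 / d * norm y)" if "m \<ge> M" for m
      proof -
        have "(x m - S (x m)) - y = - (S (x m) - trunc a b m (x m))" using x[OF that] by (simp add: algebra_simps)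
        then have "norm ((x m - S (x m)) - y) \<le> \<delta> m * norm (x m)"
          using \<delta>(3) by (metis norm_minus_cancel)
        also have "\<dots> \<le> \<delta> m * (2 / d * norm y)" by (intro mult_left_mono xb that \<delta>(2))
        finally show ?thesis .
      qed
      then show "\<forall>\<^sub>F m in sequentially. norm ((x m - S (x m)) - y) \<le> \<delta> m * (2 / d * norm y)"
        by (auto simp: eventually_sequentially)
    qed
    then have "(\<lambda>m. x m - S (x m)) \<longlonglongrightarrow> y" by (rule LIM_zero_cancel)
    then have Cz: "Cauchy (\<lambda>m. x m - S (x m))" by (rule LIMSEQ_imp_Cauchy)
    \<comment> \<open>The lower bound for I - S turns convergence of \<open>x m - S (x m)\<close>
      into the Cauchy property of \<open>x\<close>.\<close>
    have "Cauchy x"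
    proof (rule CauchyI)
      fix e :: real assume "e > 0"
      then have "d * e > 0" using d(1) by simp
      then obtain N where N: "\<And>m n. m \<ge> N \<Longrightarrow> n \<ge> N \<Longrightarrow> norm ((x m - S (x m)) - (x n - S (x n))) < d * e"
        using CauchyD[OF Cz] by blast
      have "norm (x m - x n) < e" if "m \<ge> N" "n \<ge> N" for m n
      proof -
        have "d * norm (x m - x n) \<le> norm ((x m - x n) - S (x m - x n))" by (rule below)
        also have "\<dots> = norm ((x m - S (x m)) - (x n - S (x n)))"
          by (simp add: clinear_diff[OF lS] algebra_simps)
        also have "\<dots> < d * e" by (rule N[OF that])
        finally show ?thesis using d(1) by simp
      qed
      then show "\<exists>N. \<forall>m\<ge>N. \<forall>n\<ge>N. norm (x m - x n) < e" by blast
    qed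
    then obtain w where w: "x \<longlonglongrightarrow> w" using Cauchy_convergent convergent_def by blast
    have "(\<lambda>m. x m - S (x m)) \<longlonglongrightarrow> w - S w"
      by (intro tendsto_diff w bounded_linear.tendsto[OF bounded_clinear_bounded_linear[OF bS]])
    then have "w - S w = y" using \<open>(\<lambda>m. x m - S (x m)) \<longlonglongrightarrow> y\<close> LIMSEQ_unique by blast
    then show ?thesis by blast
  qed
  then obtain R where R: "\<And>y. R y - S (R y) = y" by metis
  have unique: "x = x'" if "x - S x = x' - S x'" for x x'
  proof -
    have "S (x - x') = x - x'" using that by (simp add: clinear_diff[OF lS] algebra_simps)
    then show ?thesis using inj by fastforce
  qed
  have "bounded_clinear R"
  proof (rule bounded_clinearI)
    show "R (x + y) = R x + R y" for x y
    proof (rule unique)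
      have "R x + R y - S (R x + R y) = (R x - S (R x)) + (R y - S (R y))"
        by (simp add: clinear_add[OF lS])
      then show "R (x + y) - S (R (x + y)) = R x + R y - S (R x + R y)" by (simp only: R)
    qed
    show "R (z *\<^sub>C x) = z *\<^sub>C R x" for z x
    proof (rule unique)
      have "z *\<^sub>C R x - S (z *\<^sub>C R x) = z *\<^sub>C (R x - S (R x))"
        by (simp add: clinear_scale[OF lS] complex_vector.scale_right_diff_distrib)
      then show "R (z *\<^sub>C x) - S (R (z *\<^sub>C x)) = z *\<^sub>C R x - S (z *\<^sub>C R x)" by (simp only: R)
    qed
    show "norm (R x) \<le> (1 / d) * norm x" for x
      using below[of "R x"] d(1) by (simp add: R field_simps)
  qed
  moreover have "R (x - S x) = x" for x by (rule unique) (rule R)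
  ultimately show ?thesis using that R by blast
qed

text \<open>Otherwise S - \<mu> would be injective and so onto the span of the first
  \<open>k + 1\<close> flag vectors; but its diagonal entry at \<open>k\<close> vanishes, so no
  image has a component along \<open>f k\<close>.\<close>

lemma flag_diag_eigenvalue:
  fixes S :: "'a::complex_inner \<Rightarrow> 'a"
  assumes fl: "flag {S} f n" and S: "clinear S" and k: "k < n"
  shows "\<exists>v\<in>complex_vector.span (f ` {..<Suc k}). v \<noteq> 0 \<and> S v = cinner (S (f k)) (f k) *\<^sub>C v"
proof (rule ccontr)
  assume neg: "\<not> ?thesis"
  define E where "E = complex_vector.span (f ` {..<Suc k})"
  define \<mu> where "\<mu> = cinner (S (f k)) (f k)"
  define L where "L x = S x - \<mu> *\<^sub>C x" for x
  have lL: "clinear L" unfolding L_def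
    by (rule clinearI) (simp_all add: clinear_add[OF S] clinear_scale[OF S] scaleC_add_right
        complex_vector.scale_right_diff_distrib mult.commute)
  have SE: "S x \<in> E" if "x \<in> E" for x
    using that k unfolding E_def by (intro flag_invariant_span[OF fl _ S]) auto
  have "L ` E = E"
  proof (rule injective_imp_surjective_on[OF lL])
    show "complex_vector.subspace E" "E \<subseteq> complex_vector.span (f ` {..<Suc k})" "finite (f ` {..<Suc k})"
      by (auto simp: E_def)
    show "L ` E \<subseteq> E" unfolding L_def
      using SE by (auto simp: E_def intro!: complex_vector.span_diff complex_vector.span_scale)
    show "x = 0" if "x \<in> E" "L x = 0" for x
    proof (rule ccontr)
      assume "x \<noteq> 0"
      moreover have "S x = \<mu> *\<^sub>C x" using that(2) by (simp add: L_def)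
      ultimately show False using neg that(1) unfolding E_def \<mu>_def by blast
    qed
  qed
  moreover have "f k \<in> E" unfolding E_def by (intro complex_vector.span_base) auto
  ultimately obtain x where x: "x \<in> E" "L x = f k" by (metis imageE)
  have os: "orthosystem {..<Suc k} f" using k by (intro flag_orthosystem[OF fl]) auto
  have on: "cinner (f i) (f j) = (if i = j then 1 else 0)" if "i < n" "j < n" for i j
    using flag_orthonormal[OF fl] that by (auto simp: orthonormal_def)
  have "x = proj f {..<Suc k} x" using proj_fix[OF os _ x(1)[unfolded E_def]] by simp
  then have xe: "x = (\<Sum>i<Suc k. cinner x (f i) *\<^sub>C f i)" by (simp only: proj_def)
  have Lf: "cinner (L (f i)) (f k) = 0" if "i < Suc k" for i
  proof (cases "i = k")
    case True
    then show ?thesis using on[OF k k] by (simp add: L_def cinner_diff_left cinner_scaleC_left \<mu>_def)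
  next
    case False
    then have i: "i < k" using that by simp
    have "proj f {..i} (S (f i)) = S (f i)" using fl i k by (auto simp: flag_def)
    then have "cinner (S (f i)) (f k) = cinner (proj f {..i} (S (f i))) (f k)" by simp
    also have "\<dots> = (\<Sum>j\<in>{..i}. cinner (S (f i)) (f j) * cinner (f j) (f k))"
      by (simp add: proj_def cinner_sum_left cinner_scaleC_left)
    also have "\<dots> = 0" using i k on by (intro sum.neutral) auto
    finally show ?thesis using on[of i k] i k by (simp add: L_def cinner_diff_left cinner_scaleC_left)
  qed
  have "1 = cinner (f k) (f k)" using on[OF k k] by simp
  also have "\<dots> = cinner (L x) (f k)" by (simp add: x(2))
  also have "\<dots> = cinner (L (\<Sum>i<Suc k. cinner x (f i) *\<^sub>C f i)) (f k)" by (simp only: xe[symmetric])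
  also have "\<dots> = (\<Sum>i<Suc k. cinner x (f i) * cinner (L (f i)) (f k))"
    by (simp only: clinear_sum[OF lL] clinear_scale[OF lL] cinner_sum_left cinner_scaleC_left)
  also have "\<dots> = 0" by (intro sum.neutral) (simp add: Lf)
  finally show False by simp
qed

text \<open>The sum is the trace of the square of the truncation, that is the sum of its squared
  eigenvalues. One factor of each square is at most \<open>r\<close>, and the moduli of the
  remaining factors sum to at most \<open>c\<close>; without the square no factor \<open>r\<close>
  would be gained.\<close>

lemma trunc_trace:
  fixes a b :: "nat \<Rightarrow> 'a::complex_hilbert"
  assumes S: "nuclear_rep S a b c"
    and r: "r > 0"
    and no_eig: "\<And>z x. r \<le> cmod z \<Longrightarrow> trunc a b m x = z *\<^sub>C x \<Longrightarrow> x = 0"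
  shows "cmod (\<Sum>i<m. cinner (trunc a b m (b i)) (a i)) \<le> r * c"
proof -
  define T where "T = trunc a b m"
  have lT: "clinear T" unfolding T_def by (rule clinear_trunc)
  define R where "R = complex_vector.span (b ` {..<m})"
  obtain f n where f: "flag {T} f n" "f ` {..<n} \<subseteq> R" "\<And>x. x \<in> R \<Longrightarrow> proj f {..<n} x = x"
  proof (rule schur_flag[OF lT])
    show "complex_vector.subspace R" "R \<subseteq> complex_vector.span (b ` {..<m})" "finite (b ` {..<m})"
      by (auto simp: R_def)
    show "T ` R \<subseteq> R" unfolding R_def T_def using trunc_in_span by blast
  qed blast
  define ev where "ev k = cinner (T (f k)) (f k)" for k
  have small: "cmod (ev k) \<le> r" if k: "k < n" for k
  proof (rule ccontr)
    assume "\<not> cmod (ev k) \<le> r"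
    moreover obtain v where "v \<noteq> 0" "T v = ev k *\<^sub>C v"
      using flag_diag_eigenvalue[OF f(1) lT k] unfolding ev_def by blast
    ultimately show False using no_eig[of "ev k" v] by (simp add: T_def)
  qed
  have "(\<Sum>i<m. cinner (T (b i)) (a i)) = (\<Sum>i<m. \<Sum>k<n. cinner (b i) (f k) * cinner (T (f k)) (a i))"
  proof (intro sum.cong refl)
    fix i assume "i \<in> {..<m}"
    then have "proj f {..<n} (b i) = b i" unfolding R_def
      by (intro f(3)) (auto simp: R_def intro: complex_vector.span_base)
    then have "cinner (T (b i)) (a i) = cinner (T (\<Sum>k<n. cinner (b i) (f k) *\<^sub>C f k)) (a i)"
      by (simp add: proj_def)
    also have "\<dots> = (\<Sum>k<n. cinner (b i) (f k) * cinner (T (f k)) (a i))"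
      by (simp add: clinear_sum[OF lT] clinear_scale[OF lT] cinner_sum_left cinner_scaleC_left)
    finally show "cinner (T (b i)) (a i) = (\<Sum>k<n. cinner (b i) (f k) * cinner (T (f k)) (a i))" .
  qed
  also have "\<dots> = (\<Sum>k<n. \<Sum>i<m. cinner (b i) (f k) * cinner (T (f k)) (a i))" by (rule sum.swap)
  \<comment> \<open>The sum over \<open>i\<close> is the definition of the truncation, applied to
    \<open>T (f k)\<close> and paired with \<open>f k\<close>.\<close>
  also have "\<dots> = (\<Sum>k<n. cinner (T (T (f k))) (f k))"
    by (intro sum.cong refl)
      (simp add: T_def trunc_def[of a b m "trunc a b m _"] cinner_sum_left cinner_scaleC_left mult.commute)
  also have "\<dots> = (\<Sum>k<n. ev k * ev k)"
    unfolding ev_def using flag_diag_mult[OF f(1) _ lT] by (intro sum.cong refl) auto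
  finally have "cmod (\<Sum>i<m. cinner (T (b i)) (a i)) \<le> (\<Sum>k<n. cmod (ev k * ev k))"
    by (metis norm_sum)
  also have "\<dots> \<le> (\<Sum>k<n. r * cmod (ev k))"
    unfolding norm_mult by (intro sum_mono mult_right_mono small) auto
  also have "\<dots> = r * (\<Sum>k<n. cmod (ev k))" by (simp add: sum_distrib_left)
  also have "\<dots> \<le> r * c"
    unfolding ev_def T_def using flag_orthosystem[OF f(1) order_refl] r
    by (intro mult_left_mono nuclear_rep_diagonal[OF trunc_nuclear_rep[OF S]]) auto
  finally show ?thesis by (simp add: T_def)
qed

text \<open>Here \<open>t\<close> is the trace of the square of \<open>S\<close>. The uniform lower
  bound for S - z over all z of modulus at least \<open>r\<close> survives small perturbations, so
  late truncations have no eigenvalue there either; the bound for truncations passes to the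
  limit.\<close>

lemma nuclear_rep_small_trace:
  fixes S :: "'a::complex_hilbert \<Rightarrow> 'a"
  assumes S: "nuclear_rep S a b c" and r: "r > 0"
    and no_eig: "\<And>z x. r \<le> cmod z \<Longrightarrow> S x = z *\<^sub>C x \<Longrightarrow> x = 0"
    and t: "(\<lambda>i. cinner (S (b i)) (a i)) sums t"
  shows "cmod t \<le> r * c"
proof -
  have cl: "closed {z. r \<le> cmod z}" by (intro closed_Collect_le continuous_intros)
  have "\<exists>d>0. \<forall>z\<in>{z. r \<le> cmod z}. \<forall>x. d * norm x \<le> norm (S x - z *\<^sub>C x)"
    using no_eig r by (intro nuclear_rep_bounded_below[OF S cl]) auto
  then obtain d where d: "d > 0" "\<And>z x. r \<le> cmod z \<Longrightarrow> d * norm x \<le> norm (S x - z *\<^sub>C x)"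
    by auto
  obtain \<delta> where \<delta>: "\<delta> \<longlonglongrightarrow> 0" "\<And>m. 0 \<le> \<delta> m" "\<And>m x. norm (S x - trunc a b m x) \<le> \<delta> m * norm x"
    using nuclear_rep_trunc_error[OF S] by blast
  have "\<forall>\<^sub>F m in sequentially. \<delta> m < d" using \<delta>(1) d(1) by (intro order_tendstoD(2)) auto
  then have ev: "\<forall>\<^sub>F m in sequentially. cmod (\<Sum>i<m. cinner (trunc a b m (b i)) (a i)) \<le> r * c"
  proof eventually_elim
    case (elim m)
    show ?case
    proof (rule trunc_trace[OF S r])
      fix z x assume z: "r \<le> cmod z" and eq: "trunc a b m x = z *\<^sub>C x"
      have "d * norm x \<le> \<delta> m * norm x" using d(2)[OF z, of x] \<delta>(3)[of x m] eq by simp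
      then show "x = 0" using elim by (metis mult_right_mono_neg mult_le_cancel_right norm_le_zero_iff not_le)
    qed
  qed
  have "(\<lambda>m. (\<Sum>i<m. cinner (trunc a b m (b i)) (a i))) \<longlonglongrightarrow> t"
  proof (rule Lim_transform)
    show "(\<lambda>m. \<Sum>i<m. cinner (S (b i)) (a i)) \<longlonglongrightarrow> t" using t by (simp add: sums_def)
    show "(\<lambda>m. (\<Sum>i<m. cinner (trunc a b m (b i)) (a i)) - (\<Sum>i<m. cinner (S (b i)) (a i))) \<longlonglongrightarrow> 0"
    proof (rule Lim_null_comparison)
      show "(\<lambda>m. \<delta> m * c) \<longlonglongrightarrow> 0" using tendsto_mult_right[OF \<delta>(1), of c] by simp
      have "norm ((\<Sum>i<m. cinner (trunc a b m (b i)) (a i)) - (\<Sum>i<m. cinner (S (b i)) (a i))) \<le> \<delta> m * c" for m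
      proof -
        have "norm ((\<Sum>i<m. cinner (trunc a b m (b i)) (a i)) - (\<Sum>i<m. cinner (S (b i)) (a i)))
            = norm (\<Sum>i<m. cinner (trunc a b m (b i) - S (b i)) (a i))"
          by (simp add: cinner_diff_left sum_subtractf)
        also have "\<dots> \<le> (\<Sum>i<m. \<delta> m * (norm (a i) * norm (b i)))"
        proof (rule sum_norm_le)
          fix i
          have "cmod (cinner (trunc a b m (b i) - S (b i)) (a i)) \<le> norm (S (b i) - trunc a b m (b i)) * norm (a i)"
            by (subst norm_minus_commute) (rule cinner_bound)
          also have "\<dots> \<le> (\<delta> m * norm (b i)) * norm (a i)" by (intro mult_right_mono \<delta>(3)) auto
          finally show "cmod (cinner (trunc a b m (b i) - S (b i)) (a i)) \<le> \<delta> m * (norm (a i) * norm (b i))"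
            by (simp add: mult_ac)
        qed
        also have "\<dots> = \<delta> m * (\<Sum>i<m. norm (a i) * norm (b i))" by (simp add: sum_distrib_left)
        also have "\<dots> \<le> \<delta> m * c" by (intro mult_left_mono \<delta>(2) nuclear_rep_bound[OF S])
        finally show ?thesis .
      qed
      then show "\<forall>\<^sub>F m in sequentially. norm ((\<Sum>i<m. cinner (trunc a b m (b i)) (a i)) - (\<Sum>i<m. cinner (S (b i)) (a i))) \<le> \<delta> m * c"
        by simp
    qed
  qed
  then show ?thesis using ev by (intro tendsto_upperbound[OF tendsto_norm]) auto
qed

text \<open>
  This replaces Lidskii's theorem: the trace of a square splits into the diagonal of a triangular
  part and the trace of the square of a compression whose eigenvalues are small.
\<close>

theorem trace_square_bound:
  fixes K :: "'a::complex_hilbert \<Rightarrow> 'a"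
  assumes sep: "separable_type TYPE('a)" and K: "nuclear_rep K a b c" and fl: "flag {K} f n" and r: "r > 0"
    and no_eig: "\<And>z x. r \<le> cmod z \<Longrightarrow> K x - proj f {..<n} (K x) = z *\<^sub>C x \<Longrightarrow> x = 0"
  shows "cmod (op_trace (\<lambda>x. K (K x))) \<le> (\<Sum>k<n. (cmod (cinner (K (f k)) (f k)))\<^sup>2) + r * c"
proof -
  note bK = nuclear_rep_bounded_clinear[OF K]
  note lK = bounded_clinear_clinear[OF bK]
  have os: "orthosystem {..<n} f" by (rule flag_orthosystem[OF fl order_refl])
  define Q where "Q x = x - proj f {..<n} x" for x
  have bQ: "bounded_clinear Q" unfolding Q_def by (rule bounded_clinear_diff_proj[OF os]) simp
  have QK: "nuclear_rep (\<lambda>x. Q (K x)) a (\<lambda>i. Q (b i)) c"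
    using norm_diff_proj_le[OF os] by (intro nuclear_rep_compose[OF K bQ]) (simp add: Q_def)
  have QKQ: "Q (K (Q x)) = Q (K x)" for x
    unfolding Q_def using flag_compress[OF fl _ lK] by simp
  have tr: "(\<lambda>i. cinner (K (b i)) (a i)) sums op_trace (\<lambda>x. K (K x))"
    by (rule nuclear_rep_trace[OF sep K bK])
  have "(\<lambda>i. cinner (f k) (a i) * cinner (K (b i)) (f k)) sums cinner (K (K (f k))) (f k)" for k
  proof -
    have "(\<lambda>i. cinner (K (cinner (f k) (a i) *\<^sub>C b i)) (f k)) sums cinner (K (K (f k))) (f k)"
      by (intro bounded_linear.sums[OF bounded_linear_cinner_left]
          bounded_linear.sums[OF bounded_clinear_bounded_linear[OF bK]] nuclear_rep_sums[OF K])
    then show ?thesis by (simp add: clinear_scale[OF lK] cinner_scaleC_left)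
  qed
  then have tr1: "(\<lambda>i. \<Sum>k<n. cinner (f k) (a i) * cinner (K (b i)) (f k)) sums (\<Sum>k<n. cinner (K (K (f k))) (f k))"
    by (intro sums_sum)
  \<comment> \<open>The subtracted terms are the part of \<open>K (b i)\<close> inside the flag.
    What remains is, by \<open>QKQ\<close>, the trace term of the square of the compression in its
    representation by \<open>a\<close> and the compressed \<open>b\<close>.\<close>
  have split: "cinner (K (b i)) (a i) - (\<Sum>k<n. cinner (f k) (a i) * cinner (K (b i)) (f k)) = cinner (Q (K (Q (b i)))) (a i)" for i
    unfolding QKQ by (simp add: Q_def cinner_diff_left proj_def cinner_sum_left cinner_scaleC_left mult.commute)
  have "(\<lambda>i. cinner (Q (K (Q (b i)))) (a i)) sums (op_trace (\<lambda>x. K (K x)) - (\<Sum>k<n. cinner (K (K (f k))) (f k)))"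
    unfolding split[symmetric] by (intro sums_diff tr tr1)
  then have "cmod (op_trace (\<lambda>x. K (K x)) - (\<Sum>k<n. cinner (K (K (f k))) (f k))) \<le> r * c"
    using no_eig by (intro nuclear_rep_small_trace[OF QK r]) (auto simp: Q_def)
  moreover have "cmod (\<Sum>k<n. cinner (K (K (f k))) (f k)) \<le> (\<Sum>k<n. (cmod (cinner (K (f k)) (f k)))\<^sup>2)"
    using flag_diag_mult[OF fl _ lK] by (intro sum_norm_le) (simp add: norm_mult power2_eq_square)
  ultimately show ?thesis
    using norm_triangle_ineq2[of "op_trace (\<lambda>x. K (K x))" "\<Sum>k<n. cinner (K (K (f k))) (f k)"] by linarith
qed

section \<open>Semigroups and resolvents\<close>

text \<open>Baire: one of the closed sets \<open>F m\<close> contains a ball.\<close>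

theorem uniform_boundedness:
  fixes S :: "nat \<Rightarrow> 'a::{real_normed_vector,complete_space} \<Rightarrow> 'b::real_normed_vector"
  assumes S: "\<And>n. bounded_linear (S n)" and ptw: "\<And>x. \<exists>M. \<forall>n. norm (S n x) \<le> M"
  obtains M where "\<And>n x. norm (S n x) \<le> M * norm x"
proof -
  define F where "F m = {x. \<forall>n. norm (S n x) \<le> real m}" for m :: nat
  have cl: "closed (F m)" for m
  proof -
    have "F m = (\<Inter>n. {x. norm (S n x) \<le> real m})" by (auto simp: F_def)
    moreover have "closed {x. norm (S n x) \<le> real m}" for n
      by (intro closed_Collect_le continuous_on_norm linear_continuous_on S continuous_intros)
    ultimately show ?thesis by auto
  qed
  have "\<exists>m. x \<in> F m" for x
  proof -
    obtain M where "\<forall>n. norm (S n x) \<le> M" using ptw by blast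
    moreover obtain m :: nat where "M \<le> real m" using real_arch_simple by blast
    ultimately have "x \<in> F m" by (auto simp: F_def intro: order_trans)
    then show ?thesis by blast
  qed
  then have un: "\<Union>(range F) = UNIV" by auto
  have "\<exists>m. interior (F m) \<noteq> {}"
  proof (rule ccontr)
    assume "\<not> (\<exists>m. interior (F m) \<noteq> {})"
    then have "euclidean interior_of \<Union>(range F) = {}"
      using cl by (intro Baire_category_alt disjI1 completely_metrizable_space_euclidean) auto
    then show False using un by simp
  qed
  then obtain m x where "x \<in> interior (F m)" by blast
  then obtain r where r: "r > 0" "cball x r \<subseteq> F m"
    by (meson mem_interior_cball)
  have "norm (S n y) \<le> (2 * real m / r) * norm y" for n y
  proof (cases "y = 0")
    case True
    then show ?thesis using S[of n] by (simp add: linear_simps)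
  next
    case False
    \<comment> \<open>Rescale \<open>y\<close> to the radius of the ball; \<open>u\<close> is a
      difference of two points of \<open>F m\<close>, whence the factor 2.\<close>
    define u where "u = (r / norm y) *\<^sub>R y"
    have "norm u = r" using False r(1) by (simp add: u_def)
    then have "x + u \<in> F m" "x \<in> F m" using r by (auto simp: dist_norm)
    then have "norm (S n (x + u)) \<le> m" "norm (S n x) \<le> m" by (auto simp: F_def)
    then have "norm (S n u) \<le> 2 * m"
      using norm_triangle_ineq4[of "S n (x + u)" "S n x"] S[of n] by (simp add: linear_simps)
    moreover have "norm (S n u) = (r / norm y) * norm (S n y)"
      using r(1) by (simp add: u_def linear_simps S)
    ultimately show ?thesis using False r(1) by (simp add: field_simps)
  qed
  then show ?thesis using that by blast
qed

lemma integral_average_tendsto: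
  fixes f :: "real \<Rightarrow> 'a::banach"
  assumes f: "continuous_on {a..b} f" and ab: "a < b"
  shows "((\<lambda>h. integral {a..a + h} f /\<^sub>R h) \<longlongrightarrow> f a) (at_right 0)"
  unfolding tendsto_iff
proof (intro allI impI)
  fix e :: real assume e: "e > 0"
  then have "e / 2 > 0" by simp
  moreover have "a \<in> {a..b}" using ab by simp
  ultimately obtain d where d: "d > 0" "\<And>s. s \<in> {a..b} \<Longrightarrow> dist s a < d \<Longrightarrow> dist (f s) (f a) < e / 2"
    using f unfolding continuous_on_iff by metis
  have "dist (integral {a..a + h} f /\<^sub>R h) (f a) < e" if h: "0 < h" "h < min d (b - a)" for h
  proof -
    have cont: "continuous_on {a..a + h} f" by (rule continuous_on_subset[OF f]) (use h in auto)
    have "norm (integral {a..a + h} (\<lambda>s. f s - f a)) \<le> e / 2 * ((a + h) - a)"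
    proof (rule integral_bound)
      show "norm (f s - f a) \<le> e / 2" if "s \<in> {a..a + h}" for s
        using d(2)[of s] that h by (auto simp: dist_norm intro: less_imp_le)
    qed (use h in \<open>auto intro!: continuous_intros cont\<close>)
    also have "integral {a..a + h} (\<lambda>s. f s - f a) = integral {a..a + h} f - h *\<^sub>R f a"
      using h by (subst integral_diff) (auto intro!: integrable_continuous_real cont)
    finally have "norm (integral {a..a + h} f - h *\<^sub>R f a) / h \<le> e / 2"
      using h by (simp add: field_simps)
    also have "norm (integral {a..a + h} f - h *\<^sub>R f a) / h = norm ((integral {a..a + h} f - h *\<^sub>R f a) /\<^sub>R h)"
      using h by (simp add: divide_inverse mult.commute)
    also have "(integral {a..a + h} f - h *\<^sub>R f a) /\<^sub>R h = integral {a..a + h} f /\<^sub>R h - f a"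
      using h by (simp add: scaleR_diff_right)
    finally show ?thesis using e by (simp add: dist_norm)
  qed
  moreover have "min d (b - a) > 0" using d(1) ab by simp
  ultimately show "\<forall>\<^sub>F h in at_right 0. dist (integral {a..a + h} f /\<^sub>R h) (f a) < e"
    unfolding eventually_at_right_field by blast
qed

section \<open>Strongly continuous semigroups and their resolvents over a unit time interval\<close>

locale generated_semigroup =
  fixes D :: "'a::complex_hilbert set" and A :: "'a \<Rightarrow> 'a" and T :: "real \<Rightarrow> 'a \<Rightarrow> 'a"
  assumes linear: "linear_operator D A" and semigroup: "exp_semigroup D A T"
begin

lemma T_bounded: "t \<ge> 0 \<Longrightarrow> bounded_clinear (T t)"
  and T_0: "T 0 x = x"
  and T_add: "s \<ge> 0 \<Longrightarrow> t \<ge> 0 \<Longrightarrow> T (s + t) x = T s (T t x)"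
  and T_tendsto: "((\<lambda>t. T t x) \<longlongrightarrow> x) (at_right 0)"
  using semigroup by (auto simp: exp_semigroup_def c0_semigroup_def)

lemma T_clinear: "t \<ge> 0 \<Longrightarrow> clinear (T t)"
  by (intro bounded_clinear_clinear T_bounded)

lemma T_commute: "s \<ge> 0 \<Longrightarrow> t \<ge> 0 \<Longrightarrow> T s (T t x) = T t (T s x)"
  by (metis T_add add.commute)

lemma generator_iff:
  "((\<lambda>h. (T h x - x) /\<^sub>R h) \<longlongrightarrow> y) (at_right 0) \<longleftrightarrow> x \<in> D \<and> y = - A x"
  using semigroup by (auto simp: exp_semigroup_def is_generator_def)

text \<open>Were there no bound, times tending to 0 with growing operator norms could be chosen;
  strong continuity bounds each orbit along them, against uniform boundedness.\<close>

lemma T_bounded_near_0: "\<exists>\<delta>>0. \<exists>M\<ge>1. \<forall>s x. 0 \<le> s \<longrightarrow> s \<le> \<delta> \<longrightarrow> norm (T s x) \<le> M * norm x"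
proof (rule ccontr)
  assume neg: "\<not> ?thesis"
  have "\<exists>s x. 0 \<le> s \<and> s \<le> inverse (real (Suc k)) \<and> norm (T s x) > real (Suc k) * norm x" for k
  proof -
    have "inverse (real (Suc k)) > 0" "real (Suc k) \<ge> 1" by auto
    then show ?thesis using neg by (meson not_le)
  qed
  then obtain s x where sx: "\<And>k. 0 \<le> s k" "\<And>k. s k \<le> inverse (real (Suc k))"
    "\<And>k. norm (T (s k) (x k)) > real (Suc k) * norm (x k)" by metis
  \<comment> \<open>Strong continuity is given along \<open>at_right 0\<close>, so the time 0 must
    be excluded; there the operator is the identity.\<close>
  have pos: "s k > 0" for k
  proof (rule ccontr)
    assume "\<not> s k > 0"
    then have "s k = 0" using sx(1)[of k] by simp
    then have "real (Suc k) * norm (x k) < 1 * norm (x k)" using sx(3)[of k] by (simp add: T_0)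
    moreover have "1 * norm (x k) \<le> real (Suc k) * norm (x k)" by (intro mult_right_mono) auto
    ultimately show False by linarith
  qed
  have s_lim: "s \<longlonglongrightarrow> 0"
    by (rule tendsto_sandwich[OF _ _ tendsto_const LIMSEQ_inverse_real_of_nat])
      (auto intro!: always_eventually sx(1,2)[simplified])
  then have s_lim: "filterlim s (at_right 0) sequentially"
  proof -
    have "s n \<in> {0<..} \<and> s n \<noteq> 0" for n using pos[of n] by simp
    then show ?thesis using s_lim by (simp add: filterlim_at)
  qed
  have "\<exists>M. \<forall>n. norm (T (s n) y) \<le> M" for y
  proof -
    have "(\<lambda>n. T (s n) y) \<longlonglongrightarrow> y"
      by (rule filterlim_compose[OF T_tendsto s_lim])
    then have "Bseq (\<lambda>n. T (s n) y)" by (intro convergent_imp_Bseq convergentI)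
    then show ?thesis by (auto simp: Bseq_def)
  qed
  then obtain M where M: "\<And>n x. norm (T (s n) x) \<le> M * norm x"
    using uniform_boundedness[of "\<lambda>n. T (s n)"] T_bounded[OF sx(1)] bounded_clinear_bounded_linear by metis
  obtain k :: nat where "M \<le> real k" using real_arch_simple by blast
  then have "M * norm (x k) \<le> real (Suc k) * norm (x k)" by (intro mult_right_mono) auto
  then show False using M[of k "x k"] sx(3)[of k] by linarith
qed

lemma T_bounded_on: "\<exists>M\<ge>1. \<forall>s x. 0 \<le> s \<longrightarrow> s \<le> t \<longrightarrow> norm (T s x) \<le> M * norm x"
proof -
  obtain \<delta> M where M: "\<delta> > 0" "M \<ge> 1" "\<And>s x. 0 \<le> s \<Longrightarrow> s \<le> \<delta> \<Longrightarrow> norm (T s x) \<le> M * norm x"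
    using T_bounded_near_0 by metis
  have "norm (T s x) \<le> M ^ Suc n * norm x" if "0 \<le> s" "s \<le> real (Suc n) * \<delta>" for n s x
    using that
  proof (induction n arbitrary: s x)
    case 0
    then show ?case using M(3) by simp
  next
    case (Suc n)
    show ?case
    proof (cases "s \<le> real (Suc n) * \<delta>")
      case True
      have "norm (T s x) \<le> M ^ Suc n * norm x" by (rule Suc.IH[OF Suc.prems(1) True])
      also have "\<dots> \<le> M ^ Suc (Suc n) * norm x"
        using M(2) by (intro mult_right_mono power_increasing) auto
      finally show ?thesis .
    next
      case False
      define p where "p = real n * \<delta>"
      have p: "p \<ge> 0" "real (Suc n) * \<delta> = p + \<delta>" "real (Suc (Suc n)) * \<delta> = p + \<delta> + \<delta>"
        using M(1) by (simp_all add: p_def algebra_simps)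
      have s: "s - \<delta> \<le> real (Suc n) * \<delta>" "s - \<delta> \<ge> 0"
        using Suc.prems(2) False p(1) unfolding p(2,3) by linarith+
      have "T s x = T \<delta> (T (s - \<delta>) x)" using T_add[of \<delta> "s - \<delta>" x] M(1) s(2) by simp
      also have "norm \<dots> \<le> M * norm (T (s - \<delta>) x)" using M by simp
      also have "\<dots> \<le> M * (M ^ Suc n * norm x)" using M(2) by (intro mult_left_mono Suc.IH s) auto
      finally show ?thesis by (simp add: mult_ac)
    qed
  qed
  moreover obtain n :: nat where "t / \<delta> \<le> real n" using real_arch_simple by blast
  then have "t / \<delta> \<le> real (Suc n)" by simp
  then have "t \<le> real (Suc n) * \<delta>" using M(1) by (simp only: pos_divide_le_eq)
  ultimately have "\<forall>s x. 0 \<le> s \<longrightarrow> s \<le> t \<longrightarrow> norm (T s x) \<le> M ^ Suc n * norm x"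
    by (meson order_trans)
  then show ?thesis using one_le_power[OF M(2), of "Suc n"] by blast
qed

lemma T_continuous: "continuous_on {0..b} (\<lambda>s. T s x)"
  unfolding continuous_on_iff
proof (intro ballI allI impI)
  fix s e :: real assume s: "s \<in> {0..b}" and e: "e > 0"
  obtain M where M: "M \<ge> 1" "\<And>s x. 0 \<le> s \<Longrightarrow> s \<le> b \<Longrightarrow> norm (T s x) \<le> M * norm x"
    using T_bounded_on by metis
  have "\<forall>\<^sub>F h in at_right 0. dist (T h x) x < e / M"
    using T_tendsto[of x] e M(1) unfolding tendsto_iff by simp
  then obtain d where d: "d > 0" "\<And>h. 0 < h \<Longrightarrow> h < d \<Longrightarrow> dist (T h x) x < e / M"
    unfolding eventually_at_right_field by auto
  \<comment> \<open>Factoring out the earlier time \<open>u\<close> handles left and right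
    continuity together, at the price of a bound for \<open>T u\<close> on the whole
    interval.\<close>
  have key: "dist (T v x) (T u x) < e" if "0 \<le> u" "u \<le> v" "v \<le> b" "v - u < d" for u v
  proof (cases "u = v")
    case True
    then show ?thesis using e by simp
  next
    case False
    then have "dist (T (v - u) x) x < e / M" using that by (intro d(2)) auto
    moreover have "T v x - T u x = T u (T (v - u) x - x)"
      using that T_add[of u "v - u" x] by (simp add: clinear_diff[OF T_clinear])
    then have "norm (T v x - T u x) \<le> M * norm (T (v - u) x - x)"
      using that M(2)[of u] by simp
    ultimately show ?thesis using M(1) by (simp add: dist_norm field_simps)
  qed
  show "\<exists>d>0. \<forall>x'\<in>{0..b}. dist x' s < d \<longrightarrow> dist (T x' x) (T s x) < e"
  proof (intro exI[of _ d] conjI ballI impI d(1))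
    fix u assume u: "u \<in> {0..b}" "dist u s < d"
    show "dist (T u x) (T s x) < e"
      using key[of s u] key[of u s] u s by (cases "s \<le> u") (auto simp: dist_real_def dist_commute)
  qed
qed

definition integrand :: "complex \<Rightarrow> 'a \<Rightarrow> real \<Rightarrow> 'a" where
  "integrand z x s = exp (of_real s * z) *\<^sub>C T s x"

text \<open>The integrand is the semigroup generated by -(A - z), so \<open>J z\<close> inverts A -
  z up to the factor I - exp z * T 1. Unlike the Laplace integral over the half-line it exists for
  every complex \<open>z\<close>.\<close>

definition J :: "complex \<Rightarrow> 'a \<Rightarrow> 'a" where
  "J z x = integral {0..1} (integrand z x)"

lemma integrand_continuous: "continuous_on {0..b} (integrand z x)"
  unfolding integrand_def[abs_def] by (intro continuous_intros T_continuous)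

lemma integrand_integrable: "0 \<le> a \<Longrightarrow> integrand z x integrable_on {a..b}"
  by (rule integrable_continuous_real) (rule continuous_on_subset[OF integrand_continuous[of b]], auto)

lemma J_bounded_linear_commute:
  assumes "bounded_linear \<phi>" 
  shows "\<phi> (J z x) = integral {0..1} (\<lambda>s. \<phi> (integrand z x s))"
  unfolding J_def using integral_linear[OF integrand_integrable[of 0 z x 1] assms] by (simp add: o_def)

lemma J_commute:
  assumes S: "bounded_clinear S" "\<And>s y. 0 \<le> s \<Longrightarrow> S (T s y) = T s (S y)"
  shows "S (J z x) = J z (S x)"
proof -
  have "S (J z x) = integral {0..1} (\<lambda>s. S (integrand z x s))"
    by (rule J_bounded_linear_commute[OF bounded_clinear_bounded_linear[OF S(1)]])
  also have "\<dots> = J z (S x)"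
    unfolding J_def
    by (rule integral_cong)
      (simp add: integrand_def clinear_scale[OF bounded_clinear_clinear[OF S(1)]] S(2))
  finally show ?thesis .
qed

lemma J_bound: "\<exists>M>0. \<forall>z x. norm (J z x) \<le> M * exp (cmod z) * norm x"
proof -
  obtain M where M: "M \<ge> 1" "\<And>s x. 0 \<le> s \<Longrightarrow> s \<le> 1 \<Longrightarrow> norm (T s x) \<le> M * norm x"
    using T_bounded_on[of 1] by metis
  have "norm (J z x) \<le> M * exp (cmod z) * norm x" for z x
  proof -
    have "norm (J z x) \<le> (exp (cmod z) * (M * norm x)) * (1 - 0)"
      unfolding J_def
    proof (rule integral_bound[OF _ integrand_continuous])
      fix s :: real assume s: "s \<in> {0..1}"
      have "Re (of_real s * z) \<le> cmod (of_real s * z)" by (rule complex_Re_le_cmod)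
      also have "\<dots> \<le> 1 * cmod z" using s unfolding norm_mult by (intro mult_right_mono) auto
      finally have "cmod (exp (of_real s * z)) \<le> exp (cmod z)" by simp
      then show "norm (integrand z x s) \<le> exp (cmod z) * (M * norm x)"
        unfolding integrand_def norm_scaleC using M s by (intro mult_mono) auto
    qed simp
    then show ?thesis by (simp add: mult_ac)
  qed
  then show ?thesis using M(1) by (intro exI[of _ M]) auto
qed

lemma bounded_clinear_J: "bounded_clinear (J z)"
proof -
  obtain M where "\<And>z x. norm (J z x) \<le> M * exp (cmod z) * norm x" using J_bound by metis
  then show ?thesis
  proof (rule bounded_clinearI[rotated 2])
    show "J z (x + y) = J z x + J z y" for x y
    proof -
      have "integral {0..1} (integrand z (x + y)) = integral {0..1} (\<lambda>s. integrand z x s + integrand z y s)"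
        by (rule integral_cong) (simp add: integrand_def clinear_add[OF T_clinear] scaleC_add_right)
      then show ?thesis by (simp add: J_def integral_add integrand_integrable)
    qed
    show "J z (c *\<^sub>C x) = c *\<^sub>C J z x" for c x
      by (rule J_commute[of "(*\<^sub>C) c", symmetric])
        (simp_all add: bounded_clinear_scaleC[OF bounded_clinear_ident] clinear_scale[OF T_clinear])
  qed
qed

text \<open>Differentiate \<open>T h (J z x)\<close> at \<open>h = 0\<close>: translating the
  integral leaves an exponential factor and two boundary terms, and the generator is read off from
  the limit of the difference quotient.\<close>

lemma J_domain: "J z x \<in> D" and J_resolvent: "A (J z x) - z *\<^sub>C J z x = x - exp z *\<^sub>C T 1 x"
proof -
  define f where "f = integrand z x"
  have f_int: "f integrable_on {a..b}" if "0 \<le> a" for a b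
    unfolding f_def by (rule integrand_integrable[OF that])
  \<comment> \<open>Applying \<open>T h\<close> moves the interval of integration by
    \<open>h\<close>; the three integrals are the old interval, the piece gained on the right and
    the piece lost on the left.\<close>
  have ThJ: "T h (J z x) = exp (- of_real h * z) *\<^sub>C (integral {0..1} f + integral {1..1 + h} f - integral {0..0 + h} f)"
    if h: "0 \<le> h" "h \<le> 1" for h
  proof -
    have "T h (J z x) = integral {0..1} (\<lambda>s. T h (integrand z x s))"
      by (rule J_bounded_linear_commute[OF bounded_clinear_bounded_linear[OF T_bounded[OF h(1)]]])
    also have "\<dots> = integral {0..1} (\<lambda>s. exp (- of_real h * z) *\<^sub>C (f \<circ> (+) h) s)"
    proof (rule integral_cong)
      fix s :: real assume "s \<in> {0..1}"
      then have "T h (T s x) = T (h + s) x" using T_add h by simp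
      moreover have "exp (of_real s * z) = exp (- of_real h * z) * exp (of_real (h + s) * z)"
        by (simp add: exp_add[symmetric] algebra_simps)
      ultimately show "T h (integrand z x s) = exp (- of_real h * z) *\<^sub>C (f \<circ> (+) h) s"
        by (simp add: f_def integrand_def clinear_scale[OF T_clinear[OF h(1)]])
    qed
    also have "\<dots> = exp (- of_real h * z) *\<^sub>C integral {0..1} (f \<circ> (+) h)"
    proof -
      have "(f \<circ> (+) h) integrable_on {0..1}"
        using f_int[of "0 + h" "1 + h"] has_integral_shift_Icc_real[of f h _ 0 1] h(1)
        by (auto simp: integrable_on_def)
      then show ?thesis
        using integral_linear[OF _ bounded_linear_scaleC_right[of "exp (- of_real h * z)"]]
        by (simp add: o_def)
    qed
    also have "integral {0..1} (f \<circ> (+) h) = integral {0 + h..1 + h} f"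
      by (rule integral_shift_Icc_real)
    also have "\<dots> = integral {0..1} f + integral {1..1 + h} f - integral {0..0 + h} f"
      using Henstock_Kurzweil_Integration.integral_combine[where a = 0 and c = h and b = "1 + h" and f = f]
        Henstock_Kurzweil_Integration.integral_combine[where a = 0 and c = 1 and b = "1 + h" and f = f] h f_int
      by (simp add: algebra_simps)
    finally show ?thesis .
  qed
  have avg: "((\<lambda>h. integral {a..a + h} f /\<^sub>R h) \<longlongrightarrow> f a) (at_right 0)" if "0 \<le> a" for a
    by (rule integral_average_tendsto[of a "a + 1"])
      (use that in \<open>auto simp: f_def intro: continuous_on_subset[OF integrand_continuous[of "a + 1"]]\<close>)
  have e_lim: "((\<lambda>h. exp (- complex_of_real h * z)) \<longlongrightarrow> 1) (at_right 0)"
    by (rule tendsto_eq_intros | simp)+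
  have e_der: "((\<lambda>h. (exp (- complex_of_real h * z) - 1) /\<^sub>R h) \<longlongrightarrow> - z) (at_right 0)"
  proof -
    have "((\<lambda>w. exp (- w * z)) has_field_derivative - z) (at 0)"
      by (auto intro!: derivative_eq_intros)
    then have "((\<lambda>w. (exp (- w * z) - exp (- 0 * z)) / (w - 0)) \<longlongrightarrow> - z) (at 0)"
      unfolding has_field_derivative_iff .
    moreover have "filterlim complex_of_real (at 0) (at_right 0)"
      unfolding filterlim_at by (auto intro!: tendsto_eq_intros simp: eventually_at_right_field intro: exI[of _ 1])
    ultimately have "((\<lambda>h. (exp (- complex_of_real h * z) - exp (- 0 * z)) / (complex_of_real h - 0)) \<longlongrightarrow> - z) (at_right 0)"
      by (rule filterlim_compose)
    then show ?thesis by (simp add: scaleR_conv_of_real divide_inverse mult.commute)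
  qed
  have "((\<lambda>h. ((exp (- complex_of_real h * z) - 1) /\<^sub>R h) *\<^sub>C integral {0..1} f
      + exp (- complex_of_real h * z) *\<^sub>C (integral {1..1 + h} f /\<^sub>R h - integral {0..0 + h} f /\<^sub>R h))
      \<longlongrightarrow> (- z) *\<^sub>C integral {0..1} f + 1 *\<^sub>C (f 1 - f 0)) (at_right 0)"
    by (intro tendsto_intros e_der e_lim avg) auto
  then have "((\<lambda>h. (T h (J z x) - J z x) /\<^sub>R h) \<longlongrightarrow> (- z) *\<^sub>C integral {0..1} f + 1 *\<^sub>C (f 1 - f 0)) (at_right 0)"
  proof (rule Lim_transform_eventually)
    show "\<forall>\<^sub>F h in at_right 0. ((exp (- complex_of_real h * z) - 1) /\<^sub>R h) *\<^sub>C integral {0..1} f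
      + exp (- complex_of_real h * z) *\<^sub>C (integral {1..1 + h} f /\<^sub>R h - integral {0..0 + h} f /\<^sub>R h)
      = (T h (J z x) - J z x) /\<^sub>R h"
      unfolding eventually_at_right_field
    proof (intro exI[of _ 1] conjI allI impI)
      fix h :: real assume h: "0 < h" "h < 1"
      have sc: "(r *\<^sub>R c) *\<^sub>C y = r *\<^sub>R (c *\<^sub>C y)" "c *\<^sub>C (r *\<^sub>R y) = r *\<^sub>R (c *\<^sub>C y)" for r c and y :: 'a
        using bounded_bilinear.scaleR_left[OF bounded_bilinear_scaleC, of r c y]
          bounded_bilinear.scaleR_right[OF bounded_bilinear_scaleC, of c r y] by auto
      have alg: "(e *\<^sub>C (a + b - c) - a) /\<^sub>R h = ((e - 1) /\<^sub>R h) *\<^sub>C a + e *\<^sub>C (b /\<^sub>R h - c /\<^sub>R h)"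
        for e and a b c :: 'a
        by (simp add: sc scaleR_diff_right scaleR_add_right scaleC_add_right
            complex_vector.scale_right_diff_distrib complex_vector.scale_left_diff_distrib)
      have "(T h (J z x) - J z x) /\<^sub>R h = (exp (- of_real h * z) *\<^sub>C (integral {0..1} f + integral {1..1 + h} f - integral {0..0 + h} f)
          - integral {0..1} f) /\<^sub>R h"
        using ThJ[of h] h by (simp add: J_def f_def)
      also have "\<dots> = ((exp (- complex_of_real h * z) - 1) /\<^sub>R h) *\<^sub>C integral {0..1} f
      + exp (- complex_of_real h * z) *\<^sub>C (integral {1..1 + h} f /\<^sub>R h - integral {0..0 + h} f /\<^sub>R h)"
        by (rule alg)
      finally show "((exp (- complex_of_real h * z) - 1) /\<^sub>R h) *\<^sub>C integral {0..1} f
      + exp (- complex_of_real h * z) *\<^sub>C (integral {1..1 + h} f /\<^sub>R h - integral {0..0 + h} f /\<^sub>R h)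
      = (T h (J z x) - J z x) /\<^sub>R h" ..
    qed simp
  qed
  then have "J z x \<in> D \<and> (- z) *\<^sub>C integral {0..1} f + 1 *\<^sub>C (f 1 - f 0) = - A (J z x)"
    unfolding generator_iff .
  then show "J z x \<in> D" "A (J z x) - z *\<^sub>C J z x = x - exp z *\<^sub>C T 1 x"
    by (auto simp: J_def f_def integrand_def T_0 algebra_simps)
qed

text \<open>\<open>J z\<close> is bounded and commutes with the semigroup, so it commutes with the
  difference quotients that define the generator.\<close>

lemma J_resolvent':
  assumes x: "x \<in> D"
  shows "J z (A x - z *\<^sub>C x) = x - exp z *\<^sub>C T 1 x"
proof -
  note lJ = bounded_clinear_clinear[OF bounded_clinear_J[of z]]
  have "((\<lambda>h. (T h x - x) /\<^sub>R h) \<longlongrightarrow> - A x) (at_right 0)" using x generator_iff by blast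
  then have "((\<lambda>h. J z ((T h x - x) /\<^sub>R h)) \<longlongrightarrow> J z (- A x)) (at_right 0)"
    by (rule bounded_linear.tendsto[OF bounded_clinear_bounded_linear[OF bounded_clinear_J]])
  then have "((\<lambda>h. (T h (J z x) - J z x) /\<^sub>R h) \<longlongrightarrow> J z (- A x)) (at_right 0)"
  proof (rule Lim_transform_eventually)
    show "\<forall>\<^sub>F h in at_right 0. J z ((T h x - x) /\<^sub>R h) = (T h (J z x) - J z x) /\<^sub>R h"
      unfolding eventually_at_right_field
    proof (intro exI[of _ 1] conjI allI impI)
      fix h :: real assume "0 < h" "h < 1"
      then have "T h (J z x) = J z (T h x)"
        by (intro J_commute T_bounded) (auto intro: T_commute)
      then show "J z ((T h x - x) /\<^sub>R h) = (T h (J z x) - J z x) /\<^sub>R h"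
        by (simp add: scaleR_scaleC clinear_scale[OF lJ] clinear_diff[OF lJ])
    qed simp
  qed
  then have "J z (- A x) = - A (J z x)" unfolding generator_iff by blast
  then have "J z (A x) = A (J z x)" by (simp add: clinear_minus[OF lJ])
  then show ?thesis using J_resolvent[of z x] by (simp add: clinear_diff[OF lJ] clinear_scale[OF lJ])
qed

lemma D_subspace: "complex_vector.subspace D"
  and A_add: "x \<in> D \<Longrightarrow> y \<in> D \<Longrightarrow> A (x + y) = A x + A y"
  and A_scale: "x \<in> D \<Longrightarrow> A (c *\<^sub>C x) = c *\<^sub>C A x"
  using linear by (auto simp: linear_operator_def)

lemma A_diff: "x \<in> D \<Longrightarrow> y \<in> D \<Longrightarrow> A (x - y) = A x - A y"
  using A_add[of x "- y"] A_scale[of y "-1"] complex_vector.subspace_neg[OF D_subspace, of y] by simp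

text \<open>Here \<open>R\<close> inverts I - exp z * T 1. The identities for \<open>J z\<close> on
  both sides of A - z then give injectivity, surjectivity and the formula for the resolvent.\<close>

lemma resolvent_setI:
  assumes R: "bounded_clinear R" "\<And>x. R (x - exp z *\<^sub>C T 1 x) = x" "\<And>x. R x - exp z *\<^sub>C T 1 (R x) = x"
  shows "z \<in> resolvent_set D A" "resolvent D A z = (\<lambda>x. J z (R x))"
proof -
  define B where "B x = A x - z *\<^sub>C x" for x
  have inj: "inj_on B D"
  proof (rule inj_onI)
    fix x y assume xy: "x \<in> D" "y \<in> D" "B x = B y"
    define d where "d = x - y"
    have d: "d \<in> D" unfolding d_def by (rule complex_vector.subspace_diff[OF D_subspace xy(1,2)])
    have "A d - z *\<^sub>C d = 0"
      using xy by (simp add: d_def B_def A_diff complex_vector.scale_right_diff_distrib algebra_simps)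
    then have "d - exp z *\<^sub>C T 1 d = 0"
      using J_resolvent'[OF d, of z] clinear_zero[OF bounded_clinear_clinear[OF bounded_clinear_J]] by metis
    then have "d = 0" using R(2)[of d] clinear_zero[OF bounded_clinear_clinear[OF R(1)]] by metis
    then show "x = y" by (simp add: d_def)
  qed
  have right: "B (J z (R x)) = x" for x
    by (simp add: B_def J_resolvent R(3))
  have "B ` D = UNIV" using right J_domain by (metis UNIV_eq_I image_eqI)
  then have bij: "bij_betw B D UNIV" using inj by (simp add: bij_betw_def)
  have res: "resolvent D A z x = J z (R x)" for x
    unfolding resolvent_def using inv_into_f_eq[OF inj J_domain right] by (simp add: B_def[abs_def])
  then show "resolvent D A z = (\<lambda>x. J z (R x))" by auto
  then show "z \<in> resolvent_set D A"
    using bij bounded_clinear_compose[OF bounded_clinear_J R(1)] by (simp add: resolvent_set_def B_def[abs_def])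
qed

section \<open>Resolvent identity and holomorphy of the resolvent\<close>

abbreviation "\<rho> \<equiv> resolvent_set D A"
abbreviation "Res \<equiv> resolvent D A"

lemma Res_bounded: "z \<in> \<rho> \<Longrightarrow> bounded_clinear (Res z)"
  by (simp add: resolvent_set_def)

lemma Res_domain: "z \<in> \<rho> \<Longrightarrow> Res z x \<in> D"
  unfolding resolvent_set_def resolvent_def by (auto simp: bij_betw_def intro!: inv_into_into)

lemma Res_right: "z \<in> \<rho> \<Longrightarrow> A (Res z x) - z *\<^sub>C Res z x = x"
  unfolding resolvent_set_def resolvent_def
  using f_inv_into_f[of x "\<lambda>x. A x - z *\<^sub>C x" D] by (auto simp: bij_betw_def)

lemma Res_left: "z \<in> \<rho> \<Longrightarrow> x \<in> D \<Longrightarrow> Res z (A x - z *\<^sub>C x) = x"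
  unfolding resolvent_set_def resolvent_def
  using inv_into_f_f[of "\<lambda>x. A x - z *\<^sub>C x" D x] by (auto simp: bij_betw_def)

lemma resolvent_identity:
  assumes z: "z \<in> \<rho>" and w: "w \<in> \<rho>"
  shows "Res z x - Res w x = (z - w) *\<^sub>C Res z (Res w x)"
proof -
  note l = bounded_clinear_clinear[OF Res_bounded[OF z]]
  have "x = (A (Res w x) - z *\<^sub>C Res w x) + (z - w) *\<^sub>C Res w x"
    using Res_right[OF w, of x] by (simp add: complex_vector.scale_left_diff_distrib algebra_simps)
  then have "Res z x = Res z (A (Res w x) - z *\<^sub>C Res w x) + (z - w) *\<^sub>C Res z (Res w x)"
    by (metis clinear_add[OF l] clinear_scale[OF l])
  then show ?thesis by (simp add: Res_left[OF z Res_domain[OF w]])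
qed

text \<open>In the resolvent identity the term that contains \<open>Res w x\<close> again has factor
  at most one half and is absorbed.\<close>

lemma Res_locally_bounded:
  assumes z: "z \<in> \<rho>" and w: "w \<in> \<rho>" "cmod (w - z) * onorm (Res z) \<le> 1 / 2"
  shows "norm (Res w x) \<le> 2 * onorm (Res z) * norm x"
proof -
  note bz = Res_bounded[OF z] and bw = Res_bounded[OF w(1)]
  have "Res z x - Res w x = (z - w) *\<^sub>C Res z (Res w x)" by (rule resolvent_identity[OF z w(1)])
  then have "Res w x = Res z x + (w - z) *\<^sub>C Res z (Res w x)"
    by (simp add: complex_vector.scale_left_diff_distrib algebra_simps)
  then have "norm (Res w x) \<le> norm (Res z x) + cmod (w - z) * norm (Res z (Res w x))"
    by (metis norm_triangle_ineq norm_scaleC)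
  also have "norm (Res z x) \<le> onorm (Res z) * norm x" by (rule bounded_clinear_norm_le[OF bz])
  also have "cmod (w - z) * norm (Res z (Res w x)) \<le> cmod (w - z) * (onorm (Res z) * norm (Res w x))"
    by (intro mult_left_mono bounded_clinear_norm_le[OF bz]) auto
  also have "\<dots> \<le> 1 / 2 * norm (Res w x)"
    unfolding mult.assoc[symmetric] by (intro mult_right_mono w(2)) auto
  finally show ?thesis by simp
qed

lemma Res_tendsto:
  assumes U: "open U" "U \<subseteq> \<rho>" and z: "z \<in> U"
  shows "((\<lambda>w. Res w x) \<longlongrightarrow> Res z x) (at z)"
proof -
  have zr: "z \<in> \<rho>" using U z by blast
  define M where "M = onorm (Res z)"
  have M: "M \<ge> 0" unfolding M_def by (rule onorm_nonneg[OF Res_bounded[OF zr]])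
  have "\<forall>\<^sub>F w in at z. w \<in> U" using U(1) z by (rule eventually_at_in_open')
  moreover have "\<forall>\<^sub>F w in at z. dist w z < 1 / (2 * (M + 1))"
    using M by (intro tendstoD[OF tendsto_ident_at]) auto
  ultimately have "\<forall>\<^sub>F w in at z. norm (Res w x - Res z x) \<le> cmod (w - z) * (2 * M * norm (Res z x))"
  proof eventually_elim
    case (elim w)
    have "cmod (w - z) * M \<le> 1 / (2 * (M + 1)) * (M + 1)"
      using elim(2) M by (intro mult_mono) (auto simp: dist_norm)
    also have "\<dots> = 1 / 2" using M by (simp add: field_simps)
    finally have "cmod (w - z) * M \<le> 1 / 2" .
    then have "norm (Res w (Res z x)) \<le> 2 * M * norm (Res z x)"
      unfolding M_def using elim(1) U(2) by (intro Res_locally_bounded zr) auto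
    moreover have "Res w x - Res z x = (w - z) *\<^sub>C Res w (Res z x)"
      using elim(1) U(2) by (intro resolvent_identity zr) auto
    ultimately show ?case by (simp add: norm_scaleC mult_left_mono)
  qed
  moreover have "((\<lambda>w. cmod (w - z) * (2 * M * norm (Res z x))) \<longlongrightarrow> 0) (at z)"
    by (rule tendsto_eq_intros | simp)+
  ultimately have "((\<lambda>w. Res w x - Res z x) \<longlongrightarrow> 0) (at z)"
    by (rule Lim_null_comparison)
  then show ?thesis by (rule LIM_zero_cancel)
qed

lemma Res_holomorphic:
  assumes U: "open U" "U \<subseteq> \<rho>" and \<phi>: "bounded_clinear \<phi>"
  shows "(\<lambda>z. \<phi> (Res z x)) holomorphic_on U"
  unfolding holomorphic_on_open[OF U(1)]
proof
  fix z assume z: "z \<in> U"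
  note l = bounded_clinear_clinear[OF \<phi>]
  have "((\<lambda>w. (\<phi> (Res w x) - \<phi> (Res z x)) / (w - z)) \<longlongrightarrow> \<phi> (Res z (Res z x))) (at z)"
  proof (rule Lim_transform_eventually)
    show "((\<lambda>w. \<phi> (Res w (Res z x))) \<longlongrightarrow> \<phi> (Res z (Res z x))) (at z)"
      by (rule bounded_linear.tendsto[OF bounded_clinear_bounded_linear[OF \<phi>] Res_tendsto[OF U z]])
    have "\<forall>\<^sub>F w in at z. w \<in> U" using U(1) z by (rule eventually_at_in_open')
    moreover have "\<forall>\<^sub>F w in at z. w \<noteq> z" by (simp add: eventually_at_filter)
    ultimately show "\<forall>\<^sub>F w in at z. \<phi> (Res w (Res z x)) = (\<phi> (Res w x) - \<phi> (Res z x)) / (w - z)"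
    proof eventually_elim
      case (elim w)
      have "\<phi> (Res w x) - \<phi> (Res z x) = \<phi> ((w - z) *\<^sub>C Res w (Res z x))"
        using elim U(2) z by (subst resolvent_identity[symmetric]) (auto simp: clinear_diff[OF l])
      then show ?case using elim(2) by (simp add: clinear_scale[OF l] scaleC_complex_def)
    qed
  qed
  then show "\<exists>f'. ((\<lambda>z. \<phi> (Res z x)) has_field_derivative f') (at z)"
    unfolding has_field_derivative_iff by blast
qed

end

section \<open>Invariant flags of a semigroup\<close>

text \<open>Integrating the functional equation in one variable writes \<open>c\<close> through its
  own primitive, so a merely continuous \<open>c\<close> is differentiable and solves a linear
  differential equation.\<close>

lemma continuous_exponential_law:
  fixes c :: "real \<Rightarrow> complex"
  assumes add: "\<And>s t. 0 \<le> s \<Longrightarrow> 0 \<le> t \<Longrightarrow> c (s + t) = c s * c t" and one: "c 0 = 1"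
    and cont: "\<And>b. continuous_on {0..b} c"
  shows "\<exists>z. \<forall>s\<ge>0. c s = exp (- of_real s * z)"
proof -
  have "((\<lambda>h. integral {0..0 + h} c /\<^sub>R h) \<longlongrightarrow> c 0) (at_right 0)"
    by (rule integral_average_tendsto[where b = 1]) (use cont in auto)
  then have "\<forall>\<^sub>F h in at_right 0. dist (integral {0..0 + h} c /\<^sub>R h) (c 0) < 1"
    by (rule tendstoD) simp
  then obtain h0 where h0: "h0 > 0" "\<And>h. 0 < h \<Longrightarrow> h < h0 \<Longrightarrow> dist (integral {0..0 + h} c /\<^sub>R h) (c 0) < 1"
    unfolding eventually_at_right_field by auto
  define h where "h = h0 / 2"
  define C where "C = integral {0..h} c"
  have h: "h > 0" using h0(1) by (simp add: h_def)
  \<comment> \<open>The average of \<open>c\<close> over a short interval is within distance 1 of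
    \<open>c 0 = 1\<close>, hence nonzero.\<close>
  have C0: "C \<noteq> 0" using h0(2)[of h] h0(1) by (auto simp: C_def one h_def)
  have int: "c integrable_on {a..b}" if "0 \<le> a" for a b
    by (rule integrable_continuous_real) (rule continuous_on_subset[OF cont[of b]], use that in auto)
  define G where "G u = integral {0..u} c" for u
  have cG: "c t = (G (t + h) - G t) / C" if "t \<ge> 0" for t
  proof -
    have "G (t + h) - G t = integral {0 + t..h + t} c"
      using Henstock_Kurzweil_Integration.integral_combine[where a = 0 and c = t and b = "t + h" and f = c]
        that h int by (simp add: G_def add.commute algebra_simps)
    also have "\<dots> = integral {0..h} (c \<circ> (+) t)" by (rule integral_shift_Icc_real[symmetric])
    also have "\<dots> = integral {0..h} (\<lambda>s. c t * c s)"
      by (rule integral_cong) (use add that in auto)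
    also have "\<dots> = c t * C" by (simp add: C_def)
    finally show ?thesis using C0 by simp
  qed
  define w where "w = (c h - 1) / C"
  have der: "(c has_vector_derivative (w * c t)) (at t within {0..b})" if t: "t \<in> {0..b}" for t b
  proof -
    have G: "(G has_vector_derivative c u) (at u within {0..b + h})" if "u \<in> {0..b + h}" for u
      unfolding G_def[abs_def] by (rule integral_has_vector_derivative[OF cont that])
    have G1: "(G has_vector_derivative c t) (at t within {0..b})"
      by (rule has_vector_derivative_within_subset[OF G]) (use t h in auto)
    have "(G has_vector_derivative c (t + h)) (at (t + h) within (\<lambda>t. t + h) ` {0..b})"
      by (rule has_vector_derivative_within_subset[OF G]) (use t h in auto)
    moreover have "((\<lambda>t. t + h) has_vector_derivative 1) (at t within {0..b})"
      by (auto intro!: derivative_eq_intros)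
    ultimately have "(G \<circ> (\<lambda>t. t + h) has_vector_derivative 1 *\<^sub>R c (t + h)) (at t within {0..b})"
      by (rule vector_diff_chain_within[rotated])
    then have "((\<lambda>t. G (t + h) - G t) has_vector_derivative (c (t + h) - c t)) (at t within {0..b})"
      using has_vector_derivative_diff[OF _ G1] by (simp add: o_def)
    then have "((\<lambda>t. (G (t + h) - G t) * (1 / C)) has_vector_derivative (c (t + h) - c t) * (1 / C)) (at t within {0..b})"
      by (rule has_vector_derivative_mult_left)
    moreover have "(c (t + h) - c t) * (1 / C) = w * c t"
      using add[of t h] t h by (simp add: w_def algebra_simps diff_divide_distrib)
    ultimately have "((\<lambda>t. (G (t + h) - G t) * (1 / C)) has_vector_derivative w * c t) (at t within {0..b})"
      by simp
    then show ?thesis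
      by (rule has_vector_derivative_transform[OF t, rotated]) (simp add: cG)
  qed
  have "c s = exp (- of_real s * (- w))" if s: "s \<ge> 0" for s
  proof -
    define E where "E t = c t * exp (- (w * of_real t))" for t :: real
    have "(E has_derivative (\<lambda>h. 0)) (at t within {0..s})" if t: "t \<in> {0..s}" for t
    proof -
      have "((\<lambda>t. exp (- (w * of_real t))) has_vector_derivative (- w * exp (- (w * of_real t)))) (at t within {0..s})"
        by (rule has_vector_derivative_real_field[of "\<lambda>t. exp (- (w * t))"]) (auto intro!: derivative_eq_intros)
      then have "(E has_vector_derivative c t * (- w * exp (- (w * of_real t))) + (w * c t) * exp (- (w * of_real t))) (at t within {0..s})"
        unfolding E_def[abs_def] by (intro has_vector_derivative_mult der t)
      then show ?thesis by (simp add: has_vector_derivative_def)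
    qed
    then obtain k where "\<forall>t\<in>{0..s}. E t = k"
      using has_derivative_zero_constant[of "{0..s}" E] by auto
    then have "E s = E 0" using s by auto
    then have "c s * exp (- (w * of_real s)) = 1" by (simp add: E_def one)
    then show ?thesis
      by (simp add: exp_minus field_simps mult.commute)
  qed
  then show ?thesis by blast
qed

lemma finite_dimensional_if_orthonormal_bounded:
  fixes E :: "'a::complex_inner set"
  assumes E: "complex_vector.subspace E"
    and bd: "\<And>n (f :: nat \<Rightarrow> 'a). orthonormal {..<n} f \<Longrightarrow> f ` {..<n} \<subseteq> E \<Longrightarrow> n \<le> N"
  obtains B where "finite B" "E \<subseteq> complex_vector.span B"
proof -
  define good where "good n \<longleftrightarrow> (\<exists>f :: nat \<Rightarrow> 'a. orthonormal {..<n} f \<and> f ` {..<n} \<subseteq> E)" for n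
  have "good 0" by (simp add: good_def orthonormal_def)
  moreover have "n \<le> N" if "good n" for n using that bd by (auto simp: good_def)
  ultimately have good: "good (Greatest good)" and great: "\<And>n. good n \<Longrightarrow> n \<le> Greatest good"
    by (metis GreatestI_nat, metis Greatest_le_nat)
  define n where "n = Greatest good"
  obtain f :: "nat \<Rightarrow> 'a" where f: "orthonormal {..<n} f" "f ` {..<n} \<subseteq> E"
    using good unfolding good_def n_def by blast
  have os: "orthosystem {..<n} f" by (rule orthonormal_orthosystem[OF f(1)])
  have "x \<in> complex_vector.span (f ` {..<n})" if x: "x \<in> E" for x
  proof -
    define u where "u = x - proj f {..<n} x"
    have uE: "u \<in> E" unfolding u_def proj_def using f(2) x
      by (intro complex_vector.subspace_diff complex_vector.subspace_sum complex_vector.subspace_scale E) auto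
    have uf: "cinner u (f i) = 0" if "i < n" for i
      using cinner_proj_basis[OF os, of i x] that by (simp add: u_def cinner_diff_left)
    have "u = 0"
    proof (rule ccontr)
      assume u0: "u \<noteq> 0"
      define v where "v = complex_of_real (1 / norm u) *\<^sub>C u"
      have v: "v \<in> E" "norm v = 1" "\<And>i. i < n \<Longrightarrow> cinner v (f i) = 0"
        using u0 uE uf E by (auto simp: v_def norm_scaleC norm_divide cinner_scaleC_left intro: complex_vector.subspace_scale)
      have "cinner (f i) v = 0" if "i < n" for i using v(3)[OF that] cinner_eq_0_commute by blast
      then have "orthonormal {..<Suc n} (f(n := v))"
        using f(1) v by (auto simp: orthonormal_def norm_one_iff)
      then have "good (Suc n)" unfolding good_def
        using f(2) v(1) by (intro exI[of _ "f(n := v)"]) (auto simp: less_Suc_eq)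
      then show False using great[of "Suc n"] by (simp add: n_def)
    qed
    then have "x = proj f {..<n} x" by (simp add: u_def)
    then show ?thesis using proj_in_span[of f "{..<n}" x] by simp
  qed
  then show ?thesis using that[of "f ` {..<n}"] by auto
qed

context generated_semigroup
begin

text \<open>The diagonal law is required for all times at once: at a single time \<zeta> k would be
  determined only up to multiples of a period of the exponential, and distinct eigenvalues of
  \<open>A\<close> could not be told apart.\<close>

definition spectral_flag :: "real \<Rightarrow> (nat \<Rightarrow> 'a) \<Rightarrow> (nat \<Rightarrow> complex) \<Rightarrow> nat \<Rightarrow> bool" where
  "spectral_flag \<Lambda> f \<zeta> n \<longleftrightarrow> flag (T ` {0..}) f n \<and>
     (\<forall>k<n. Re (\<zeta> k) \<le> \<Lambda> \<and> (\<forall>s\<ge>0. cinner (T s (f k)) (f k) = exp (- of_real s * \<zeta> k)))"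

lemma spectral_flag_flag: "spectral_flag \<Lambda> f \<zeta> n \<Longrightarrow> flag (T ` {0..}) f n"
  and spectral_flag_diag:
    "spectral_flag \<Lambda> f \<zeta> n \<Longrightarrow> k < n \<Longrightarrow> 0 \<le> s \<Longrightarrow> cinner (T s (f k)) (f k) = exp (- of_real s * \<zeta> k)"
  and spectral_flag_Re: "spectral_flag \<Lambda> f \<zeta> n \<Longrightarrow> k < n \<Longrightarrow> Re (\<zeta> k) \<le> \<Lambda>"
  by (auto simp: spectral_flag_def)

lemma spectral_flag_card:
  assumes fl: "spectral_flag \<Lambda> f \<zeta> n" and \<tau>: "\<tau> > 0" and K: "nuclear_rep (T \<tau>) a b c"
  shows "real n \<le> exp (\<tau> * \<Lambda>) * c"
proof -
  have "real n * exp (- (\<tau> * \<Lambda>)) = (\<Sum>k<n. exp (- (\<tau> * \<Lambda>)))" by simp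
  also have "\<dots> \<le> (\<Sum>k<n. cmod (cinner (T \<tau> (f k)) (f k)))"
    using \<tau> spectral_flag_Re[OF fl] spectral_flag_diag[OF fl]
    by (intro sum_mono) (auto intro!: mult_left_mono)
  also have "\<dots> \<le> c"
    by (rule nuclear_rep_diagonal[OF K flag_orthosystem[OF spectral_flag_flag[OF fl] order_refl]]) simp
  finally show ?thesis by (simp add: exp_minus field_simps)
qed

text \<open>Bounds the exponents from the other side, so that diagonal entries at small times are
  bounded uniformly in the flag.\<close>

lemma spectral_flag_Re_lower:
  assumes fl: "spectral_flag \<Lambda> f \<zeta> n" and k: "k < n"
  shows "exp (- Re (\<zeta> k)) \<le> onorm (T 1)"
proof -
  have nf: "norm (f k) = 1"
    using orthonormal_norm[OF flag_orthonormal[OF spectral_flag_flag[OF fl]]] k by simp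
  have "exp (- Re (\<zeta> k)) = cmod (cinner (T 1 (f k)) (f k))"
    using spectral_flag_diag[OF fl k, of 1] by simp
  also have "\<dots> \<le> norm (T 1 (f k)) * norm (f k)" by (rule cinner_bound)
  also have "\<dots> \<le> onorm (T 1)"
    using bounded_clinear_norm_le[OF T_bounded[of 1], of "f k"] by (simp add: nf)
  finally show ?thesis .
qed

lemma maximal_spectral_flag_exists:
  assumes K: "nuclear_rep (T 1) a b c"
  obtains f \<zeta> n where "spectral_flag \<Lambda> f \<zeta> n"
    "\<And>f' \<zeta>'. \<not> spectral_flag \<Lambda> f' \<zeta>' (Suc n)"
proof -
  define good where "good n \<longleftrightarrow> (\<exists>f \<zeta>. spectral_flag \<Lambda> f \<zeta> n)" for n
  obtain N :: nat where N: "exp (1 * \<Lambda>) * c \<le> real N" using real_arch_simple by blast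
  have "good 0" by (simp add: good_def spectral_flag_def flag_def orthonormal_def)
  moreover have "n \<le> N" if gn: "good n" for n
  proof -
    obtain f \<zeta> where "spectral_flag \<Lambda> f \<zeta> n" using gn by (auto simp: good_def)
    then have "real n \<le> exp (1 * \<Lambda>) * c" by (rule spectral_flag_card[OF _ _ K]) simp
    then show ?thesis using N by linarith
  qed
  ultimately have good: "good (Greatest good)" and great: "\<And>n. good n \<Longrightarrow> n \<le> Greatest good"
    by (metis GreatestI_nat, metis Greatest_le_nat)
  then have "\<not> good (Suc (Greatest good))" by fastforce
  then show ?thesis using that good unfolding good_def by blast
qed

text \<open>An eigenspace of the compression of \<open>T \<tau>\<close> is finite-dimensional and
  invariant under the compressions of all \<open>T s\<close>. A common eigenvector in it extends the
  flag, and since its entry at time \<tau> is \<mu>, the new exponent has real part at most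
  \<Lambda>, against maximality.\<close>

lemma maximal_spectral_flag_no_eigenvalue:
  assumes fl: "spectral_flag \<Lambda> f \<zeta> n" and max: "\<And>f' \<zeta>'. \<not> spectral_flag \<Lambda> f' \<zeta>' (Suc n)"
    and \<tau>: "\<tau> > 0" and K: "nuclear_rep (T \<tau>) a b c"
    and \<mu>: "exp (- (\<tau> * \<Lambda>)) \<le> cmod \<mu>" and x: "T \<tau> x - proj f {..<n} (T \<tau> x) = \<mu> *\<^sub>C x"
  shows "x = 0"
proof (rule ccontr)
  assume "x \<noteq> 0"
  have \<mu>0: "\<mu> \<noteq> 0" using \<mu> exp_gt_zero[of "- (\<tau> * \<Lambda>)"] by auto
  note flg = spectral_flag_flag[OF fl]
  have os: "orthosystem {..<n} f" by (rule flag_orthosystem[OF flg order_refl])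
  define Q where "Q y = y - proj f {..<n} y" for y
  have bQ: "bounded_clinear Q" unfolding Q_def by (rule bounded_clinear_diff_proj[OF os]) simp
  note lQ = bounded_clinear_clinear[OF bQ]
  have QT: "Q (T s y) = Q (T s (Q y))" if "s \<ge> 0" for s y
    unfolding Q_def using that by (intro flag_compress[OF flg]) (auto intro: T_clinear)
  have lT: "clinear (T \<tau>)" using \<tau> by (intro T_clinear) simp
  define E where "E = {y. Q (T \<tau> y) = \<mu> *\<^sub>C y}"
  have subE: "complex_vector.subspace E"
    unfolding complex_vector.subspace_def E_def
    by (auto simp: clinear_zero[OF lT] clinear_zero[OF lQ] clinear_add[OF lT] clinear_add[OF lQ]
        clinear_scale[OF lT] clinear_scale[OF lQ] scaleC_add_right mult.commute)
  \<comment> \<open>The range of \<open>Q\<close> is orthogonal to the flag, and \<mu> is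
    nonzero.\<close>
  have orthE: "cinner y (f i) = 0" if "y \<in> E" "i < n" for y i
  proof -
    have "\<mu> * cinner y (f i) = cinner (Q (T \<tau> y)) (f i)" using that by (simp add: E_def cinner_scaleC_left)
    also have "\<dots> = 0"
      using cinner_proj_basis[OF os] that(2) by (simp add: Q_def cinner_diff_left)
    finally show ?thesis using \<mu>0 by simp
  qed
  have QK: "nuclear_rep (\<lambda>y. Q (T \<tau> y)) a (\<lambda>i. Q (b i)) c"
    using norm_diff_proj_le[OF os] by (intro nuclear_rep_compose[OF K bQ]) (simp add: Q_def)
  obtain N :: nat where N: "c / cmod \<mu> \<le> real N" using real_arch_simple by blast
  obtain B where B: "finite B" "E \<subseteq> complex_vector.span B"
  proof (rule finite_dimensional_if_orthonormal_bounded[OF subE])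
    fix m and g :: "nat \<Rightarrow> 'a" assume g: "orthonormal {..<m} g" "g ` {..<m} \<subseteq> E"
    \<comment> \<open>Each orthonormal vector of the eigenspace contributes the modulus of \<mu> to
      a diagonal sum that is at most \<open>c\<close>.\<close>
    have "real m * cmod \<mu> = (\<Sum>k<m. cmod \<mu>)" by simp
    also have "\<dots> = (\<Sum>k<m. cmod (cinner (Q (T \<tau> (g k))) (g k)))"
    proof (intro sum.cong refl)
      fix k assume "k \<in> {..<m}"
      then have "Q (T \<tau> (g k)) = \<mu> *\<^sub>C g k" "cinner (g k) (g k) = 1"
        using g by (auto simp: E_def orthonormal_def)
      then show "cmod \<mu> = cmod (cinner (Q (T \<tau> (g k))) (g k))" by (simp add: cinner_scaleC_left)
    qed
    also have "\<dots> \<le> c" by (rule nuclear_rep_diagonal[OF QK orthonormal_orthosystem[OF g(1)]]) simp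
    finally have "real m \<le> c / cmod \<mu>" using \<mu>0 by (simp add: field_simps)
    then show "m \<le> N" using N by linarith
  qed blast
  obtain v where v: "v \<in> E" "norm v = 1" "flag (T ` {0..}) (f(n := v)) (Suc n)"
  proof (rule flag_extend_finite[OF flg _ _ subE orthE _ B(2,1)])
    show "clinear S" if "S \<in> T ` {0..}" for S using that by (auto intro: T_clinear)
    show "S (S' y) = S' (S y)" if "S \<in> T ` {0..}" "S' \<in> T ` {0..}" for S S' y
      using that by (auto intro: T_commute)
    show "E \<noteq> {0}" using x \<open>x \<noteq> 0\<close> by (auto simp: E_def Q_def)
    show "S y - proj f {..<n} (S y) \<in> E" if S: "S \<in> T ` {0..}" and y: "y \<in> E" for S y
    proof -
      obtain s where s: "s \<ge> 0" "S = T s" using S by auto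
      have "Q (T \<tau> (Q (T s y))) = Q (T \<tau> (T s y))" using QT[of \<tau> "T s y"] \<tau> by simp
      also have "\<dots> = Q (T s (T \<tau> y))" using T_commute[of \<tau> s y] \<tau> s by simp
      also have "\<dots> = Q (T s (Q (T \<tau> y)))" by (rule QT[OF s(1)])
      also have "\<dots> = \<mu> *\<^sub>C Q (T s y)"
        using y by (simp add: E_def clinear_scale[OF T_clinear[OF s(1)]] clinear_scale[OF lQ])
      finally show ?thesis by (simp add: E_def Q_def s(2))
    qed
  qed blast
  define c' where "c' s = cinner (T s v) v" for s
  have vv: "cinner v v = 1" using v(2) norm_one_iff by blast
  have QTv: "Q (T s v) = c' s *\<^sub>C v" if "s \<ge> 0" for s
  proof -
    have "T s \<in> T ` {0..}" using that by simp
    then have "proj (f(n := v)) {..n} (T s ((f(n := v)) n)) = T s ((f(n := v)) n)"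
      using v(3) unfolding flag_def by blast
    then have "T s v = proj (f(n := v)) {..n} (T s v)" by simp
    also have "\<dots> = proj f {..<n} (T s v) + c' s *\<^sub>C v"
    proof -
      have "proj (f(n := v)) {..<n} = proj f {..<n}" by (rule proj_upd) simp
      then show ?thesis by (simp add: proj_def c'_def lessThan_Suc_atMost[symmetric] fun_eq_iff)
    qed
    finally show ?thesis unfolding Q_def diff_eq_eq by (simp add: add.commute)
  qed
  \<comment> \<open>The diagonal entry at the new vector is multiplicative in time because the
    extended flag is triangular for all \<open>T s\<close>.\<close>
  have "\<exists>z. \<forall>s\<ge>0. c' s = exp (- of_real s * z)"
  proof (rule continuous_exponential_law)
    show "c' (s + t) = c' s * c' t" if "0 \<le> s" "0 \<le> t" for s t
      using flag_diag_mult[OF v(3), of "T s" "T t" n] that T_add[OF that, of v]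
      by (simp add: c'_def T_clinear)
    show "c' 0 = 1" by (simp add: c'_def T_0 vv)
    show "continuous_on {0..b} c'" for b
      unfolding c'_def[abs_def] by (intro continuous_intros T_continuous)
  qed
  then obtain z where z: "\<And>s. s \<ge> 0 \<Longrightarrow> c' s = exp (- of_real s * z)" by blast
  have "\<mu> *\<^sub>C v = c' \<tau> *\<^sub>C v" using QTv[of \<tau>] \<tau> v(1) by (auto simp: E_def)
  then have "\<mu> = c' \<tau>" using v(2) by (metis complex_vector.scale_cancel_right norm_zero zero_neq_one)
  then have "cmod \<mu> = exp (- (\<tau> * Re z))" using z[of \<tau>] \<tau> by simp
  then have "\<tau> * Re z \<le> \<tau> * \<Lambda>" using \<mu> by simp
  then have Rez: "Re z \<le> \<Lambda>" using \<tau> by simp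
  have "spectral_flag \<Lambda> (f(n := v)) (\<zeta>(n := z)) (Suc n)"
    unfolding spectral_flag_def
  proof (intro conjI allI impI v(3))
    fix k assume k: "k < Suc n"
    show "Re ((\<zeta>(n := z)) k) \<le> \<Lambda>"
      using k Rez spectral_flag_Re[OF fl] by (cases "k = n") auto
    fix s :: real assume s: "s \<ge> 0"
    show "cinner (T s ((f(n := v)) k)) ((f(n := v)) k) = exp (- of_real s * (\<zeta>(n := z)) k)"
      using k spectral_flag_diag[OF fl _ s] z[OF s] by (cases "k = n") (auto simp: c'_def)
  qed
  then show False using max by blast
qed

end

section \<open>Riesz projectors and the counting function\<close>

text \<open>Time 1 is singled out because \<open>J\<close> integrates over the unit interval, so the
  resolvent is governed by \<open>T 1\<close>.\<close>

locale maximal_spectral_flag = generated_semigroup D A T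
  for D :: "'a::complex_hilbert set" and A T +
  fixes \<Lambda> :: real and f :: "nat \<Rightarrow> 'a" and \<zeta> :: "nat \<Rightarrow> complex" and n :: nat
    and a b :: "nat \<Rightarrow> 'a" and c :: real
  assumes K: "nuclear_rep (T 1) a b c"
    and fl: "spectral_flag \<Lambda> f \<zeta> n"
    and maximal: "\<not> spectral_flag \<Lambda> f' \<zeta>' (Suc n)"
begin

abbreviation U :: "nat \<Rightarrow> 'a set" where
  "U m \<equiv> complex_vector.span (f ` {..<m})"

abbreviation Q :: "'a \<Rightarrow> 'a" where
  "Q x \<equiv> x - proj f {..<n} x"

lemma flagT: "flag (T ` {0..}) f n"
  by (rule spectral_flag_flag[OF fl])

lemma os: "m \<le> n \<Longrightarrow> orthosystem {..<m} f"
  by (rule flag_orthosystem[OF flagT])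

lemma on: "i < n \<Longrightarrow> j < n \<Longrightarrow> cinner (f i) (f j) = (if i = j then 1 else 0)"
  using flag_orthonormal[OF flagT] by (auto simp: orthonormal_def)

lemma U_proj: "m \<le> n \<Longrightarrow> x \<in> U m \<Longrightarrow> proj f {..<m} x = x"
  by (rule proj_fix[OF os]) auto

lemma f_U: "k < m \<Longrightarrow> f k \<in> U m"
  by (rule complex_vector.span_base) auto

lemma U_orth:
  assumes "x \<in> U m" "m \<le> k" "k < n"
  shows "cinner x (f k) = 0"
proof -
  have "m \<le> n" using assms by simp
  then have "cinner x (f k) = cinner (proj f {..<m} x) (f k)" using U_proj assms(1) by simp
  also have "\<dots> = (\<Sum>i<m. cinner x (f i) * cinner (f i) (f k))"
    by (simp add: proj_def cinner_sum_left cinner_scaleC_left)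
  also have "\<dots> = 0" using assms by (intro sum.neutral) (auto simp: on)
  finally show ?thesis .
qed

lemma T_U: "0 \<le> s \<Longrightarrow> m \<le> n \<Longrightarrow> x \<in> U m \<Longrightarrow> T s x \<in> U m"
  by (rule flag_invariant_span[OF flagT]) (auto intro: T_clinear)

lemma J_U:
  assumes m: "m \<le> n" and x: "x \<in> U m"
  shows "J z x \<in> U m"
proof -
  have "proj f {..<m} (J z x) = integral {0..1} (\<lambda>s. proj f {..<m} (integrand z x s))"
    by (rule J_bounded_linear_commute[OF bounded_clinear_bounded_linear[OF bounded_clinear_proj[OF os[OF m]]]]) simp
  also have "\<dots> = integral {0..1} (integrand z x)"
    by (rule integral_cong)
      (simp add: integrand_def clinear_scale[OF clinear_proj] U_proj[OF m T_U[OF _ m x]])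
  finally have "proj f {..<m} (J z x) = J z x" by (simp add: J_def)
  then show ?thesis using proj_in_span[of f "{..<m}" "J z x"] by simp
qed

lemma U_Suc_decompose:
  assumes k: "k < n" and x: "x \<in> U (Suc k)"
  shows "x = proj f {..<k} x + cinner x (f k) *\<^sub>C f k"
proof -
  have "x = proj f {..<Suc k} x" using U_proj[of "Suc k" x] k x by simp
  also have "\<dots> = proj f {..<k} x + cinner x (f k) *\<^sub>C f k" by (simp add: proj_def)
  finally show ?thesis .
qed

lemma T_leading_coeff:
  assumes k: "k < n" and x: "x \<in> U (Suc k)" and s: "0 \<le> s"
  shows "cinner (T s x) (f k) = exp (- of_real s * \<zeta> k) * cinner x (f k)"
proof -
  note l = T_clinear[OF s]
  have "T s x = T s (proj f {..<k} x) + cinner x (f k) *\<^sub>C T s (f k)"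
    by (subst U_Suc_decompose[OF k x]) (simp add: clinear_add[OF l] clinear_scale[OF l])
  moreover have "cinner (T s (proj f {..<k} x)) (f k) = 0"
    using k s by (intro U_orth[OF T_U[OF _ _ proj_in_span]]) auto
  ultimately show ?thesis
    by (simp add: cinner_add_left cinner_scaleC_left spectral_flag_diag[OF fl k s])
qed

text \<open>The complement part of an eigenvector is an eigenvector of the compression, hence 0.
  What remains lies in the flag, and its coordinates vanish from the top down because the diagonal
  entries differ from the eigenvalue.\<close>

lemma no_eigenvalue_of_T:
  assumes QK: "\<And>y. Q (T 1 y) = exp (- z) *\<^sub>C y \<Longrightarrow> y = 0"
    and ne: "\<And>k. k < n \<Longrightarrow> exp (- z) \<noteq> exp (- \<zeta> k)"
    and x: "T 1 x = exp (- z) *\<^sub>C x"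
  shows "x = 0"
proof -
  have "Q (T 1 (Q x)) = Q (T 1 x)"
    using flag_compress[OF flagT, of "T 1" x] T_clinear[of 1] by simp
  also have "\<dots> = exp (- z) *\<^sub>C Q x"
    by (simp add: x clinear_scale[OF clinear_proj] complex_vector.scale_right_diff_distrib)
  finally have "Q x = 0" by (rule QK)
  then have "x \<in> U n" using proj_in_span[of f "{..<n}" x] by simp
  moreover have "x \<in> U m \<Longrightarrow> x = 0" if "m \<le> n" for m
    using that
  proof (induction m)
    case 0
    then show ?case by simp
  next
    case (Suc m)
    then have m: "m < n" by simp
    have "exp (- \<zeta> m) * cinner x (f m) = exp (- z) * cinner x (f m)"
      using T_leading_coeff[OF m Suc.prems(1), of 1] by (auto simp: x cinner_scaleC_left)
    then have "cinner x (f m) = 0" by (metis mult_cancel_right ne[OF m])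
    then have "x = proj f {..<m} x" using U_Suc_decompose[OF m Suc.prems(1)] by simp
    then have "x \<in> U m" using proj_in_span[of f "{..<m}" x] by simp
    then show ?case using Suc.IH m by simp
  qed
  ultimately show "x = 0" by blast
qed

text \<open>The resolvent is \<open>J z\<close> times the inverse \<open>R\<close> of I - exp z * T
  1. Both factors preserve every \<open>U m\<close>, so diagonal entries multiply, and the
  complement block is estimated from the lower bound \<open>d\<close> for the compression.\<close>

lemma resolvent_near:
  assumes d: "d > 0" and QK: "\<And>y. d * norm y \<le> norm (Q (T 1 y) - exp (- z) *\<^sub>C y)"
    and ne: "\<And>k. k < n \<Longrightarrow> exp (- z) \<noteq> exp (- \<zeta> k)"
    and M: "\<And>x. norm (J z x) \<le> M * norm x" "M \<ge> 0"
  shows "z \<in> \<rho>" "\<And>m x. m \<le> n \<Longrightarrow> x \<in> U m \<Longrightarrow> Res z x \<in> U m"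
    "\<And>k. k < n \<Longrightarrow> cinner (Res z (f k)) (f k) = 1 / (\<zeta> k - z)"
    "\<And>x. norm (Q (Res z (Q x))) \<le> M * (cmod (exp (- z)) / d) * norm x"
proof -
  define S where "S x = exp z *\<^sub>C T 1 x" for x
  have S_nuc: "nuclear_rep S a (\<lambda>i. exp z *\<^sub>C b i) (cmod (exp z) * c)"
    unfolding S_def[abs_def] by (rule nuclear_rep_scale[OF K])
  have lT: "clinear (T 1)" by (rule T_clinear) simp
  have lS: "clinear S" by (rule nuclear_rep_clinear[OF S_nuc])
  have ee: "exp (- z) * exp z = 1" by (simp flip: exp_add)
  have no_fix: "x = 0" if "S x = x" for x
  proof (rule no_eigenvalue_of_T[OF _ ne])
    show "y = 0" if "Q (T 1 y) = exp (- z) *\<^sub>C y" for y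
      using QK[of y] that d by (simp add: mult_le_0_iff)
    have "exp (- z) *\<^sub>C S x = T 1 x" by (simp add: S_def ee)
    then show "T 1 x = exp (- z) *\<^sub>C x" using that by simp
  qed
  obtain R where R: "bounded_clinear R" "\<And>x. R (x - S x) = x" "\<And>x. R x - S (R x) = x"
    using fredholm_alternative[OF S_nuc no_fix] by blast
  show "z \<in> \<rho>" using resolvent_setI(1)[OF R(1)] R(2,3) by (simp add: S_def)
  have Res: "Res z = (\<lambda>x. J z (R x))"
    using resolvent_setI(2)[OF R(1)] R(2,3) by (simp add: S_def)
  \<comment> \<open>I - S is injective on the finite-dimensional invariant space \<open>U m\<close>,
    hence onto it, so its inverse stays inside.\<close>
  have R_U: "R x \<in> U m" if m: "m \<le> n" and x: "x \<in> U m" for m x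
  proof -
    define L where "L y = y - S y" for y
    have "clinear L" unfolding L_def
      by (rule clinearI) (simp_all add: clinear_add[OF lS] clinear_scale[OF lS] complex_vector.scale_right_diff_distrib)
    then have "L ` U m = U m"
    proof (rule injective_imp_surjective_on)
      show "L ` U m \<subseteq> U m" unfolding L_def S_def
        using T_U[of 1 m] m by (auto intro!: complex_vector.span_diff complex_vector.span_scale)
      show "y = 0" if "L y = 0" for y using no_fix[of y] that by (simp add: L_def)
    qed auto
    then obtain u where "u \<in> U m" "L u = x" using x by (metis imageE)
    then show ?thesis using R(2)[of u] by (simp add: L_def)
  qed
  show "Res z x \<in> U m" if "m \<le> n" "x \<in> U m" for m x
    unfolding Res by (rule J_U[OF that(1) R_U[OF that]])
  show "cinner (Res z (f k)) (f k) = 1 / (\<zeta> k - z)" if k: "k < n" for k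
  proof -
    define v where "v = R (f k)"
    define g where "g = cinner v (f k)"
    \<comment> \<open>\<open>w\<close> and \<open>g\<close> are the diagonal entries of
      \<open>S\<close> and \<open>R\<close> at \<open>k\<close>. The entry of \<open>J z\<close> is
      (w - 1) / (z - \<zeta> k), and with g * (1 - w) = 1 the exponentials cancel.\<close>
    define w where "w = exp (z - \<zeta> k)"
    have k': "Suc k \<le> n" using k by simp
    have v: "v \<in> U (Suc k)" unfolding v_def by (rule R_U[OF k' f_U]) simp
    have zk: "z \<noteq> \<zeta> k" using ne[OF k] by auto
    have "cinner (v - S v) (f k) = 1"
      unfolding v_def R(3) using on[OF k k] by simp
    moreover have "cinner (S v) (f k) = w * g"
      using T_leading_coeff[OF k v, of 1]
      by (simp add: S_def cinner_scaleC_left g_def w_def exp_diff exp_minus divide_inverse)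
    ultimately have g1: "g * (1 - w) = 1"
      by (simp add: cinner_diff_left g_def algebra_simps)
    have "cinner (J z v) (f k) = integral {0..1} (\<lambda>s. cinner (integrand z v s) (f k))"
      by (rule J_bounded_linear_commute[OF bounded_linear_cinner_left])
    also have "\<dots> = integral {0..1} (\<lambda>s. g * exp (of_real s * (z - \<zeta> k)))"
    proof (rule integral_cong)
      fix s :: real assume "s \<in> {0..1}"
      then have "cinner (integrand z v s) (f k) = exp (of_real s * z) * (exp (- of_real s * \<zeta> k) * g)"
        using T_leading_coeff[OF k v, of s] by (simp add: integrand_def cinner_scaleC_left g_def)
      also have "\<dots> = g * exp (of_real s * (z - \<zeta> k))"
        by (simp add: right_diff_distrib exp_diff exp_minus divide_inverse mult_ac)
      finally show "cinner (integrand z v s) (f k) = g * exp (of_real s * (z - \<zeta> k))" .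
    qed
    also have "\<dots> = g * ((w - 1) / (z - \<zeta> k))"
    proof -
      have "((\<lambda>s. exp (of_real s * (z - \<zeta> k))) has_integral
          (exp (of_real 1 * (z - \<zeta> k)) / (z - \<zeta> k) - exp (of_real 0 * (z - \<zeta> k)) / (z - \<zeta> k))) {0..1}"
      proof (rule fundamental_theorem_of_calculus)
        fix s :: real assume "s \<in> {0..1}"
        show "((\<lambda>s. exp (of_real s * (z - \<zeta> k)) / (z - \<zeta> k)) has_vector_derivative exp (of_real s * (z - \<zeta> k))) (at s within {0..1})"
          by (rule has_vector_derivative_real_field[of "\<lambda>s. exp (s * (z - \<zeta> k)) / (z - \<zeta> k)"])
            (use zk in \<open>auto intro!: derivative_eq_intros\<close>)
      qed simp
      then have "integral {0..1} (\<lambda>s. exp (of_real s * (z - \<zeta> k))) = (w - 1) / (z - \<zeta> k)"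
        by (intro integral_unique) (simp add: w_def diff_divide_distrib)
      then show ?thesis by simp
    qed
    also have "\<dots> = 1 / (\<zeta> k - z)"
    proof -
      have "g * (w - 1) = - 1" using g1 by (simp add: algebra_simps)
      then have "g * ((w - 1) / (z - \<zeta> k)) = - 1 / (z - \<zeta> k)" by simp
      also have "\<dots> = 1 / (\<zeta> k - z)" using zk by (simp add: divide_simps)
      finally show ?thesis .
    qed
    finally show ?thesis by (simp add: Res v_def)
  qed
  show "norm (Q (Res z (Q x))) \<le> M * (cmod (exp (- z)) / d) * norm x" for x
  proof -
    define v where "v = R (Q x)"
    have "exp (- z) *\<^sub>C (v - S v) = exp (- z) *\<^sub>C Q x" by (simp add: v_def R(3))
    then have eq: "exp (- z) *\<^sub>C v - T 1 v = exp (- z) *\<^sub>C Q x"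
      by (simp add: complex_vector.scale_right_diff_distrib S_def ee)
    \<comment> \<open>Compressing the equation for \<open>v\<close> leaves one for
      \<open>Q v\<close> alone, to which the lower bound \<open>QK\<close> applies.\<close>
    have "Q (T 1 (Q v)) - exp (- z) *\<^sub>C Q v = Q (T 1 v - exp (- z) *\<^sub>C v)"
      using flag_compress[OF flagT, of "T 1" v] lT
      by (simp add: clinear_diff[OF clinear_proj] clinear_scale[OF clinear_proj] complex_vector.scale_right_diff_distrib)
    also have "T 1 v - exp (- z) *\<^sub>C v = - (exp (- z) *\<^sub>C Q x)" unfolding eq[symmetric] by simp
    also have "Q (- (exp (- z) *\<^sub>C Q x)) = - (exp (- z) *\<^sub>C Q x)"
      using proj_proj[OF os[OF order_refl], of x]
      by (simp add: clinear_diff[OF clinear_proj] clinear_scale[OF clinear_proj] clinear_minus[OF clinear_proj])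
    finally have "norm (Q (T 1 (Q v)) - exp (- z) *\<^sub>C Q v) = cmod (exp (- z)) * norm (Q x)"
      by (simp only: norm_minus_cancel norm_scaleC)
    then have "d * norm (Q v) \<le> cmod (exp (- z)) * norm (Q x)" using QK[of "Q v"] by simp
    also have "\<dots> \<le> cmod (exp (- z)) * norm x"
      by (intro mult_left_mono norm_diff_proj_le os) auto
    finally have Qv: "norm (Q v) \<le> (cmod (exp (- z)) / d) * norm x" using d by (simp add: field_simps)
    note lJ = bounded_clinear_clinear[OF bounded_clinear_J[of z]]
    have "proj f {..<n} (J z (proj f {..<n} v)) = J z (proj f {..<n} v)"
      by (intro U_proj J_U proj_in_span) auto
    then have "Q (J z v) = Q (J z (Q v))"
      by (simp add: clinear_diff[OF lJ] clinear_diff[OF clinear_proj])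
    then have "norm (Q (Res z (Q x))) = norm (Q (J z (Q v)))" by (simp add: Res v_def)
    also have "\<dots> \<le> norm (J z (Q v))" by (intro norm_diff_proj_le os) auto
    also have "\<dots> \<le> M * norm (Q v)" by (rule M(1))
    also have "\<dots> \<le> M * ((cmod (exp (- z)) / d) * norm x)" by (intro mult_left_mono Qv M(2))
    finally show ?thesis by (simp add: mult.assoc)
  qed
qed

text \<open>By maximality exp (- z0) is no eigenvalue of the compression, even if z0 is an
  eigenvalue of \<open>A\<close>. The resulting lower bound persists nearby with half the constant,
  and a small radius avoids the finitely many flag values.\<close>

lemma punctured_resolvent:
  assumes z0: "Re z0 \<le> \<Lambda>"
  obtains r C where "r > 0" "\<And>k. k < n \<Longrightarrow> \<zeta> k \<noteq> z0 \<Longrightarrow> r \<le> dist (\<zeta> k) z0"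
    "\<And>z. z \<noteq> z0 \<Longrightarrow> dist z z0 < r \<Longrightarrow> z \<in> \<rho> \<and> (\<forall>m\<le>n. \<forall>x\<in>U m. Res z x \<in> U m) \<and>
       (\<forall>k<n. cinner (Res z (f k)) (f k) = 1 / (\<zeta> k - z)) \<and> (\<forall>x. norm (Q (Res z (Q x))) \<le> C * norm x)"
proof -
  have os_n: "orthosystem {..<n} f" by (rule os) simp
  have QK_nuc: "nuclear_rep (\<lambda>x. Q (T 1 x)) a (\<lambda>i. Q (b i)) c"
    by (rule nuclear_rep_compose[OF K bounded_clinear_diff_proj[OF os_n]])
      (simp_all add: norm_diff_proj_le[OF os_n])
  have "exp (- (1 * \<Lambda>)) \<le> cmod (exp (- z0))" using z0 by simp
  then have "x = 0" if "Q (T 1 x) = exp (- z0) *\<^sub>C x" for x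
    using maximal_spectral_flag_no_eigenvalue[OF fl maximal _ K _ that] by simp
  then have "\<exists>d>0. \<forall>w\<in>{exp (- z0)}. \<forall>x. d * norm x \<le> norm (Q (T 1 x) - w *\<^sub>C x)"
    by (intro nuclear_rep_bounded_below[OF QK_nuc]) auto
  then obtain d where d: "d > 0" "\<And>x. d * norm x \<le> norm (Q (T 1 x) - exp (- z0) *\<^sub>C x)" by auto
  obtain M where M: "M > 0" "\<And>z x. norm (J z x) \<le> M * exp (cmod z) * norm x" using J_bound by blast
  have e_lim: "((\<lambda>z. exp (- z)) \<longlongrightarrow> exp (- z0)) (at z0)" by (intro tendsto_intros)
  have ev1: "\<forall>\<^sub>F z in at z0. dist (exp (- z)) (exp (- z0)) < d / 2"
    using e_lim d(1) by (intro tendstoD) auto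
  have near: "\<forall>\<^sub>F z in at z0. dist z z0 < e" if "e > 0" for e
    using that by (intro tendstoD[OF tendsto_ident_at])
  have neq: "\<forall>\<^sub>F z in at z0. z \<noteq> z0" by (simp add: eventually_at_filter)
  have "\<forall>\<^sub>F z in at z0. exp (- z) \<noteq> exp (- \<zeta> k)" for k
  proof (cases "exp (- z0) = exp (- \<zeta> k)")
    case False
    then show ?thesis using e_lim tendsto_imp_eventually_ne by blast
  next
    \<comment> \<open>The exponential is injective on a disc of radius 1, so points near z0 other
      than z0 miss the value exp (- z0), even when \<zeta> k differs from z0 by a period.\<close>
    case True
    show ?thesis using near[OF zero_less_one] neq
    proof eventually_elim
      case (elim z)
      show ?case
      proof
        assume "exp (- z) = exp (- \<zeta> k)"
        then have "exp (- z) = exp (- z0)" using True by simp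
        moreover have "\<bar>Im (- z) - Im (- z0)\<bar> < 2 * pi"
          using abs_Im_le_cmod[of "z - z0"] elim(1) pi_gt3 by (simp add: dist_norm)
        ultimately have "- z = - z0" by (rule exp_complex_eqI[rotated])
        then show False using elim(2) by simp
      qed
    qed
  qed
  then have ev2: "\<forall>\<^sub>F z in at z0. \<forall>k\<in>{..<n}. exp (- z) \<noteq> exp (- \<zeta> k)"
    by (intro eventually_ball_finite) auto
  have "\<forall>\<^sub>F z in at z0. \<zeta> k \<noteq> z0 \<longrightarrow> dist z z0 < dist (\<zeta> k) z0" for k
    using near[of "dist (\<zeta> k) z0"] by (cases "\<zeta> k = z0") auto
  then have ev3: "\<forall>\<^sub>F z in at z0. \<forall>k\<in>{..<n}. \<zeta> k \<noteq> z0 \<longrightarrow> dist z z0 < dist (\<zeta> k) z0"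
    by (intro eventually_ball_finite) auto
  have "\<forall>\<^sub>F z in at z0. dist z z0 < 1" by (rule near) simp
  with ev1 ev2 ev3 have "\<forall>\<^sub>F z in at z0. dist (exp (- z)) (exp (- z0)) < d / 2 \<and> (\<forall>k<n. exp (- z) \<noteq> exp (- \<zeta> k)) \<and>
      (\<forall>k<n. \<zeta> k \<noteq> z0 \<longrightarrow> dist z z0 < dist (\<zeta> k) z0) \<and> dist z z0 < 1"
    by eventually_elim auto
  then obtain r where r: "r > 0" "\<And>z. z \<noteq> z0 \<Longrightarrow> dist z z0 < r \<Longrightarrow>
      dist (exp (- z)) (exp (- z0)) < d / 2 \<and> (\<forall>k<n. exp (- z) \<noteq> exp (- \<zeta> k)) \<and>
      (\<forall>k<n. \<zeta> k \<noteq> z0 \<longrightarrow> dist z z0 < dist (\<zeta> k) z0) \<and> dist z z0 < 1"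
    unfolding eventually_at by auto
  define M1 where "M1 = M * exp (cmod z0 + 1)"
  define C where "C = M1 * ((exp (cmod z0 + 1)) / (d / 2))"
  show ?thesis
  proof (rule that[of r C])
    show "r > 0" by (rule r(1))
    show "r \<le> dist (\<zeta> k) z0" if k: "k < n" "\<zeta> k \<noteq> z0" for k
    proof (rule ccontr)
      assume "\<not> r \<le> dist (\<zeta> k) z0"
      then show False using r(2)[of "\<zeta> k"] k by auto
    qed
    fix z assume z: "z \<noteq> z0" "dist z z0 < r"
    note rz = r(2)[OF z]
    have cz: "cmod z \<le> cmod z0 + 1"
      using rz norm_triangle_ineq2[of z z0] by (simp add: dist_norm)
    have QKz: "d / 2 * norm y \<le> norm (Q (T 1 y) - exp (- z) *\<^sub>C y)" for y
    proof -
      have "d * norm y \<le> norm (Q (T 1 y) - exp (- z0) *\<^sub>C y)" by (rule d(2))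
      also have "Q (T 1 y) - exp (- z0) *\<^sub>C y = (Q (T 1 y) - exp (- z) *\<^sub>C y) + (exp (- z) - exp (- z0)) *\<^sub>C y"
        by (simp add: complex_vector.scale_left_diff_distrib)
      also have "norm \<dots> \<le> norm (Q (T 1 y) - exp (- z) *\<^sub>C y) + cmod (exp (- z) - exp (- z0)) * norm y"
        by (metis norm_triangle_ineq norm_scaleC)
      also have "cmod (exp (- z) - exp (- z0)) * norm y \<le> d / 2 * norm y"
        using rz by (intro mult_right_mono) (auto simp: dist_norm)
      finally show ?thesis by simp
    qed
    have Jz: "norm (J z x) \<le> M1 * norm x" for x
    proof -
      have "norm (J z x) \<le> M * exp (cmod z) * norm x" by (rule M(2))
      also have "\<dots> \<le> M1 * norm x"
        unfolding M1_def using M(1) cz by (intro mult_right_mono mult_left_mono) auto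
      finally show ?thesis .
    qed
    have M1: "M1 \<ge> 0" using M(1) by (simp add: M1_def)
    have "d / 2 > 0" using d(1) by simp
    note near_z = resolvent_near[OF this QKz _ Jz M1]
    have "norm (Q (Res z (Q x))) \<le> C * norm x" for x
    proof -
      have "norm (Q (Res z (Q x))) \<le> M1 * (cmod (exp (- z)) / (d / 2)) * norm x"
        using rz by (intro near_z(4)) auto
      also have "cmod (exp (- z)) \<le> exp (cmod z0 + 1)"
        using cz abs_Re_le_cmod[of z] by simp
      then have "M1 * (cmod (exp (- z)) / (d / 2)) * norm x \<le> C * norm x"
        unfolding C_def using M1 d(1) by (intro mult_right_mono mult_left_mono divide_right_mono) auto
      finally show ?thesis .
    qed
    then show "z \<in> \<rho> \<and> (\<forall>m\<le>n. \<forall>x\<in>U m. Res z x \<in> U m) \<and>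
       (\<forall>k<n. cinner (Res z (f k)) (f k) = 1 / (\<zeta> k - z)) \<and> (\<forall>x. norm (Q (Res z (Q x))) \<le> C * norm x)"
      using rz near_z(1-3) by blast
  qed
qed

text \<open>The diagonal entry 1 / (\<zeta> k - z) is unbounded near \<zeta> k, whereas resolvents
  are bounded near a point of the resolvent set.\<close>

lemma flag_values_in_spectrum:
  assumes k: "k < n"
  shows "\<zeta> k \<in> op_spectrum D A"
  unfolding op_spectrum_def
proof
  assume zk: "\<zeta> k \<in> \<rho>"
  obtain r C where r: "r > 0" "\<And>z. z \<noteq> \<zeta> k \<Longrightarrow> dist z (\<zeta> k) < r \<Longrightarrow>
      z \<in> \<rho> \<and> cinner (Res z (f k)) (f k) = 1 / (\<zeta> k - z)"
    using punctured_resolvent[OF spectral_flag_Re[OF fl k]] k by metis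
  define M where "M = onorm (Res (\<zeta> k))"
  have M: "M \<ge> 0" unfolding M_def by (rule onorm_nonneg[OF Res_bounded[OF zk]])
  \<comment> \<open>Small enough to remain in the punctured disc and to make \<delta> * M at most
    1/4, while the blow-up would require it to be at least 1/2.\<close>
  define \<delta> where "\<delta> = min (r / 2) (1 / (4 * (M + 1)))"
  have \<delta>: "\<delta> > 0" "\<delta> < r" "\<delta> \<le> 1 / (4 * (M + 1))"
    using r(1) M by (auto simp: \<delta>_def min_def)
  have "\<delta> * (M + 1) \<le> 1 / (4 * (M + 1)) * (M + 1)" using \<delta>(3) M by (intro mult_right_mono) auto
  also have "\<dots> = 1 / 4" using M by (simp add: field_simps)
  finally have \<delta>M: "\<delta> * M \<le> 1 / 4" using \<delta>(1) by (simp add: algebra_simps)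
  define z where "z = \<zeta> k + of_real \<delta>"
  have z: "z \<noteq> \<zeta> k" "dist z (\<zeta> k) < r" "cmod (z - \<zeta> k) = \<delta>"
    using \<delta> by (auto simp: z_def dist_norm)
  have nf: "norm (f k) = 1" using on[OF k k] norm_one_iff by auto
  have "1 / \<delta> = cmod (1 / (\<zeta> k - z))" using z(3) by (simp add: norm_divide norm_minus_commute)
  also have "\<dots> = cmod (cinner (Res z (f k)) (f k))" using r(2)[OF z(1,2)] by simp
  also have "\<dots> \<le> norm (Res z (f k)) * norm (f k)" by (rule cinner_bound)
  also have "\<dots> \<le> 2 * M * norm (f k)"
    unfolding M_def nf using Res_locally_bounded[OF zk, of z "f k"] r(2)[OF z(1,2)] z(3) \<delta>M
    by (simp add: M_def nf)
  finally have "1 \<le> 2 * (\<delta> * M)" using \<delta>(1) nf by (simp add: field_simps)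
  then show False using \<delta>M by simp
qed

end

section \<open>Riesz integrals tested against functionals\<close>

context generated_semigroup
begin

lemma Res_continuous_on:
  assumes "open V" "V \<subseteq> \<rho>"
  shows "continuous_on V (\<lambda>z. Res z x)"
  using Res_tendsto[OF assms] by (intro continuous_at_imp_continuous_on) (simp add: isCont_def)

lemma circle_integrand_continuous:
  assumes V: "open V" "V \<subseteq> \<rho>" and circ: "sphere z0 \<epsilon> \<subseteq> V" "\<epsilon> > 0"
  shows "continuous_on {0..1} (\<lambda>s. vector_derivative (circlepath z0 \<epsilon>) (at s within {0..1}) *\<^sub>C
      Res (circlepath z0 \<epsilon> s) x)"
proof -
  have "continuous_on {0..1} (\<lambda>s. Res (circlepath z0 \<epsilon> s) x)"
  proof (rule continuous_on_compose2[OF Res_continuous_on[OF V]])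
    show "continuous_on {0..1} (circlepath z0 \<epsilon>)"
      using path_circlepath[of z0 \<epsilon>] by (simp add: path_def)
    show "circlepath z0 \<epsilon> ` {0..1} \<subseteq> V"
    proof -
      have "path_image (circlepath z0 \<epsilon>) = sphere z0 \<epsilon>" using circ(2) by simp
      then show ?thesis using circ(1) by (simp only: path_image_def)
    qed
  qed
  then have "continuous_on {0..1} (\<lambda>s. (2 * pi * \<i> * \<epsilon> * exp (2 * of_real pi * \<i> * of_real s)) *\<^sub>C Res (circlepath z0 \<epsilon> s) x)"
    by (intro continuous_on_scaleC continuous_intros)
  then show ?thesis
    by (rule continuous_on_eq) (simp add: vector_derivative_circlepath01)
qed

text \<open>Bridge from the vector-valued integral to scalar contour integrals, where Cauchy's
  theorems apply.\<close>

lemma riesz_integral_functional: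
  assumes V: "open V" "V \<subseteq> \<rho>" and circ: "sphere z0 \<epsilon> \<subseteq> V" "\<epsilon> > 0"
    and \<phi>: "bounded_clinear (\<phi> :: 'a \<Rightarrow> complex)"
  shows "\<phi> (riesz_integral D A z0 \<epsilon> x) =
    \<i> / (2 * complex_of_real pi) * contour_integral (circlepath z0 \<epsilon>) (\<lambda>z. \<phi> (Res z x))"
proof -
  define g where "g s = vector_derivative (circlepath z0 \<epsilon>) (at s within {0..1}) *\<^sub>C
      Res (circlepath z0 \<epsilon> s) x" for s
  note l = bounded_clinear_clinear[OF \<phi>]
  have g: "g integrable_on {0..1}"
    unfolding g_def by (intro integrable_continuous_real circle_integrand_continuous[OF V circ])
  have "((\<phi> \<circ> g) has_integral \<phi> (integral {0..1} g)) {0..1}"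
    using g by (intro has_integral_linear integrable_integral bounded_clinear_bounded_linear[OF \<phi>])
  then have "((\<lambda>z. \<phi> (Res z x)) has_contour_integral \<phi> (integral {0..1} g)) (circlepath z0 \<epsilon>)"
    unfolding has_contour_integral_def
    by (simp add: o_def g_def clinear_scale[OF l] scaleC_complex_def mult.commute)
  then have "contour_integral (circlepath z0 \<epsilon>) (\<lambda>z. \<phi> (Res z x)) = \<phi> (integral {0..1} g)"
    by (rule contour_integral_unique)
  then show ?thesis
    by (simp add: riesz_integral_def g_def[abs_def] clinear_scale[OF l] scaleC_complex_def)
qed

lemma clinear_riesz_integral:
  assumes V: "open V" "V \<subseteq> \<rho>" and circ: "sphere z0 \<epsilon> \<subseteq> V" "\<epsilon> > 0"
  shows "clinear (riesz_integral D A z0 \<epsilon>)"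
proof -
  define g where "g x s = vector_derivative (circlepath z0 \<epsilon>) (at s within {0..1}) *\<^sub>C
      Res (circlepath z0 \<epsilon> s) x" for x s
  have g: "g x integrable_on {0..1}" for x
    unfolding g_def by (intro integrable_continuous_real circle_integrand_continuous[OF V circ])
  have "circlepath z0 \<epsilon> s \<in> \<rho>" if "s \<in> {0..1}" for s
  proof -
    have "circlepath z0 \<epsilon> s \<in> path_image (circlepath z0 \<epsilon>)" using that by (simp add: path_image_def)
    then show ?thesis using circ V(2) by auto
  qed
  then have l: "clinear (Res (circlepath z0 \<epsilon> s))" if "s \<in> {0..1}" for s
    using that by (intro bounded_clinear_clinear Res_bounded)
  have "integral {0..1} (g (x + y)) = integral {0..1} (\<lambda>s. g x s + g y s)" for x y
    by (rule integral_cong) (simp add: g_def clinear_add[OF l] scaleC_add_right)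
  then have add: "integral {0..1} (g (x + y)) = integral {0..1} (g x) + integral {0..1} (g y)" for x y
    by (simp add: integral_add g)
  have "integral {0..1} (g (k *\<^sub>C x)) = integral {0..1} ((\<lambda>v. k *\<^sub>C v) \<circ> g x)" for k x
    by (rule integral_cong) (simp add: g_def clinear_scale[OF l] mult.commute)
  then have scale: "integral {0..1} (g (k *\<^sub>C x)) = k *\<^sub>C integral {0..1} (g x)" for k x
    using integral_linear[OF g bounded_linear_scaleC_right] by metis
  have "riesz_integral D A z0 \<epsilon> = (\<lambda>x. (\<i> / (2 * complex_of_real pi)) *\<^sub>C integral {0..1} (g x))"
    by (simp add: riesz_integral_def[abs_def] g_def[abs_def])
  then show ?thesis
    by (intro clinearI) (simp_all add: add scale scaleC_add_right mult.commute)
qed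

end

lemma bounded_clinear_cinner_left: "bounded_clinear (\<lambda>x. cinner x (y::'a::complex_inner))"
  by (simp add: bounded_clinear_def bounded_linear_cinner_left cinner_scaleC_left scaleC_complex_def)

section \<open>The Riesz projector in the coordinates of the flag\<close>

context maximal_spectral_flag
begin

context
  fixes z0 :: complex and r C :: real
  assumes r: "r > 0" and r_le: "\<And>k. k < n \<Longrightarrow> \<zeta> k \<noteq> z0 \<Longrightarrow> r \<le> dist (\<zeta> k) z0"
    and punctured: "\<And>z. z \<noteq> z0 \<Longrightarrow> dist z z0 < r \<Longrightarrow> z \<in> \<rho> \<and> (\<forall>m\<le>n. \<forall>x\<in>U m. Res z x \<in> U m) \<and>
       (\<forall>k<n. cinner (Res z (f k)) (f k) = 1 / (\<zeta> k - z)) \<and> (\<forall>x. norm (Q (Res z (Q x))) \<le> C * norm x)"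
begin

abbreviation "V \<equiv> ball z0 r - {z0}"
abbreviation "\<kappa> \<equiv> \<i> / (2 * complex_of_real pi)"
abbreviation "P \<equiv> riesz_integral D A z0"

lemma V_open: "open V" by auto

lemma V_rho: "V \<subseteq> \<rho>"
proof
  fix z assume "z \<in> V"
  then have "z \<noteq> z0" "dist z z0 < r" by (auto simp: dist_commute)
  then show "z \<in> \<rho>" using punctured by blast
qed

lemma circle_V: "0 < \<epsilon> \<Longrightarrow> \<epsilon> < r \<Longrightarrow> sphere z0 \<epsilon> \<subseteq> V"
  by auto

lemma P_functional:
  assumes \<epsilon>: "0 < \<epsilon>" "\<epsilon> < r" and \<phi>: "bounded_clinear \<phi>"
  shows "\<phi> (P \<epsilon> x) = \<kappa> * contour_integral (circlepath z0 \<epsilon>) (\<lambda>z. \<phi> (Res z x))"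
  by (rule riesz_integral_functional[OF V_open V_rho circle_V[OF \<epsilon>] \<epsilon>(1) \<phi>])

lemma P_inner:
  assumes \<epsilon>: "0 < \<epsilon>" "\<epsilon> < r"
  shows "cinner (P \<epsilon> x) y = \<kappa> * contour_integral (circlepath z0 \<epsilon>) (\<lambda>z. cinner (Res z x) y)"
  by (rule P_functional[OF \<epsilon> bounded_clinear_cinner_left])

lemma P_radius_le:
  assumes "0 < \<epsilon>1" "\<epsilon>1 \<le> \<epsilon>2" "\<epsilon>2 < r"
  shows "P \<epsilon>1 = P \<epsilon>2"
proof (rule ext, rule cinner_ext)
  fix x y
  have hol: "(\<lambda>z. cinner (Res z x) y) holomorphic_on (ball z0 r - {z0})"
    by (rule Res_holomorphic[OF V_open V_rho bounded_clinear_cinner_left])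
  have "contour_integral (circlepath z0 \<epsilon>2) (\<lambda>z. cinner (Res z x) y)
      = contour_integral (circlepath z0 \<epsilon>1) (\<lambda>z. cinner (Res z x) y)"
    by (rule contour_integral_circlepath_eq(3)[OF open_ball hol]) (use assms in auto)
  then show "cinner (P \<epsilon>1 x) y = cinner (P \<epsilon>2 x) y"
    using assms by (simp add: P_inner)
qed

lemma P_radius:
  assumes "0 < \<epsilon>1" "\<epsilon>1 < r" "0 < \<epsilon>2" "\<epsilon>2 < r"
  shows "P \<epsilon>1 = P \<epsilon>2"
proof (cases "\<epsilon>1 \<le> \<epsilon>2")
  case True
  then show ?thesis using assms by (intro P_radius_le)
next
  case False
  then show ?thesis using assms by (intro P_radius_le[symmetric]) auto
qed

lemma riesz_projector_eq:
  assumes \<epsilon>: "0 < \<epsilon>" "\<epsilon> < r"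
  shows "riesz_projector D A z0 = P \<epsilon>"
  unfolding riesz_projector_def
proof (rule the_equality)
  have ev: "\<forall>\<^sub>F e in at_right 0. P e = P \<epsilon>"
    unfolding eventually_at_right_field
  proof (intro exI[of _ r] conjI allI impI r)
    fix e assume "0 < e" "e < r"
    then show "P e = P \<epsilon>" using \<epsilon> by (rule P_radius)
  qed
  then show "\<forall>\<^sub>F e in at_right 0. P e = P \<epsilon>" .
  fix X assume "\<forall>\<^sub>F e in at_right 0. P e = X"
  with ev have "\<forall>\<^sub>F e in at_right (0::real). X = P \<epsilon>" by eventually_elim simp
  then show "X = P \<epsilon>" by simp
qed

text \<open>Composing two circles of different radii, the resolvent identity and Cauchy's formula give \<open>P\<^sup>2 = P\<close>.\<close>

lemma P_idempotent:
  assumes \<epsilon>: "0 < \<epsilon>" "\<epsilon> < r"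
  shows "P \<epsilon> (P \<epsilon> x) = P \<epsilon> x"
proof -
  \<comment> \<open>Two distinct radii keep \<open>z - w\<close> away from 0, so the integrand is
    jointly continuous and the contour integrals may be exchanged.\<close>
  define e1 where "e1 = r / 3"
  define e2 where "e2 = r / 2"
  have e: "0 < e1" "e1 < e2" "0 < e2" "e2 < r" "e1 < r" using r by (auto simp: e1_def e2_def)
  have "P e2 (P e1 x) = P e1 x"
  proof (rule cinner_ext)
    fix y
    define h where "h z = cinner (Res z x) y" for z
    have h_hol: "h holomorphic_on V"
      unfolding h_def by (rule Res_holomorphic[OF V_open V_rho bounded_clinear_cinner_left])
    have sph1: "sphere z0 e1 \<subseteq> V" and sph2: "sphere z0 e2 \<subseteq> V"
      by (rule circle_V[OF e(1,5)], rule circle_V[OF e(3,4)])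
    have h1: "continuous_on (sphere z0 e1) h"
      by (rule continuous_on_subset[OF holomorphic_on_imp_continuous_on[OF h_hol] sph1])
    have inner: "cinner (Res w (P e1 x)) y = \<kappa> * contour_integral (circlepath z0 e1) (\<lambda>z. h z / (z - w))"
      if w: "w \<in> sphere z0 e2" for w
    proof -
      have wr: "w \<in> \<rho>" using sph2 V_rho w by auto
      have bw: "bounded_clinear (\<lambda>v. cinner (Res w v) y)"
        by (rule bounded_clinear_compose[OF bounded_clinear_cinner_left Res_bounded[OF wr]])
      have zw: "z - w \<noteq> 0" if "z \<in> cball z0 e1" for z
        using that w e(2) by (auto simp: dist_commute)
      \<comment> \<open>As a function of \<open>z\<close> this is holomorphic inside the outer
        circle, on which \<open>w\<close> lies; only the other term of the resolvent identity
        survives.\<close>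
      have 1: "((\<lambda>z. h w / (w - z)) has_contour_integral 0) (circlepath z0 e1)"
      proof (rule Cauchy_theorem_disc_simple[where a = z0 and e = e2])
        show "(\<lambda>z. h w / (w - z)) holomorphic_on ball z0 e2"
          using w by (intro holomorphic_intros) auto
      qed (use e in auto)
      have int: "(\<lambda>z. h z / (z - w)) contour_integrable_on circlepath z0 e1"
      proof (rule contour_integrable_continuous_circlepath)
        have "continuous_on (sphere z0 e1) (\<lambda>z. h z / (z - w))"
          using zw by (intro continuous_intros h1) auto
        then show "continuous_on (path_image (circlepath z0 e1)) (\<lambda>z. h z / (z - w))"
          using e(1) by simp
      qed
      have "cinner (Res w (P e1 x)) y = \<kappa> * contour_integral (circlepath z0 e1) (\<lambda>z. cinner (Res w (Res z x)) y)"
        by (rule P_functional[OF e(1,5) bw])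
      also have "contour_integral (circlepath z0 e1) (\<lambda>z. cinner (Res w (Res z x)) y)
          = contour_integral (circlepath z0 e1) (\<lambda>z. h w / (w - z) + h z / (z - w))"
      proof (rule contour_integral_eq)
        fix z assume "z \<in> path_image (circlepath z0 e1)"
        then have z: "z \<in> sphere z0 e1" using e(1) by simp
        then have zr: "z \<in> \<rho>" using sph1 V_rho by auto
        have zw': "z - w \<noteq> 0" using zw z by auto
        have "h w - h z = (w - z) * cinner (Res w (Res z x)) y"
          using arg_cong[OF resolvent_identity[OF wr zr, of x], of "\<lambda>v. cinner v y"]
          by (simp add: h_def cinner_diff_left cinner_scaleC_left)
        then show "cinner (Res w (Res z x)) y = h w / (w - z) + h z / (z - w)"
        proof -
          have "h z / (z - w) = - (h z / (w - z))" by (metis minus_diff_eq minus_divide_right)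
          then have "h w / (w - z) + h z / (z - w) = (h w - h z) / (w - z)"
            by (simp add: diff_divide_distrib)
          then show ?thesis using zw' \<open>h w - h z = _\<close> by simp
        qed
      qed
      also have "\<dots> = 0 + contour_integral (circlepath z0 e1) (\<lambda>z. h z / (z - w))"
        using contour_integral_add[OF has_contour_integral_integrable[OF 1] int] contour_integral_unique[OF 1] by simp
      finally show ?thesis by simp
    qed
    have "cinner (P e2 (P e1 x)) y = \<kappa> * contour_integral (circlepath z0 e2) (\<lambda>w. cinner (Res w (P e1 x)) y)"
      by (rule P_inner[OF e(3,4)])
    also have "contour_integral (circlepath z0 e2) (\<lambda>w. cinner (Res w (P e1 x)) y)
        = contour_integral (circlepath z0 e2) (\<lambda>w. contour_integral (circlepath z0 e1) (\<lambda>z. \<kappa> * (h z / (z - w))))"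
    proof (rule contour_integral_eq)
      fix w assume "w \<in> path_image (circlepath z0 e2)"
      then have w: "w \<in> sphere z0 e2" using e(3) by simp
      have "continuous_on (path_image (circlepath z0 e1)) (\<lambda>z. h z / (z - w))"
        using e(1,2) w by (auto intro!: continuous_intros h1)
      then have "(\<lambda>z. h z / (z - w)) contour_integrable_on circlepath z0 e1"
        by (rule contour_integrable_continuous_circlepath)
      then show "cinner (Res w (P e1 x)) y = contour_integral (circlepath z0 e1) (\<lambda>z. \<kappa> * (h z / (z - w)))"
        unfolding inner[OF w] by (rule contour_integral_lmul[symmetric])
    qed
    also have "\<dots> = contour_integral (circlepath z0 e1) (\<lambda>z. contour_integral (circlepath z0 e2) (\<lambda>w. \<kappa> * (h z / (z - w))))"
    proof (rule contour_integral_swap)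
      have "continuous_on (sphere z0 e2 \<times> sphere z0 e1) (\<lambda>p. \<kappa> * (h (snd p) / (snd p - fst p)))"
      proof (intro continuous_intros)
        show "continuous_on (sphere z0 e2 \<times> sphere z0 e1) (\<lambda>p. h (snd p))"
          by (rule continuous_on_compose2[OF h1]) (auto intro: continuous_intros)
      qed (use e(2) in auto)
      then show "continuous_on (path_image (circlepath z0 e2) \<times> path_image (circlepath z0 e1))
          (\<lambda>(w, z). \<kappa> * (h z / (z - w)))"
        using e(1,3) by (simp add: case_prod_unfold)
    qed (auto simp: vector_derivative_circlepath intro!: continuous_intros)
    also have "\<dots> = contour_integral (circlepath z0 e1) h"
    proof (rule contour_integral_eq)
      fix z assume "z \<in> path_image (circlepath z0 e1)"
      then have z: "z \<in> sphere z0 e1" using e(1) by simp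
      \<comment> \<open>Cauchy's formula in \<open>w\<close>, with \<open>z\<close> inside the outer
        circle; the factor is 1 because \<kappa> is i / (2 pi).\<close>
      have "((\<lambda>w. (- \<kappa> * h z) / (w - z)) has_contour_integral (2 * of_real pi * \<i> * (- \<kappa> * h z))) (circlepath z0 e2)"
        by (rule Cauchy_integral_circlepath_simple) (use z e(2) in \<open>auto simp: dist_norm norm_minus_commute\<close>)
      moreover have "(- \<kappa> * h z) / (w - z) = \<kappa> * (h z / (z - w))" for w
        by (metis minus_diff_eq minus_divide_divide minus_minus mult_minus_left times_divide_eq_right)
      moreover have "2 * of_real pi * \<i> * (- \<kappa> * h z) = h z" by (simp add: field_simps)
      ultimately have "((\<lambda>w. \<kappa> * (h z / (z - w))) has_contour_integral h z) (circlepath z0 e2)"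
        by simp
      then show "contour_integral (circlepath z0 e2) (\<lambda>w. \<kappa> * (h z / (z - w))) = h z"
        by (rule contour_integral_unique)
    qed
    also have "\<kappa> * contour_integral (circlepath z0 e1) h = cinner (P e1 x) y"
      using P_inner[OF e(1,5), of x y] by (simp add: h_def[abs_def])
    finally show "cinner (P e2 (P e1 x)) y = cinner (P e1 x) y" .
  qed
  moreover have "P e1 = P \<epsilon>" "P e2 = P \<epsilon>" using P_radius e \<epsilon> by blast+
  ultimately show ?thesis by simp
qed

lemma P_U:
  assumes \<epsilon>: "0 < \<epsilon>" "\<epsilon> < r" and m: "m \<le> n" and x: "x \<in> U m"
  shows "P \<epsilon> x \<in> U m"
proof -
  have "P \<epsilon> x = proj f {..<m} (P \<epsilon> x)"
  proof (rule cinner_ext)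
    fix y
    have "cinner (P \<epsilon> x) (y - proj f {..<m} y) = \<kappa> * contour_integral (circlepath z0 \<epsilon>) (\<lambda>z. cinner (Res z x) (y - proj f {..<m} y))"
      by (rule P_inner[OF \<epsilon>])
    also have "contour_integral (circlepath z0 \<epsilon>) (\<lambda>z. cinner (Res z x) (y - proj f {..<m} y)) = 0"
    proof (rule contour_integral_eq_0)
      fix z assume "z \<in> path_image (circlepath z0 \<epsilon>)"
      then have "z \<noteq> z0" "dist z z0 < r" using \<epsilon> by (auto simp: dist_commute)
      then have "Res z x \<in> U m" using punctured m x by blast
      then have "cinner (Res z x) y = cinner (proj f {..<m} (Res z x)) y" by (simp add: U_proj[OF m])
      then show "cinner (Res z x) (y - proj f {..<m} y) = 0"
        by (simp add: cinner_diff_right cinner_proj_left_right)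
    qed
    finally show "cinner (P \<epsilon> x) y = cinner (proj f {..<m} (P \<epsilon> x)) y"
      by (simp add: cinner_diff_right cinner_proj_left_right)
  qed
  then show ?thesis using proj_in_span[of f "{..<m}" "P \<epsilon> x"] by simp
qed

text \<open>The complement block of the resolvent is bounded near z0, so its singularity is
  removable and its circle integral vanishes. Since \<open>P \<epsilon>\<close> preserves
  \<open>U n\<close>, nothing of its range is left outside \<open>U n\<close>.\<close>

lemma P_range:
  assumes \<epsilon>: "0 < \<epsilon>" "\<epsilon> < r"
  shows "P \<epsilon> x \<in> U n"
proof -
  have "cinner (P \<epsilon> (Q x)) (Q y) = 0" for y
  proof -
    define h where "h z = cinner (Res z (Q x)) (Q y)" for z
    have h_hol: "h holomorphic_on ball z0 r - {z0}"
      unfolding h_def by (rule Res_holomorphic[OF V_open V_rho bounded_clinear_cinner_left])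
    have bound: "norm (h z) \<le> C * norm x * norm y" if "z \<noteq> z0" "dist z z0 < r" for z
    proof -
      have "h z = cinner (Q (Res z (Q x))) y"
        by (simp add: h_def cinner_diff_left cinner_diff_right cinner_proj_left_right)
      then have "norm (h z) \<le> norm (Q (Res z (Q x))) * norm y" by (simp only: cinner_bound)
      also have "\<dots> \<le> (C * norm x) * norm y" using punctured[OF that] by (intro mult_right_mono) auto
      finally show ?thesis .
    qed
    have "\<forall>\<^sub>F z in at z0. norm (h z) \<le> C * norm x * norm y"
      unfolding eventually_at using r bound by (intro exI[of _ r]) auto
    then have "\<exists>H. H holomorphic_on ball z0 r \<and> (\<forall>z\<in>ball z0 r - {z0}. H z = h z)"
      using holomorphic_on_extend_bounded[OF h_hol] r by (auto simp: interior_open)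
    then obtain H where H: "H holomorphic_on ball z0 r" "\<And>z. z \<in> ball z0 r - {z0} \<Longrightarrow> H z = h z" by blast
    have "(H has_contour_integral 0) (circlepath z0 \<epsilon>)"
      by (rule Cauchy_theorem_disc_simple[OF H(1)]) (use \<epsilon> in auto)
    then have "contour_integral (circlepath z0 \<epsilon>) H = 0" by (rule contour_integral_unique)
    moreover have "contour_integral (circlepath z0 \<epsilon>) h = contour_integral (circlepath z0 \<epsilon>) H"
      by (rule contour_integral_eq) (use \<epsilon> H(2) in auto)
    ultimately show ?thesis using P_inner[OF \<epsilon>, of "Q x" "Q y"] by (simp add: h_def[abs_def])
  qed
  then have "cinner (Q (P \<epsilon> (Q x))) y = 0" for y
    by (simp add: cinner_diff_left cinner_diff_right cinner_proj_left_right)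
  then have "Q (P \<epsilon> (Q x)) = 0" using cinner_eq_zero_iff by blast
  then have "P \<epsilon> (Q x) \<in> U n" using proj_in_span[of f "{..<n}" "P \<epsilon> (Q x)"] by simp
  moreover have "P \<epsilon> (proj f {..<n} x) \<in> U n" by (rule P_U[OF \<epsilon> order_refl proj_in_span])
  moreover have "P \<epsilon> x = P \<epsilon> (Q x) + P \<epsilon> (proj f {..<n} x)"
    using clinear_diff[OF clinear_riesz_integral[OF V_open V_rho circle_V[OF \<epsilon>] \<epsilon>(1)]] by simp
  ultimately show ?thesis by (simp add: complex_vector.span_add)
qed

text \<open>The diagonal entry of the resolvent has a simple pole at \<zeta> k: it contributes its
  residue if \<zeta> k = z0, and otherwise lies outside the circle by the choice of
  \<open>r\<close>.\<close>

lemma P_diag: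
  assumes \<epsilon>: "0 < \<epsilon>" "\<epsilon> < r" and k: "k < n"
  shows "cinner (P \<epsilon> (f k)) (f k) = (if k \<in> {k. \<zeta> k = z0} then 1 else 0)"
proof -
  have "contour_integral (circlepath z0 \<epsilon>) (\<lambda>z. cinner (Res z (f k)) (f k))
      = contour_integral (circlepath z0 \<epsilon>) (\<lambda>z. (- 1) * (1 / (z - \<zeta> k)))"
  proof (rule contour_integral_eq)
    fix z assume "z \<in> path_image (circlepath z0 \<epsilon>)"
    then have "z \<noteq> z0" "dist z z0 < r" using \<epsilon> by (auto simp: dist_commute)
    then have "cinner (Res z (f k)) (f k) = 1 / (\<zeta> k - z)" using punctured k by blast
    also have "\<dots> = (- 1) * (1 / (z - \<zeta> k))" by (metis minus_diff_eq minus_divide_right mult_minus1)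
    finally show "cinner (Res z (f k)) (f k) = (- 1) * (1 / (z - \<zeta> k))" .
  qed
  also have "\<dots> = (if \<zeta> k = z0 then - (2 * of_real pi * \<i>) else 0)"
  proof (cases "\<zeta> k = z0")
    case True
    have "((\<lambda>z. (- 1) / (z - z0)) has_contour_integral (2 * of_real pi * \<i> * (- 1))) (circlepath z0 \<epsilon>)"
      by (rule Cauchy_integral_circlepath_simple) (use \<epsilon> in auto)
    then show ?thesis using True contour_integral_unique by fastforce
  next
    case False
    have "((\<lambda>z. (- 1) * (1 / (z - \<zeta> k))) has_contour_integral 0) (circlepath z0 \<epsilon>)"
    proof (rule Cauchy_theorem_disc_simple[where a = z0 and e = r])
      show "(\<lambda>z. (- 1) * (1 / (z - \<zeta> k))) holomorphic_on ball z0 r"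
        using r_le[OF k False] by (intro holomorphic_intros) (auto simp: dist_commute)
    qed (use \<epsilon> in auto)
    then show ?thesis using False contour_integral_unique by auto
  qed
  finally show ?thesis
    using P_inner[OF \<epsilon>, of "f k" "f k"] by (auto simp: field_simps)
qed

lemma alg_mult_punctured: "alg_mult D A z0 = enat (card {k \<in> {k. \<zeta> k = z0}. k < n})"
proof -
  define \<epsilon> where "\<epsilon> = r / 2"
  have \<epsilon>: "0 < \<epsilon>" "\<epsilon> < r" using r by (auto simp: \<epsilon>_def)
  have lP: "clinear (P \<epsilon>)"
    by (rule clinear_riesz_integral[OF V_open V_rho circle_V[OF \<epsilon>] \<epsilon>(1)])
  have "flag {P \<epsilon>} f n"
    unfolding flag_def
  proof (intro conjI ballI allI impI)
    show "orthonormal {..<n} f" by (rule flag_orthonormal[OF flagT])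
    fix S j assume S: "S \<in> {P \<epsilon>}" and j: "j < n"
    have "P \<epsilon> (f j) \<in> U (Suc j)" using j by (intro P_U[OF \<epsilon>] f_U) auto
    then have "proj f {..<Suc j} (P \<epsilon> (f j)) = P \<epsilon> (f j)" using j by (intro U_proj) auto
    then show "proj f {..j} (S (f j)) = S (f j)" using S by (simp add: lessThan_Suc_atMost)
  qed
  then have "op_rank (P \<epsilon>) = enat (card {k \<in> {k. \<zeta> k = z0}. k < n})"
    using P_diag[OF \<epsilon>] P_range[OF \<epsilon>] P_idempotent[OF \<epsilon>]
    by (intro op_rank_idempotent[OF lP]) auto
  then show ?thesis by (simp add: alg_mult_def riesz_projector_eq[OF \<epsilon>])
qed

end

lemma alg_mult_eq:
  assumes "Re z0 \<le> \<Lambda>"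
  shows "alg_mult D A z0 = enat (card {k. k < n \<and> \<zeta> k = z0})"
proof -
  obtain r C where "r > 0" "\<And>k. k < n \<Longrightarrow> \<zeta> k \<noteq> z0 \<Longrightarrow> r \<le> dist (\<zeta> k) z0"
    "\<And>z. z \<noteq> z0 \<Longrightarrow> dist z z0 < r \<Longrightarrow> z \<in> \<rho> \<and> (\<forall>m\<le>n. \<forall>x\<in>U m. Res z x \<in> U m) \<and>
       (\<forall>k<n. cinner (Res z (f k)) (f k) = 1 / (\<zeta> k - z)) \<and> (\<forall>x. norm (Q (Res z (Q x))) \<le> C * norm x)"
    using punctured_resolvent[OF assms] by blast
  then have "alg_mult D A z0 = enat (card {k \<in> {k. \<zeta> k = z0}. k < n})"
    by (rule alg_mult_punctured)
  then show ?thesis by (simp add: conj_commute)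
qed

text \<open>Points of the spectrum that are not flag values have multiplicity 0, so the infinite sum
  collapses to the values of \<zeta>, each counted as often as it occurs.\<close>

theorem counting_function_eq: "counting_function D A \<Lambda> = ennreal (real n)"
proof -
  define S where "S = {z \<in> op_spectrum D A. Re z \<le> \<Lambda>}"
  have sub: "\<zeta> ` {..<n} \<subseteq> S"
    using flag_values_in_spectrum spectral_flag_Re[OF fl] by (auto simp: S_def)
  have am: "ennreal_of_enat (alg_mult D A z) = of_nat (card {k \<in> {..<n}. \<zeta> k = z})" if "z \<in> S" for z
    using that alg_mult_eq[of z] by (simp add: S_def ennreal_of_enat_enat conj_commute lessThan_def)
  have "counting_function D A \<Lambda> = (\<Sum>\<^sub>\<infinity>z\<in>\<zeta> ` {..<n}. of_nat (card {k \<in> {..<n}. \<zeta> k = z}))"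
    unfolding counting_function_def S_def[symmetric]
  proof (rule infsum_cong_neutral)
    fix z assume z: "z \<in> S - \<zeta> ` {..<n}"
    then have "{k \<in> {..<n}. \<zeta> k = z} = {}" by auto
    then show "ennreal_of_enat (alg_mult D A z) = 0" using am[of z] z by simp
  qed (use sub am in auto)
  also have "\<dots> = (\<Sum>z\<in>\<zeta> ` {..<n}. of_nat (card {k \<in> {..<n}. \<zeta> k = z}))" by simp
  also have "\<dots> = of_nat (\<Sum>z\<in>\<zeta> ` {..<n}. card {k \<in> {..<n}. \<zeta> k = z})" by simp
  also have "(\<Sum>z\<in>\<zeta> ` {..<n}. card {k \<in> {..<n}. \<zeta> k = z}) = n"
    using sum.image_gen[of "{..<n}" "\<lambda>_. 1::nat" \<zeta>] by simp
  finally show ?thesis by (simp add: ennreal_of_nat_eq_real_of_nat)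
qed

end

section \<open>Eigenvalue asymptotics\<close>

text \<open>The same \<open>n\<close> serves all \<tau>, which lets \<tau> be tuned to \<Lambda>
  afterwards.\<close>

lemma (in generated_semigroup) counting_function_bounds:
  assumes sep: "separable_type TYPE('a)" and tc: "\<And>t. t > 0 \<Longrightarrow> trace_class (T t)"
  defines "tr \<tau> \<equiv> enn2real (trace_norm (T \<tau>))"
  defines "W \<equiv> max 1 (onorm (T 1))"
  obtains n where "counting_function D A \<Lambda> = ennreal n"
    "\<And>\<tau>. \<tau> > 0 \<Longrightarrow> n \<le> exp (\<tau> * \<Lambda>) * tr \<tau>"
    "\<And>\<tau>. \<tau> > 0 \<Longrightarrow> 2 * \<tau> \<le> 1 \<Longrightarrow> cmod (op_trace (T (2 * \<tau>))) \<le> n * W + exp (- (\<tau> * \<Lambda>)) * tr \<tau>"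
proof -
  have nuc: "\<exists>a b. nuclear_rep (T \<tau>) a b (tr \<tau>)" if "\<tau> > 0" for \<tau>
    using trace_class_nuclear_rep[OF sep tc[OF that]] unfolding tr_def by metis
  obtain a b where K: "nuclear_rep (T 1) a b (tr 1)" using nuc[of 1] by auto
  obtain f \<zeta> n where fl: "spectral_flag \<Lambda> f \<zeta> n" and max: "\<And>f' \<zeta>'. \<not> spectral_flag \<Lambda> f' \<zeta>' (Suc n)"
    by (rule maximal_spectral_flag_exists[OF K, of \<Lambda>], rule that)
  interpret maximal_spectral_flag D A T \<Lambda> f \<zeta> n a b "tr 1"
    by unfold_locales (rule K, rule fl, rule max)
  show ?thesis
  proof (rule that[of "real n"])
    show "counting_function D A \<Lambda> = ennreal (real n)" by (rule counting_function_eq)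
    fix \<tau> :: real assume \<tau>: "\<tau> > 0"
    obtain a' b' where K': "nuclear_rep (T \<tau>) a' b' (tr \<tau>)" using nuc[OF \<tau>] by blast
    show "real n \<le> exp (\<tau> * \<Lambda>) * tr \<tau>" by (rule spectral_flag_card[OF fl \<tau> K'])
    assume \<tau>1: "2 * \<tau> \<le> 1"
    have T2: "T (2 * \<tau>) = (\<lambda>x. T \<tau> (T \<tau> x))"
    proof
      fix x
      have "T (\<tau> + \<tau>) x = T \<tau> (T \<tau> x)" using \<tau> by (intro T_add) auto
      then show "T (2 * \<tau>) x = T \<tau> (T \<tau> x)" unfolding mult_2 .
    qed
    have "cmod (op_trace (T (2 * \<tau>))) \<le> (\<Sum>k<n. (cmod (cinner (T \<tau> (f k)) (f k)))\<^sup>2) + exp (- (\<tau> * \<Lambda>)) * tr \<tau>"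
      unfolding T2
    proof (rule trace_square_bound[OF sep K'])
      show "flag {T \<tau>} f n" using flagT \<tau> by (auto simp: flag_def)
      show "x = 0" if "exp (- (\<tau> * \<Lambda>)) \<le> cmod z" "T \<tau> x - proj f {..<n} (T \<tau> x) = z *\<^sub>C x" for z x
        by (rule maximal_spectral_flag_no_eigenvalue[OF fl max \<tau> K' that])
    qed simp
    also have "(\<Sum>k<n. (cmod (cinner (T \<tau> (f k)) (f k)))\<^sup>2) \<le> (\<Sum>k<n. W)"
    proof (rule sum_mono)
      fix k assume "k \<in> {..<n}"
      then have k: "k < n" by simp
      have "exp (- Re (\<zeta> k)) \<le> W"
        using spectral_flag_Re_lower[OF fl k] by (simp add: W_def)
      then have le: "- Re (\<zeta> k) \<le> ln W" by (metis ln_exp ln_le_cancel_iff exp_gt_zero less_le_trans)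
      \<comment> \<open>The maximum with 1 in \<open>W\<close> is there for this: the exponent 2 *
        \<tau> may then be replaced by its upper bound 1.\<close>
      have lnW: "ln W \<ge> 0" by (simp add: W_def)
      have "(cmod (cinner (T \<tau> (f k)) (f k)))\<^sup>2 = exp (2 * \<tau> * (- Re (\<zeta> k)))"
        using spectral_flag_diag[OF fl k, of \<tau>] \<tau> by (simp add: exp_double[symmetric] mult.assoc)
      also have "2 * \<tau> * (- Re (\<zeta> k)) \<le> 2 * \<tau> * ln W" using \<tau> le by (intro mult_left_mono) auto
      also have "\<dots> \<le> 1 * ln W" using \<tau>1 lnW by (intro mult_right_mono) auto
      finally show "(cmod (cinner (T \<tau> (f k)) (f k)))\<^sup>2 \<le> W" by (simp add: W_def)
    qed
    also have "(\<Sum>k<n. W) = real n * W" by simp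
    finally show "cmod (op_trace (T (2 * \<tau>))) \<le> real n * W + exp (- (\<tau> * \<Lambda>)) * tr \<tau>" by simp
  qed
qed

lemma powr_minus_quotient: "0 < u \<Longrightarrow> 0 < v \<Longrightarrow> (u / v :: real) powr (- e) = u powr (- e) * v powr e"
  by (subst powr_divide) (simp_all add: powr_minus[of v] divide_inverse)

theorem corollary5p23:
  fixes D :: "'h::complex_hilbert set"
    and A :: "'h \<Rightarrow> 'h"
    and T :: "real \<Rightarrow> 'h \<Rightarrow> 'h"
    and \<alpha> \<beta> C\<^sub>\<alpha> C\<^sub>\<beta> t\<^sub>0 :: real
  assumes separable: "separable_space (euclidean :: 'h topology)"
    and subsectorial: "subsectorial D A"
    and semigroup: "exp_semigroup D A T"
    and trace_class: "\<And>t. t > 0 \<Longrightarrow> trace_class (T t)"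
    and pos: "\<alpha> > 0" "\<beta> > 0" "C\<^sub>\<alpha> > 0" "C\<^sub>\<beta> > 0" "t\<^sub>0 > 0"
    and trace_lower: "\<And>t. 0 < t \<Longrightarrow> t < t\<^sub>0 \<Longrightarrow> C\<^sub>\<alpha> * t powr (- \<alpha>) \<le> cmod (op_trace (T t))"
    and trace_upper: "\<And>t. 0 < t \<Longrightarrow> t < t\<^sub>0 \<Longrightarrow> trace_norm (T t) \<le> ennreal (C\<^sub>\<beta> * t powr (- \<beta>))"
  shows "(\<exists>C x\<^sub>0. C > 0 \<and> x\<^sub>0 > 0 \<and>
            (\<forall>x\<ge>x\<^sub>0. ennreal (C * (x / ln x) powr \<alpha>) \<le> counting_function D A x \<and>
                     counting_function D A x \<le> ennreal (exp 1 * C\<^sub>\<beta> * x powr \<beta>))) \<and>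
         (\<beta> = \<alpha> \<longrightarrow>
          (\<exists>C x\<^sub>0. C > 0 \<and> x\<^sub>0 > 0 \<and>
            (\<forall>x\<ge>x\<^sub>0. ennreal (C * x powr \<alpha>) \<le> counting_function D A x \<and>
                     counting_function D A x \<le> ennreal (exp 1 * C\<^sub>\<beta> * x powr \<beta>))))"
proof -
  have "linear_operator D A"
    using subsectorial by (auto simp: subsectorial_def subsectorial_of_order_def)
  then interpret generated_semigroup D A T
    using semigroup by unfold_locales
  define W where "W = max 1 (onorm (T 1))"
  have W: "W \<ge> 1" by (simp add: W_def)
  have main: "\<exists>N. counting_function D A x = ennreal N \<and>
      (\<forall>\<tau>. 0 < \<tau> \<and> \<tau> < t\<^sub>0 \<longrightarrow> N \<le> exp (\<tau> * x) * (C\<^sub>\<beta> * \<tau> powr (- \<beta>))) \<and>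
      (\<forall>\<tau>. 0 < \<tau> \<and> 2 * \<tau> < t\<^sub>0 \<and> 2 * \<tau> \<le> 1 \<longrightarrow>
        C\<^sub>\<alpha> * (2 * \<tau>) powr (- \<alpha>) \<le> N * W + exp (- (\<tau> * x)) * (C\<^sub>\<beta> * \<tau> powr (- \<beta>)))" for x
  proof -
    obtain N where N: "counting_function D A x = ennreal N"
      "\<And>\<tau>. \<tau> > 0 \<Longrightarrow> N \<le> exp (\<tau> * x) * enn2real (trace_norm (T \<tau>))"
      "\<And>\<tau>. \<tau> > 0 \<Longrightarrow> 2 * \<tau> \<le> 1 \<Longrightarrow>
         cmod (op_trace (T (2 * \<tau>))) \<le> N * W + exp (- (\<tau> * x)) * enn2real (trace_norm (T \<tau>))"
      using counting_function_bounds[OF separable trace_class, of x] unfolding W_def by blast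
    have tr: "enn2real (trace_norm (T \<tau>)) \<le> C\<^sub>\<beta> * \<tau> powr (- \<beta>)" if "0 < \<tau>" "\<tau> < t\<^sub>0" for \<tau>
      using trace_upper[OF that] pos by (intro enn2real_leI) auto
    show ?thesis
    proof (intro exI[of _ N] conjI allI impI N(1))
      fix \<tau> assume \<tau>: "0 < \<tau> \<and> \<tau> < t\<^sub>0"
      have "N \<le> exp (\<tau> * x) * enn2real (trace_norm (T \<tau>))" using N(2) \<tau> by blast
      also have "\<dots> \<le> exp (\<tau> * x) * (C\<^sub>\<beta> * \<tau> powr (- \<beta>))"
        using \<tau> by (intro mult_left_mono tr) auto
      finally show "N \<le> exp (\<tau> * x) * (C\<^sub>\<beta> * \<tau> powr (- \<beta>))" .
    next
      fix \<tau> assume \<tau>: "0 < \<tau> \<and> 2 * \<tau> < t\<^sub>0 \<and> 2 * \<tau> \<le> 1"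
      then have "exp (- (\<tau> * x)) * enn2real (trace_norm (T \<tau>)) \<le> exp (- (\<tau> * x)) * (C\<^sub>\<beta> * \<tau> powr (- \<beta>))"
        by (intro mult_left_mono tr) auto
      then show "C\<^sub>\<alpha> * (2 * \<tau>) powr (- \<alpha>) \<le> N * W + exp (- (\<tau> * x)) * (C\<^sub>\<beta> * \<tau> powr (- \<beta>))"
        using N(3)[of \<tau>] trace_lower[of "2 * \<tau>"] \<tau> by linarith
    qed
  qed
  have upper: "counting_function D A x \<le> ennreal (exp 1 * C\<^sub>\<beta> * x powr \<beta>)" if x: "x > 0" "1 / x < t\<^sub>0" for x
  proof -
    obtain N where N: "counting_function D A x = ennreal N"
      "\<And>\<tau>. 0 < \<tau> \<Longrightarrow> \<tau> < t\<^sub>0 \<Longrightarrow> N \<le> exp (\<tau> * x) * (C\<^sub>\<beta> * \<tau> powr (- \<beta>))"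
      using main[of x] by blast
    have "N \<le> exp (1 / x * x) * (C\<^sub>\<beta> * (1 / x) powr (- \<beta>))"
      using x by (intro N(2)) auto
    also have "\<dots> = exp 1 * C\<^sub>\<beta> * x powr \<beta>"
      using x by (simp add: powr_minus powr_divide)
    finally show ?thesis unfolding N(1) by (intro ennreal_leI)
  qed
  have x_large: "\<forall>\<^sub>F x in at_top. x > 0 \<and> 1 / x < t\<^sub>0"
  proof (intro eventually_conj eventually_gt_at_top)
    have "((\<lambda>x::real. 1 / x) \<longlongrightarrow> 0) at_top" by real_asymp
    then show "\<forall>\<^sub>F x in at_top. 1 / x < t\<^sub>0" using pos(5) by (rule order_tendstoD(2))
  qed
  \<comment> \<open>Both lower bounds follow from one pattern: choose \<tau> depending on
    \<open>x\<close> so that the error term uses up at most part of the main term. The constant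
    \<open>k\<close> is divided by \<open>W\<close> at the end.\<close>
  have finish: "\<exists>C x\<^sub>0. C > 0 \<and> x\<^sub>0 > 0 \<and> (\<forall>x\<ge>x\<^sub>0. ennreal (C * g x) \<le> counting_function D A x \<and>
                     counting_function D A x \<le> ennreal (exp 1 * C\<^sub>\<beta> * x powr \<beta>))"
    if k: "k > 0" and ev: "\<forall>\<^sub>F x in at_top. \<exists>\<tau>. 0 < \<tau> \<and> 2 * \<tau> < t\<^sub>0 \<and> 2 * \<tau> \<le> 1 \<and>
         k * g x \<le> C\<^sub>\<alpha> * (2 * \<tau>) powr (- \<alpha>) - exp (- (\<tau> * x)) * (C\<^sub>\<beta> * \<tau> powr (- \<beta>))"
    for k :: real and g :: "real \<Rightarrow> real"
  proof -
    have "\<forall>\<^sub>F x in at_top. ennreal (k / W * g x) \<le> counting_function D A x \<and>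
                     counting_function D A x \<le> ennreal (exp 1 * C\<^sub>\<beta> * x powr \<beta>)"
      using ev x_large
    proof eventually_elim
      case (elim x)
      obtain N where N: "counting_function D A x = ennreal N"
        "\<And>\<tau>. 0 < \<tau> \<Longrightarrow> 2 * \<tau> < t\<^sub>0 \<Longrightarrow> 2 * \<tau> \<le> 1 \<Longrightarrow>
        C\<^sub>\<alpha> * (2 * \<tau>) powr (- \<alpha>) \<le> N * W + exp (- (\<tau> * x)) * (C\<^sub>\<beta> * \<tau> powr (- \<beta>))"
        using main[of x] by blast
      obtain \<tau> where \<tau>: "0 < \<tau>" "2 * \<tau> < t\<^sub>0" "2 * \<tau> \<le> 1"
         "k * g x \<le> C\<^sub>\<alpha> * (2 * \<tau>) powr (- \<alpha>) - exp (- (\<tau> * x)) * (C\<^sub>\<beta> * \<tau> powr (- \<beta>))"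
        using elim(1) by blast
      have "k * g x \<le> N * W" using N(2)[OF \<tau>(1-3)] \<tau>(4) by linarith
      then have "k / W * g x \<le> N" using W by (simp add: field_simps)
      then have "ennreal (k / W * g x) \<le> counting_function D A x" unfolding N(1) by (rule ennreal_leI)
      then show ?case using upper elim(2) by simp
    qed
    then obtain X where X: "\<And>x. x \<ge> X \<Longrightarrow> ennreal (k / W * g x) \<le> counting_function D A x \<and>
                     counting_function D A x \<le> ennreal (exp 1 * C\<^sub>\<beta> * x powr \<beta>)"
      unfolding eventually_at_top_linorder by blast
    have "k / W > 0" using k W by simp
    then show ?thesis using X by (intro exI[of _ "k / W"] exI[of _ "max X 1"]) auto
  qed
  show ?thesis
  proof (intro conjI impI)
    \<comment> \<open>With \<tau> = p * ln x / x the exponential factor is x^(-p), which beats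
      \<tau>^(-\<beta>), at most a constant times x^\<beta>, by a factor 1 / x. The main term is
      then 2 * k * (x / ln x)^\<alpha>, and half of it is kept.\<close>
    define p where "p = \<beta> + 1"
    define k where "k = C\<^sub>\<alpha> * (2 * p) powr (- \<alpha>) / 2"
    have p: "p > 0" using pos by (simp add: p_def)
    have k: "k > 0" using pos p by (simp add: k_def)
    show "\<exists>C x\<^sub>0. C > 0 \<and> x\<^sub>0 > 0 \<and>
            (\<forall>x\<ge>x\<^sub>0. ennreal (C * (x / ln x) powr \<alpha>) \<le> counting_function D A x \<and>
                     counting_function D A x \<le> ennreal (exp 1 * C\<^sub>\<beta> * x powr \<beta>))"
    proof (rule finish[OF k])
      have lim: "((\<lambda>x::real. 2 * (p * ln x / x)) \<longlongrightarrow> 0) at_top" by real_asymp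
      have ev1: "\<forall>\<^sub>F x in at_top. 2 * (p * ln x / x) < t\<^sub>0"
        by (rule order_tendstoD(2)[OF lim pos(5)])
      have ev2: "\<forall>\<^sub>F x in at_top. 2 * (p * ln x / x) < 1"
        by (rule order_tendstoD(2)[OF lim]) simp
      have "((\<lambda>x::real. C\<^sub>\<beta> * p powr (- \<beta>) / x) \<longlongrightarrow> 0) at_top" by real_asymp
      then have ev3: "\<forall>\<^sub>F x in at_top. C\<^sub>\<beta> * p powr (- \<beta>) / x < k"
        using k by (rule order_tendstoD(2))
      show "\<forall>\<^sub>F x in at_top. \<exists>\<tau>. 0 < \<tau> \<and> 2 * \<tau> < t\<^sub>0 \<and> 2 * \<tau> \<le> 1 \<and>
         k * (x / ln x) powr \<alpha> \<le> C\<^sub>\<alpha> * (2 * \<tau>) powr (- \<alpha>) - exp (- (\<tau> * x)) * (C\<^sub>\<beta> * \<tau> powr (- \<beta>))"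
        using ev1 ev2 ev3 eventually_gt_at_top[of "exp 1"]
      proof eventually_elim
        case (elim x)
        have x0: "x > 0" using elim(4) exp_gt_zero[of 1] by linarith
        have lnx: "ln x > 1" using elim(4) x0 by (metis ln_exp ln_less_cancel_iff exp_gt_zero)
        define \<tau> where "\<tau> = p * ln x / x"
        have "p * ln x > 0" using p lnx by (intro mult_pos_pos) linarith+
        then have \<tau>: "\<tau> > 0" "\<tau> * x = p * ln x" using x0 by (simp_all add: \<tau>_def)
        have lnx0: "ln x > 0" using lnx by linarith
        define q where "q = x / ln x"
        have q: "q > 0" "\<tau> = p / q" using x0 lnx0 by (simp_all add: q_def \<tau>_def)
        have "ln x \<le> x" using ln_le_minus_one[OF x0] by linarith
        then have q1: "q \<ge> 1" using lnx0 by (simp add: q_def)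
        have main_term: "C\<^sub>\<alpha> * (2 * \<tau>) powr (- \<alpha>) = 2 * k * q powr \<alpha>"
        proof -
          have "(2 * \<tau>) powr (- \<alpha>) = (2 * p / q) powr (- \<alpha>)" by (simp add: q(2))
          also have "\<dots> = (2 * p) powr (- \<alpha>) * q powr \<alpha>"
            using p q(1) by (intro powr_minus_quotient) auto
          finally show ?thesis by (simp add: k_def)
        qed
        have "exp (- (\<tau> * x)) * (C\<^sub>\<beta> * \<tau> powr (- \<beta>)) \<le> C\<^sub>\<beta> * p powr (- \<beta>) / x"
        proof -
          have "exp (- (\<tau> * x)) = x powr (- p)" using x0 by (simp add: powr_def \<tau>(2))
          moreover have "\<tau> powr (- \<beta>) = p powr (- \<beta>) * q powr \<beta>"
            unfolding q(2) using p q(1) by (rule powr_minus_quotient)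
          moreover have "q powr \<beta> \<le> x powr \<beta>"
          proof (intro powr_mono2)
            have "x * 1 \<le> x * ln x" using x0 lnx by (intro mult_left_mono) auto
            then show "q \<le> x" using lnx0 by (simp add: q_def pos_divide_le_eq)
          qed (use q(1) pos(2) in auto)
          moreover have "x powr (- p) * x powr \<beta> = 1 / x"
            using x0 by (simp add: p_def powr_add[symmetric] powr_minus_divide)
          ultimately have "exp (- (\<tau> * x)) * (C\<^sub>\<beta> * \<tau> powr (- \<beta>)) = (C\<^sub>\<beta> * p powr (- \<beta>)) * (x powr (- p) * q powr \<beta>)"
            by simp
          also have "\<dots> \<le> (C\<^sub>\<beta> * p powr (- \<beta>)) * (x powr (- p) * x powr \<beta>)"
            using pos(4) \<open>q powr \<beta> \<le> x powr \<beta>\<close> by (intro mult_left_mono) auto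
          also have "\<dots> = C\<^sub>\<beta> * p powr (- \<beta>) / x" by (simp add: \<open>x powr (- p) * x powr \<beta> = 1 / x\<close>)
          finally show ?thesis .
        qed
        also have "\<dots> \<le> k * 1" using elim(3) by simp
        also have "\<dots> \<le> k * q powr \<alpha>" using k q1 pos(1) by (intro mult_left_mono ge_one_powr_ge_zero) auto
        finally have "k * q powr \<alpha> \<le> C\<^sub>\<alpha> * (2 * \<tau>) powr (- \<alpha>) - exp (- (\<tau> * x)) * (C\<^sub>\<beta> * \<tau> powr (- \<beta>))"
          unfolding main_term by linarith
        then show ?case
          using \<tau>(1) elim(1,2) unfolding q_def \<tau>_def[symmetric] by (intro exI[of _ \<tau>]) auto
      qed
    qed
  next
    assume ba: "\<beta> = \<alpha>"
    \<comment> \<open>When \<beta> = \<alpha>, main and error term scale alike in \<tau>, so \<tau>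
      = \<kappa> / x is enough. This \<kappa> makes exp (- \<kappa>) *
      \<open>C\<^sub>\<beta>\<close> at most half of
      \<open>C\<^sub>\<alpha> * 2 powr (- \<alpha>)\<close>; the maximum with 1 keeps it
      positive.\<close>
    define \<kappa> where "\<kappa> = max 1 (ln (2 * 2 powr \<alpha> * C\<^sub>\<beta> / C\<^sub>\<alpha>))"
    define k where "k = C\<^sub>\<alpha> * 2 powr (- \<alpha>) * \<kappa> powr (- \<alpha>) / 2"
    have \<kappa>: "\<kappa> \<ge> 1" by (simp add: \<kappa>_def)
    have k: "k > 0" using pos \<kappa> by (simp add: k_def)
    have small: "exp (- \<kappa>) * C\<^sub>\<beta> \<le> C\<^sub>\<alpha> * 2 powr (- \<alpha>) / 2"
    proof -
      have "2 * 2 powr \<alpha> * C\<^sub>\<beta> / C\<^sub>\<alpha> = exp (ln (2 * 2 powr \<alpha> * C\<^sub>\<beta> / C\<^sub>\<alpha>))" using pos by simp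
      also have "\<dots> \<le> exp \<kappa>" by (simp add: \<kappa>_def)
      finally show ?thesis using pos by (simp add: exp_minus powr_minus field_simps)
    qed
    show "\<exists>C x\<^sub>0. C > 0 \<and> x\<^sub>0 > 0 \<and>
            (\<forall>x\<ge>x\<^sub>0. ennreal (C * x powr \<alpha>) \<le> counting_function D A x \<and>
                     counting_function D A x \<le> ennreal (exp 1 * C\<^sub>\<beta> * x powr \<beta>))"
    proof (rule finish[OF k])
      have lim: "((\<lambda>x::real. 2 * (\<kappa> / x)) \<longlongrightarrow> 0) at_top" by real_asymp
      have ev1: "\<forall>\<^sub>F x in at_top. 2 * (\<kappa> / x) < t\<^sub>0"
        by (rule order_tendstoD(2)[OF lim pos(5)])
      have ev2: "\<forall>\<^sub>F x in at_top. 2 * (\<kappa> / x) < 1"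
        by (rule order_tendstoD(2)[OF lim]) simp
      show "\<forall>\<^sub>F x in at_top. \<exists>\<tau>. 0 < \<tau> \<and> 2 * \<tau> < t\<^sub>0 \<and> 2 * \<tau> \<le> 1 \<and>
         k * x powr \<alpha> \<le> C\<^sub>\<alpha> * (2 * \<tau>) powr (- \<alpha>) - exp (- (\<tau> * x)) * (C\<^sub>\<beta> * \<tau> powr (- \<beta>))"
        using ev1 ev2 eventually_gt_at_top[of 0]
      proof eventually_elim
        case (elim x)
        define \<tau> where "\<tau> = \<kappa> / x"
        have \<tau>: "\<tau> > 0" "\<tau> * x = \<kappa>" using \<kappa> elim(3) by (simp_all add: \<tau>_def)
        have \<tau>_powr: "\<tau> powr (- \<alpha>) = \<kappa> powr (- \<alpha>) * x powr \<alpha>"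
          unfolding \<tau>_def using \<kappa> elim(3) by (intro powr_minus_quotient) auto
        have "exp (- (\<tau> * x)) * (C\<^sub>\<beta> * \<tau> powr (- \<beta>)) = (exp (- \<kappa>) * C\<^sub>\<beta>) * (\<kappa> powr (- \<alpha>) * x powr \<alpha>)"
          by (simp add: \<tau>(2) ba \<tau>_powr)
        also have "\<dots> \<le> (C\<^sub>\<alpha> * 2 powr (- \<alpha>) / 2) * (\<kappa> powr (- \<alpha>) * x powr \<alpha>)"
          by (intro mult_right_mono small) auto
        also have "\<dots> = k * x powr \<alpha>" by (simp add: k_def)
        finally have "exp (- (\<tau> * x)) * (C\<^sub>\<beta> * \<tau> powr (- \<beta>)) \<le> k * x powr \<alpha>" .
        moreover have "C\<^sub>\<alpha> * (2 * \<tau>) powr (- \<alpha>) = 2 * (k * x powr \<alpha>)"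
          using \<tau>(1) by (simp add: powr_mult \<tau>_powr k_def)
        ultimately have "k * x powr \<alpha> \<le> C\<^sub>\<alpha> * (2 * \<tau>) powr (- \<alpha>) - exp (- (\<tau> * x)) * (C\<^sub>\<beta> * \<tau> powr (- \<beta>))"
          by linarith
        then show ?case
          using \<tau>(1) elim(1,2) unfolding \<tau>_def[symmetric] by (intro exI[of _ \<tau>]) auto
      qed
    qed
  qed
qed

end
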